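(* Let $p\geq 0$, $k\geq p+1$, and let $G$ be a balanced bipartite graph of order $2n$ with minimum degree $\delta(G)\geq k$. (i) If $k=p+2$, $n\geq 2k^2+3$, and $\rho(G)\geq \rho(N_{n,n}^{k-2,1})$, then $G$ is $2p$-Hamilton-biconnected unless $G= N_{n,n}^{k-2,1}$. (ii) If $k\neq p+2$, $n\geq (k+2)(k-p+1)$, and $\rho(G)\geq \rho(M_{n,n}^{n-k,k-p})$, then $G$ is $2p$-Hamilton-biconnected unless $G= M_{n,n}^{n-k,k-p}$.
   Context: $\rho(G)$ is the spectral radius (largest eigenvalue of the adjacency matrix) of $G$. A bipartite graph $G=(X,Y;E)$ is balanced if $|X|=|Y|$; it is Hamilton-biconnected if for every $u\in X$, $v\in Y$ there is a Hamiltonian path with ends $u,v$. A vertex set $W$ is balanced if $|W\cap X|=|W\cap Y|$; $G$ is $2p$-Hamilton-biconnected if for every balanced $W$ with $|W|=2p$, the subgraph induced by $V(G)\setminus W$ is Hamilton-biconnected. $M_{n,m}^{s,t}$: parts $X=X_1\cup X_2$, $Y=Y_1\cup Y_2$, $|X_1|=s$, $|X_2|=n-s$, $|Y_1|=m-t$, $|Y_2|=t$; edges are all pairs between $X_1$ and $Y_1$, between $X_2$ and $Y_1$, and between $X_2$ and $Y_2$. $N_{n,n}^{q,1}$: parts $X=X_1\cup X_2\cup X_3$, $Y=Y_1\cup Y_2\cup Y_3$, $|X_1|=|Y_1|=n-q-2$, $|X_2|=|Y_2|=q+1$, $|X_3|=|Y_3|=1$; edges are all pairs between $X_i$ and $Y_i$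 ($i=1,2,3$), between $X_1$ and $Y_2$, between $X_2$ and $Y_1\cup Y_3$, and between $X_3$ and $Y_2$. "$G=H$" means isomorphic. *)

theory Defs
  imports Complex_Main "Jordan_Normal_Form.Char_Poly"
begin

definition simple_graph :: "nat \<Rightarrow> (nat \<Rightarrow> nat \<Rightarrow> bool) \<Rightarrow> bool" where
  "simple_graph N E \<longleftrightarrow>
     (\<forall>i j. E i j \<longrightarrow> i < N \<and> j < N) \<and> (\<forall>i j. E i j \<longrightarrow> E j i) \<and> (\<forall>i. \<not> E i i)"

(* bipartite graph G=(X,Y;E) with Y = {0..<N} - X *)
definition bipartite_graph :: "nat \<Rightarrow> nat set \<Rightarrow> (nat \<Rightarrow> nat \<Rightarrow> bool) \<Rightarrow> bool" where
  "bipartite_graph N X E \<longleftrightarrow> simple_graph N E \<and> X \<subseteq> {0..<N} \<and>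
     (\<forall>i j. E i j \<longrightarrow> (i \<in> X \<longleftrightarrow> j \<notin> X))"

definition degree :: "nat \<Rightarrow> (nat \<Rightarrow> nat \<Rightarrow> bool) \<Rightarrow> nat \<Rightarrow> nat" where
  "degree N E v = card {w \<in> {0..<N}. E v w}"

definition min_degree_ge :: "nat \<Rightarrow> (nat \<Rightarrow> nat \<Rightarrow> bool) \<Rightarrow> nat \<Rightarrow> bool" where
  "min_degree_ge N E k \<longleftrightarrow> (\<forall>v<N. degree N E v \<ge> k)"

definition adj_matrix :: "nat \<Rightarrow> (nat \<Rightarrow> nat \<Rightarrow> bool) \<Rightarrow> real mat" where
  "adj_matrix N E = mat N N (\<lambda>(i, j). if E i j then 1 else 0)"

definition spectral_radius_graph :: "nat \<Rightarrow> (nat \<Rightarrow> nat \<Rightarrow> bool) \<Rightarrow> real" where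
  "spectral_radius_graph N E = Max {ev. eigenvalue (adj_matrix N E) ev}"

definition ham_path :: "(nat \<Rightarrow> nat \<Rightarrow> bool) \<Rightarrow> nat set \<Rightarrow> nat \<Rightarrow> nat \<Rightarrow> bool" where
  "ham_path E S u v \<longleftrightarrow> (\<exists>ps. ps \<noteq> [] \<and> distinct ps \<and> set ps = S \<and> hd ps = u \<and> last ps = v \<and>
      (\<forall>i. Suc i < length ps \<longrightarrow> E (ps ! i) (ps ! Suc i)))"

definition hamilton_biconnected :: "nat set \<Rightarrow> (nat \<Rightarrow> nat \<Rightarrow> bool) \<Rightarrow> nat set \<Rightarrow> bool" where
  "hamilton_biconnected X E S \<longleftrightarrow> (\<forall>u \<in> S \<inter> X. \<forall>v \<in> S - X. ham_path E S u v)"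

definition hamilton_biconnected_2p :: "nat \<Rightarrow> nat set \<Rightarrow> (nat \<Rightarrow> nat \<Rightarrow> bool) \<Rightarrow> nat \<Rightarrow> bool" where
  "hamilton_biconnected_2p N X E p \<longleftrightarrow>
     (\<forall>W. W \<subseteq> {0..<N} \<longrightarrow> card (W \<inter> X) = card (W - X) \<longrightarrow> card W = 2 * p \<longrightarrow>
          hamilton_biconnected X E ({0..<N} - W))"

definition graph_iso :: "nat \<Rightarrow> (nat \<Rightarrow> nat \<Rightarrow> bool) \<Rightarrow> (nat \<Rightarrow> nat \<Rightarrow> bool) \<Rightarrow> bool" where
  "graph_iso N E E' \<longleftrightarrow> (\<exists>f. bij_betw f {0..<N} {0..<N} \<and>
      (\<forall>i<N. \<forall>j<N. E i j \<longleftrightarrow> E' (f i) (f j)))"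

definition M_graph :: "nat \<Rightarrow> nat \<Rightarrow> nat \<Rightarrow> nat \<Rightarrow> nat \<Rightarrow> nat \<Rightarrow> bool" where
  "M_graph n m s t i j \<longleftrightarrow>
     (let X1 = {0..<s}; X2 = {s..<n}; Y1 = {n..<n+(m-t)}; Y2 = {n+(m-t)..<n+m};
          adj = (\<lambda>x y. (x \<in> X1 \<and> y \<in> Y1) \<or> (x \<in> X2 \<and> y \<in> Y1) \<or> (x \<in> X2 \<and> y \<in> Y2))
      in adj i j \<or> adj j i)"

definition N_graph :: "nat \<Rightarrow> nat \<Rightarrow> nat \<Rightarrow> nat \<Rightarrow> bool" where
  "N_graph n q i j \<longleftrightarrow>
     (let X1 = {0..<n-q-2}; X2 = {n-q-2..<n-1}; X3 = {n-1};
          Y1 = (\<lambda>x. x + n) ` X1; Y2 = (\<lambda>x. x + n) ` X2; Y3 = {2*n-1};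
          adj = (\<lambda>x y. (x \<in> X1 \<and> y \<in> Y1) \<or> (x \<in> X2 \<and> y \<in> Y2) \<or> (x \<in> X3 \<and> y \<in> Y3) \<or>
                       (x \<in> X1 \<and> y \<in> Y2) \<or> (x \<in> X2 \<and> y \<in> Y1 \<union> Y3) \<or> (x \<in> X3 \<and> y \<in> Y2))
      in adj i j \<or> adj j i)"

end

theory Submission
  imports Defs "HOL-Analysis.Function_Topology" "HOL-Analysis.Convex" "Jordan_Normal_Form.Spectral_Radius"
begin

text \<open>The square of the spectral radius of a bipartite graph is at most its number of edges, so the spectral
  hypothesis leaves fewer than \<open>n (k - p)\<close> non-edges between the two sides. Delete a balanced set of \<open>2 p\<close>
  vertices, put \<open>t = k - p\<close>, and close the remaining graph under joining non-adjacent vertices of the two sides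
  whose degrees sum to at least \<open>n - p + 2\<close>; this does not affect the existence of Hamiltonian paths between
  given ends. Counting non-edges in the closure, every non-adjacent pair contains a vertex of degree at most
  \<open>t + 1\<close>, and there are at most \<open>t\<close> such vertices. Either their neighbourhoods are rich enough to
  thread all of them into a Hamiltonian path with prescribed ends, or the original graph lies in \<open>M\<close> or,
  for \<open>t = 2\<close>, in \<open>N\<close>, or has two vertices of degree at most \<open>k\<close> on one side. The last
  alternative (which contains the case \<open>M\<close> for \<open>t = 2\<close>) forces the spectral radius to be at most
  \<open>n - 1\<close>, less than that of \<open>N\<close>. In the others a non-negative maximiser of the Rayleigh quotient
  of the graph is a positive eigenvector of \<open>M\<close> or \<open>N\<close>, which leaves no room for a missing edge.\<close>

section \<open>Alternating paths\<close>

text \<open>Write \<open>t = k - p\<close>. The size bound in (ii) is the point from which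
  \<open>n t\<close> non-edges are few enough: \<open>n t <= (t + 1) (n - k - 2)\<close> holds
  exactly when \<open>n >= (k + 2) (t + 1)\<close>, and the right-hand side is the cost of
  \<open>t + 1\<close> vertices of degree \<open>t + 2\<close> on one side after the deletion, the
  first configuration that the closure argument cannot tolerate. For \<open>t = 2\<close> counting
  edges cannot finish: \<open>N\<close> and the graph with two vertices of degree \<open>k\<close>
  on one side both miss \<open>2 (n - k)\<close> edges. They are separated spectrally:
  \<open>N\<close> contains a complete bipartite graph with \<open>n - 1\<close> vertices per side
  and a further edge, which puts its radius above \<open>n - 1\<close>;
  \<open>n >= 2 k^2 + 3\<close> makes the opposite estimate for the other graph work. The obstacle
  in building paths is the prescribed ends. Vertices are brought in by detours, but a detour changes
  neither the first nor the last vertex, so \<open>v\<close> has to lie on the base path from the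
  beginning and a low \<open>u\<close> has to be attached in front. Most case distinctions about
  paths come from this.\<close>

lemma ham_path_iff_successively:
  "ham_path E S u v \<longleftrightarrow>
     (\<exists>ps. ps \<noteq> [] \<and> distinct ps \<and> set ps = S \<and> hd ps = u \<and> last ps = v \<and> successively E ps)"
proof -
  have "successively E ps \<longleftrightarrow> (\<forall>i. Suc i < length ps \<longrightarrow> E (ps ! i) (ps ! Suc i))" for ps
  proof (induction ps rule: induct_list012)
    case (3 x y zs)
    then show ?case
      by (auto simp: nth_Cons split: nat.splits)
  qed auto
  then show ?thesis unfolding ham_path_def by simp
qed

lemma ham_path_rev:
  assumes "ham_path E S u v" "symp E"
  shows "ham_path E S v u"
proof -
  obtain ps where ps: "ps \<noteq> []" "distinct ps" "set ps = S" "hd ps = u" "last ps = v" "successively E ps"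
    using assms(1) by (auto simp: ham_path_iff_successively)
  have "successively E (rev ps)"
    using ps(6) assms(2) by (auto intro: successively_mono dest: sympD)
  then show ?thesis
    unfolding ham_path_iff_successively using ps
    by (intro exI[of _ "rev ps"]) (auto simp: hd_rev last_rev)
qed

text \<open>A path alternating between the two sides is recorded by the list of its \<open>Y\<close>-vertices together
  with the function \<open>\<pi>\<close> that sends each of them to its predecessor on the path.\<close>

definition alt_path :: "(nat \<Rightarrow> nat \<Rightarrow> bool) \<Rightarrow> nat \<Rightarrow> nat \<Rightarrow> (nat \<Rightarrow> nat) \<Rightarrow> nat set \<Rightarrow> bool" where
  "alt_path E u v \<pi> B \<longleftrightarrow>
     (\<exists>ys. ys \<noteq> [] \<and> distinct ys \<and> set ys = B \<and> last ys = v \<and> \<pi> (hd ys) = u \<and> inj_on \<pi> B \<and>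
        (\<forall>y\<in>B. E (\<pi> y) y) \<and> successively (\<lambda>a b. E a (\<pi> b)) ys)"

text \<open>Interleaving the two sides, each \<open>y\<close> preceded by \<open>\<pi> y\<close>,
  gives the vertex list; disjointness and the injectivity of \<open>\<pi>\<close> make it
  distinct.\<close>

lemma ham_path_alt_path:
  assumes "alt_path E u v \<pi> B" "\<pi> ` B = A" "A \<inter> B = {}"
  shows "ham_path E (A \<union> B) u v"
proof -
  obtain ys where ys: "ys \<noteq> []" "distinct ys" "set ys = B" "last ys = v" "\<pi> (hd ys) = u" "inj_on \<pi> B"
    "\<forall>y\<in>B. E (\<pi> y) y" "successively (\<lambda>a b. E a (\<pi> b)) ys"
    using assms(1) unfolding alt_path_def by blast
  define path where "path zs = concat (map (\<lambda>y. [\<pi> y, y]) zs)" for zs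
  have path_simps: "path [] = []" "path (z # zs) = \<pi> z # z # path zs" for z zs
    by (auto simp: path_def)
  have set_path: "set (path zs) = \<pi> ` set zs \<union> set zs" for zs
    by (auto simp: path_def)
  have hd_path: "zs \<noteq> [] \<Longrightarrow> hd (path zs) = \<pi> (hd zs)" for zs
    by (cases zs) (auto simp: path_simps)
  have path_Nil: "path zs = [] \<longleftrightarrow> zs = []" for zs
    by (cases zs) (auto simp: path_simps)
  have last_path: "zs \<noteq> [] \<Longrightarrow> last (path zs) = last zs" for zs
    by (induction zs) (auto simp: path_simps path_Nil)
  have "distinct (path zs)" if "distinct zs" "set zs \<subseteq> B" for zs
    using that
  proof (induction zs)
    case (Cons z zs)
    have "\<pi> z \<notin> \<pi> ` set zs"
      using Cons.prems ys(6) by (auto dest: inj_onD)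
    moreover have "\<pi> z \<notin> B" "z \<notin> \<pi> ` B"
      using Cons.prems assms(2,3) by auto
    ultimately show ?case
      using Cons by (auto simp: path_simps set_path)
  qed (simp add: path_simps)
  moreover have "successively E (path zs)"
    if "successively (\<lambda>a b. E a (\<pi> b)) zs" "set zs \<subseteq> B" for zs
    using that
  proof (induction zs)
    case (Cons z zs)
    then show ?case
      using ys(7) by (auto simp: path_simps successively_Cons hd_path path_Nil)
  qed (simp add: path_simps)
  ultimately show ?thesis
    unfolding ham_path_iff_successively using ys assms(2)
    by (intro exI[of _ "path ys"]) (auto simp: set_path hd_path last_path path_Nil)
qed

text \<open>The edge from \<open>\<pi> w\<close> to \<open>w\<close> is replaced by the detour \<open>\<pi> w, y, x, w\<close>.\<close>

lemma alt_path_insert: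
  assumes "alt_path E u v \<pi> B" "w \<in> B" "y \<notin> B" "x \<notin> \<pi> ` B" "E x w" "E x y" "E (\<pi> w) y" "symp E"
  shows "alt_path E u v (\<pi>(y := \<pi> w, w := x)) (insert y B)"
proof -
  obtain ys where ys: "ys \<noteq> []" "distinct ys" "set ys = B" "last ys = v" "\<pi> (hd ys) = u" "inj_on \<pi> B"
    "\<forall>y\<in>B. E (\<pi> y) y" "successively (\<lambda>a b. E a (\<pi> b)) ys"
    using assms(1) unfolding alt_path_def by blast
  obtain as bs where split: "ys = as @ w # bs"
    using assms(2) ys(3) by (auto dest: split_list)
  let ?p = "\<pi>(y := \<pi> w, w := x)"
  have ne: "y \<noteq> w" "w \<notin> set as" "w \<notin> set bs" "y \<notin> set as" "y \<notin> set bs"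
    using assms(2,3) ys(2,3) split by auto
  have same: "?p z = \<pi> z" if "z \<in> set as \<union> set bs" for z
    using that ne by auto
  have suc: "successively (\<lambda>a b. E a (\<pi> b)) as" "successively (\<lambda>a b. E a (\<pi> b)) (w # bs)"
    "as \<noteq> [] \<Longrightarrow> E (last as) (\<pi> w)"
    using ys(8) by (auto simp: split successively_append_iff)
  have "successively (\<lambda>a b. E a (?p b)) as"
    using suc(1) same by (auto intro: successively_mono simp del: fun_upd_apply)
  moreover have "successively (\<lambda>a b. E a (?p b)) (w # bs)"
  proof -
    have "successively (\<lambda>a b. E a (?p b)) bs"
      using suc(2) same by (auto intro: successively_mono simp: successively_Cons simp del: fun_upd_apply)
    moreover have "bs \<noteq> [] \<Longrightarrow> ?p (hd bs) = \<pi> (hd bs)"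
      using same by (auto simp del: fun_upd_apply)
    ultimately show ?thesis
      using suc(2) by (cases "bs = []") (simp_all add: successively_Cons del: fun_upd_apply)
  qed
  ultimately have suc': "successively (\<lambda>a b. E a (?p b)) (as @ y # w # bs)"
    using suc(3) ne sympD[OF assms(8) assms(6)] by (auto simp: successively_append_iff)
  \<comment> \<open>The value \<open>\<pi> w\<close> merely moves from \<open>w\<close> to
    \<open>y\<close>, so the single new value is \<open>x\<close>, which lies outside the old
    image.\<close>
  have "inj_on ?p (insert y B)"
  proof -
    have "\<pi> ` (B - {w}) = \<pi> ` B - {\<pi> w}"
      using assms(2) ys(6) by (auto simp: inj_on_def)
    moreover have "inj_on ?p (B - {w})"
    proof -
      have "inj_on ?p (B - {w}) \<longleftrightarrow> inj_on \<pi> (B - {w})"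
        using assms(3) by (intro inj_on_cong) auto
      then show ?thesis using ys(6) by (blast intro: inj_on_subset)
    qed
    moreover have "?p ` (B - {w}) = \<pi> ` (B - {w})"
      using assms(3) by (intro image_cong) auto
    ultimately have im: "?p ` (B - {w}) = \<pi> ` B - {\<pi> w}" and inj: "inj_on ?p (B - {w})"
      by simp_all
    have val: "?p y = \<pi> w" "?p w = x" "\<pi> w \<noteq> x"
      using ne(1) assms(2,4) by auto
    have "inj_on ?p (insert w (B - {w}))"
      unfolding inj_on_insert using inj im val(2) assms(4) by auto
    then have "inj_on ?p B" using assms(2) by (simp add: insert_absorb)
    moreover have "?p y \<notin> ?p ` B"
    proof -
      have "?p ` B = insert x (\<pi> ` B - {\<pi> w})"
        using im val(2) assms(2) by (metis image_insert insert_Diff)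
      then show ?thesis unfolding val(1) using val(3) by blast
    qed
    ultimately show ?thesis
      unfolding inj_on_insert using assms(3) by simp
  qed
  moreover have "\<forall>z\<in>insert y B. E (?p z) z"
    using ys(7) assms ne by auto
  moreover have "?p (hd (as @ y # w # bs)) = u"
    using ys(5) ne by (cases as) (auto simp: split)
  moreover have "last (as @ y # w # bs) = v"
    using ys(4) by (auto simp: split)
  moreover have "distinct (as @ y # w # bs)" "set (as @ y # w # bs) = insert y B"
    using ys(2,3) ne by (auto simp: split)
  ultimately show ?thesis
    unfolding alt_path_def using suc' by (intro exI[of _ "as @ y # w # bs"]) auto
qed

lemma image_alt_path_insert:
  assumes "w \<in> B" "y \<notin> B"
  shows "(\<pi>(y := \<pi> w, w := x)) ` insert y B = insert x (\<pi> ` B)"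
  using assms by (auto simp: image_iff)

text \<open>Detours keep the first vertex. A start that is not on the base path is attached in front
  instead: the path becomes \<open>x, y, u, ...\<close>.\<close>

lemma alt_path_Cons:
  assumes "alt_path E u v \<pi> B" "y \<notin> B" "x \<notin> \<pi> ` B" "E x y" "E y u"
  shows "alt_path E x v (\<pi>(y := x)) (insert y B)"
proof -
  obtain ys where ys: "ys \<noteq> []" "distinct ys" "set ys = B" "last ys = v" "\<pi> (hd ys) = u" "inj_on \<pi> B"
    "\<forall>y\<in>B. E (\<pi> y) y" "successively (\<lambda>a b. E a (\<pi> b)) ys"
    using assms(1) unfolding alt_path_def by blast
  let ?p = "\<pi>(y := x)"
  have same: "?p z = \<pi> z" if "z \<in> set ys" for z
    using that assms(2) ys(3) by auto
  have "successively (\<lambda>a b. E a (?p b)) ys"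
    using ys(8) same by (auto intro: successively_mono simp del: fun_upd_apply)
  moreover have "hd ys \<noteq> y" using ys(1,3) assms(2) by auto
  ultimately have "successively (\<lambda>a b. E a (?p b)) (y # ys)"
    using ys(5) assms(5) by (auto simp: successively_Cons)
  moreover have "inj_on ?p (insert y B)"
    using ys(6) assms(2,3) by (auto simp: inj_on_def image_iff)
  ultimately show ?thesis
    unfolding alt_path_def using ys assms
    by (intro exI[of _ "y # ys"]) auto
qed

text \<open>The complements of \<open>A\<close> and \<open>B\<close> are equinumerous, so any
  bijection between them completes \<open>g\<close>. A one-point \<open>A\<close> pins a single
  value; a larger one matches distinguished blocks of vertices.\<close>

lemma exists_bij_betw_extending:
  assumes "finite U" "finite V" "card U = card V" "A \<subseteq> U" "B \<subseteq> V" "bij_betw g A B"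
  shows "\<exists>f. bij_betw f U V \<and> (\<forall>a\<in>A. f a = g a)"
proof -
  have "card A = card B" using assms(6) by (rule bij_betw_same_card)
  then have "card (U - A) = card (V - B)"
    using assms by (simp add: card_Diff_subset finite_subset)
  then obtain h where h: "bij_betw h (U - A) (V - B)"
    using assms(1,2) by (metis finite_same_card_bij finite_Diff)
  let ?f = "\<lambda>a. if a \<in> A then g a else h a"
  have "bij_betw ?f (A \<union> (U - A)) (B \<union> (V - B))"
  proof (rule bij_betw_combine)
    show "bij_betw ?f A B" using assms(6) by (simp cong: bij_betw_cong)
    have "bij_betw ?f (U - A) (V - B) \<longleftrightarrow> bij_betw h (U - A) (V - B)"
      by (rule bij_betw_cong) auto
    then show "bij_betw ?f (U - A) (V - B)" using h by simp
  qed auto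
  moreover have "A \<union> (U - A) = U" "B \<union> (V - B) = V" using assms(4,5) by auto
  ultimately show ?thesis by (intro exI[of _ ?f]) auto
qed

text \<open>Every order of \<open>B\<close> that ends in \<open>v\<close> works, together with every
  bijection onto \<open>A\<close> that gives the first element the predecessor
  \<open>u\<close>.\<close>

lemma alt_path_complete:
  assumes "finite A" "finite B" "card A = card B" "u \<in> A" "v \<in> B" "symp E"
    and "\<And>a b. a \<in> A \<Longrightarrow> b \<in> B \<Longrightarrow> E a b"
  shows "\<exists>\<pi>. alt_path E u v \<pi> B \<and> \<pi> ` B = A"
proof -
  obtain zs where zs: "distinct zs" "set zs = B - {v}"
    using finite_distinct_list[of "B - {v}"] assms(2) by auto
  let ?ys = "zs @ [v]"
  have ys: "distinct ?ys" "set ?ys = B" using zs assms(5) by auto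
  moreover have "hd ?ys \<in> set ?ys" by (rule hd_in_set) simp
  ultimately have hd_B: "hd ?ys \<in> B" by simp
  have "bij_betw (\<lambda>_. u) {hd ?ys} {u}" by (simp add: bij_betw_def)
  then obtain \<pi> where \<pi>: "bij_betw \<pi> B A" "\<pi> (hd ?ys) = u"
    using exists_bij_betw_extending[of B A "{hd ?ys}" "{u}" "\<lambda>_. u"] assms hd_B by auto
  have mem: "\<pi> b \<in> A" if "b \<in> B" for b
    using \<pi>(1) that by (auto simp: bij_betw_def)
  have sorted: "sorted_wrt (\<lambda>a b. E a (\<pi> b)) ws" if "set ws \<subseteq> B" for ws
    using that
  proof (induction ws)
    case (Cons w ws)
    have "E w (\<pi> b)" if "b \<in> set ws" for b
      using sympD[OF assms(6) assms(7)[OF mem]] that Cons.prems by auto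
    then show ?case using Cons by simp
  qed simp
  have "successively (\<lambda>a b. E a (\<pi> b)) ?ys"
    by (rule successively_if_sorted_wrt, rule sorted) (use ys(2) in simp)
  moreover have "inj_on \<pi> B" "\<pi> ` B = A" using \<pi>(1) by (simp_all add: bij_betw_def)
  moreover have "\<forall>b\<in>B. E (\<pi> b) b" using mem assms(7) by blast
  moreover have "last ?ys = v" "?ys \<noteq> []" by simp_all
  ultimately show ?thesis
    unfolding alt_path_def using ys \<pi>(2) by blast
qed

text \<open>Inserting the vertices of \<open>L\<close> one after another, each in front of the previously inserted vertex.\<close>

lemma alt_path_chain:
  assumes "finite L" "finite C" "card L = card C" "alt_path E u v \<pi> B" "c \<in> B"
    and "C \<inter> B = {}" "L \<inter> \<pi> ` B = {}" "symp E"
    and "\<And>l y. l \<in> L \<Longrightarrow> y \<in> insert c C \<Longrightarrow> E l y" "\<And>y. y \<in> C \<Longrightarrow> E (\<pi> c) y"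
  shows "\<exists>\<pi>' d. alt_path E u v \<pi>' (B \<union> C) \<and> \<pi>' ` (B \<union> C) = \<pi> ` B \<union> L \<and> d \<in> insert c C \<and>
           \<pi>' d = \<pi> c \<and> (\<forall>b. b \<notin> insert c C \<longrightarrow> \<pi>' b = \<pi> b)"
  using assms
proof (induction L arbitrary: C \<pi> B c rule: finite_induct)
  case empty
  then have "C = {}" by simp
  then show ?case using empty by (intro exI[of _ \<pi>] exI[of _ c]) auto
next
  case (insert l L)
  from insert.prems(2) insert.hyps have "card C = Suc (card L)" by simp
  then obtain y C' where C: "C = insert y C'" "y \<notin> C'" "card C' = card L"
    by (auto simp: card_Suc_eq)
  \<comment> \<open>The detour is \<open>\<pi> c, y, l, c\<close>. The next one is made in front of
    \<open>y\<close>, whose predecessor is again the old \<open>\<pi> c\<close>; so one adjacency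
    hypothesis on \<open>\<pi> c\<close> serves the whole chain, and \<open>d\<close> is the vertex
    that it finally precedes.\<close>
  let ?p = "\<pi>(y := \<pi> c, c := l)"
  have y: "y \<notin> B" "y \<noteq> c" using insert.prems C by auto
  have sym: "E a b \<Longrightarrow> E b a" for a b using insert.prems(7) by (auto dest: sympD)
  have step: "alt_path E u v ?p (insert y B)"
    by (rule alt_path_insert) (use insert.prems C y sym in \<open>auto\<close>)
  have img: "?p ` insert y B = insert l (\<pi> ` B)"
    using insert.prems(4) y by (intro image_alt_path_insert) auto
  have "\<exists>\<pi>' d. alt_path E u v \<pi>' (insert y B \<union> C') \<and> \<pi>' ` (insert y B \<union> C') = ?p ` insert y B \<union> L \<and>
     d \<in> insert y C' \<and> \<pi>' d = ?p y \<and> (\<forall>b. b \<notin> insert y C' \<longrightarrow> \<pi>' b = ?p b)"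
  proof (rule insert.IH)
    show "finite C'" using insert.prems(1) C by simp
    show "card L = card C'" using C by simp
    show "L \<inter> ?p ` insert y B = {}" using img insert.prems(6) insert.hyps by auto
    show "E (?p y) z" if "z \<in> C'" for z using that y C insert.prems(9) by auto
    show "E m z" if "m \<in> L" "z \<in> insert y C'" for m z using that insert.prems(8) C by auto
    show "alt_path E u v ?p (insert y B)" by (rule step)
  qed (use insert.prems C in auto)
  then obtain \<pi>' d where r: "alt_path E u v \<pi>' (insert y B \<union> C')"
    "\<pi>' ` (insert y B \<union> C') = ?p ` insert y B \<union> L"
    "d \<in> insert y C'" "\<pi>' d = ?p y" "\<forall>b. b \<notin> insert y C' \<longrightarrow> \<pi>' b = ?p b" by blast
  have un: "insert y B \<union> C' = B \<union> C" using C by auto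
  show ?case
  proof (intro exI conjI)
    show "alt_path E u v \<pi>' (B \<union> C)" using r(1) un by simp
    show "\<pi>' ` (B \<union> C) = \<pi> ` B \<union> insert l L" using r(2) unfolding img un by simp
    show "d \<in> insert c C" using r(3) C by auto
    show "\<pi>' d = \<pi> c" using r(4) y by simp
    show "\<forall>b. b \<notin> insert c C \<longrightarrow> \<pi>' b = \<pi> b" using r(5) C by auto
  qed
qed

text \<open>Each \<open>l\<close> gets its own detour \<open>\<pi> (g l), f l, l, g l\<close>. They
  do not interfere because the vertices \<open>g l\<close> are distinct. The new predecessor of
  \<open>f l\<close> is recorded so that a further detour can be made there.\<close>

lemma alt_path_parallel:
  assumes "finite L" "alt_path E u v \<pi> B" "inj_on f L" "inj_on g L" "g ` L \<subseteq> B"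
    and "f ` L \<inter> B = {}" "L \<inter> \<pi> ` B = {}" "symp E"
    and "\<And>l. l \<in> L \<Longrightarrow> E l (f l)" "\<And>l. l \<in> L \<Longrightarrow> E l (g l)" "\<And>l. l \<in> L \<Longrightarrow> E (\<pi> (g l)) (f l)"
  shows "\<exists>\<pi>'. alt_path E u v \<pi>' (B \<union> f ` L) \<and> \<pi>' ` (B \<union> f ` L) = \<pi> ` B \<union> L \<and>
           (\<forall>l\<in>L. \<pi>' (f l) = \<pi> (g l)) \<and> (\<forall>b. b \<notin> f ` L \<union> g ` L \<longrightarrow> \<pi>' b = \<pi> b)"
  using assms
proof (induction L arbitrary: \<pi> B rule: finite_induct)
  case empty
  then show ?case by (intro exI[of _ \<pi>]) auto
next
  case (insert l L)
  let ?p = "\<pi>(f l := \<pi> (g l), g l := l)"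
  have sym: "E a b \<Longrightarrow> E b a" for a b using insert.prems(7) by (auto dest: sympD)
  have gl: "g l \<in> B" "f l \<notin> B" "f l \<noteq> g l" "g l \<notin> g ` L" "f l \<notin> f ` L" "f l \<notin> g ` L" "g l \<notin> f ` L"
    using insert by auto
  have step: "alt_path E u v ?p (insert (f l) B)"
    by (rule alt_path_insert) (use insert.prems gl sym in \<open>auto\<close>)
  have img: "?p ` insert (f l) B = insert l (\<pi> ` B)"
    using gl by (intro image_alt_path_insert) auto
  have ne: "g m \<noteq> f l" "g m \<noteq> g l" "f m \<noteq> f l" "f m \<noteq> g l" if "m \<in> L" for m
    using that gl by (metis imageI)+
  have same: "?p (g m) = \<pi> (g m)" "?p (f m) = \<pi> (f m)" if "m \<in> L" for m
    using ne[OF that] by auto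
  have "\<exists>\<pi>'. alt_path E u v \<pi>' (insert (f l) B \<union> f ` L) \<and>
      \<pi>' ` (insert (f l) B \<union> f ` L) = ?p ` insert (f l) B \<union> L \<and>
      (\<forall>l\<in>L. \<pi>' (f l) = ?p (g l)) \<and> (\<forall>b. b \<notin> f ` L \<union> g ` L \<longrightarrow> \<pi>' b = ?p b)"
  proof (rule insert.IH)
    show "L \<inter> ?p ` insert (f l) B = {}" using img insert.prems(6) insert.hyps by auto
    show "E (?p (g m)) (f m)" if "m \<in> L" for m using same[OF that] insert.prems(10) that by auto
    show "alt_path E u v ?p (insert (f l) B)" by (rule step)
  qed (use insert.prems gl in auto)
  then obtain \<pi>' where r: "alt_path E u v \<pi>' (insert (f l) B \<union> f ` L)"
      "\<pi>' ` (insert (f l) B \<union> f ` L) = ?p ` insert (f l) B \<union> L"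
      "\<forall>l\<in>L. \<pi>' (f l) = ?p (g l)" "\<forall>b. b \<notin> f ` L \<union> g ` L \<longrightarrow> \<pi>' b = ?p b" by blast
  have un: "insert (f l) B \<union> f ` L = B \<union> f ` insert l L" by auto
  show ?case
  proof (intro exI conjI)
    show "alt_path E u v \<pi>' (B \<union> f ` insert l L)" using r(1) un by simp
    show "\<pi>' ` (B \<union> f ` insert l L) = \<pi> ` B \<union> insert l L" using r(2) unfolding img un by simp
    show "\<forall>m\<in>insert l L. \<pi>' (f m) = \<pi> (g m)"
    proof
      fix m assume "m \<in> insert l L"
      then consider "m = l" | "m \<in> L" by blast
      then show "\<pi>' (f m) = \<pi> (g m)"
      proof cases
        case 1
        then show ?thesis using r(4) gl by auto
      next
        case 2
        then show ?thesis using r(3) same(1) by metis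
      qed
    qed
    show "\<forall>b. b \<notin> f ` insert l L \<union> g ` insert l L \<longrightarrow> \<pi>' b = \<pi> b" using r(4) by auto
  qed
qed

section \<open>Bipartite degree closure\<close>

text \<open>Relative to an explicit set, because vertices are deleted later while the relation stays
  the same.\<close>

definition deg_in :: "(nat \<Rightarrow> nat \<Rightarrow> bool) \<Rightarrow> nat set \<Rightarrow> nat \<Rightarrow> nat" where
  "deg_in E S v = card {w \<in> S. E v w}"

text \<open>\<open>E\<close> is not confined to \<open>X \<union> Y\<close>: deleting vertices just
  shrinks the two sets, without renumbering.\<close>

locale balanced_bipartite =
  fixes X Y :: "nat set" and E :: "nat \<Rightarrow> nat \<Rightarrow> bool"
  assumes finite_X: "finite X" and finite_Y: "finite Y" and disjoint: "X \<inter> Y = {}"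
    and card_eq: "card Y = card X" and symp_E: "symp E"
    and indep_X: "a \<in> X \<Longrightarrow> b \<in> X \<Longrightarrow> \<not> E a b"
    and indep_Y: "a \<in> Y \<Longrightarrow> b \<in> Y \<Longrightarrow> \<not> E a b"
begin

lemma sym_E: "E a b \<Longrightarrow> E b a"
  using symp_E by (auto dest: sympD)

lemma swap: "balanced_bipartite Y X E"
  using finite_X finite_Y disjoint card_eq symp_E indep_X indep_Y
  by unfold_locales auto

end

text \<open>The Bondy-Chvatal closure condition for balanced bipartite graphs. The degree sum that
  forces an edge is \<open>card X + 2\<close>, one more than for Hamiltonian cycles, since the path
  has prescribed ends.\<close>

definition degree_closed :: "nat set \<Rightarrow> nat set \<Rightarrow> (nat \<Rightarrow> nat \<Rightarrow> bool) \<Rightarrow> bool" where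
  "degree_closed X Y E \<longleftrightarrow>
     (\<forall>x\<in>X. \<forall>y\<in>Y. \<not> E x y \<longrightarrow> deg_in E Y x + deg_in E X y \<le> card X + 1)"

text \<open>Reversing the segment \<open>q # D\<close> lets \<open>p\<close> jump to its last vertex
  and \<open>q\<close> jump to \<open>r\<close>, so that the step from that last vertex to
  \<open>r\<close> is avoided.\<close>

lemma ham_path_reroute_left:
  assumes "distinct (C @ p # q # D @ r # B)" "successively E (C @ p # q # D)" "successively E (r # B)"
    and "E p (last (q # D))" "E q r" "symp E"
  shows "ham_path E (set (C @ p # q # D @ r # B)) (hd (C @ [p])) (last (r # B))"
proof -
  define R where "R = rev (q # D)"
  let ?ps = "(C @ [p]) @ R @ r # B"
  have sym: "successively (\<lambda>x y. E y x) (q # D)"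
    using assms(2,6) by (auto simp: successively_append_iff intro: successively_mono dest: sympD)
  have "successively E (C @ [p])" using assms(2) by (auto simp: successively_append_iff)
  moreover have "successively E R" unfolding R_def successively_rev by (rule sym)
  moreover have "E p (hd R)" using assms(4) by (simp only: hd_rev R_def)
  moreover have "E (last R) r" using assms(5) by (simp only: last_rev list.sel R_def)
  moreover have "R \<noteq> []" by (simp add: R_def)
  ultimately have "successively E ?ps"
    using assms(3) by (auto simp: successively_append_iff successively_Cons)
  moreover have "hd ?ps = hd (C @ [p])" by (cases C) auto
  moreover have "last ?ps = last (r # B)" by simp
  moreover have "distinct ?ps" using assms(1) by (auto simp: R_def)
  moreover have "set ?ps = set (C @ p # q # D @ r # B)" by (auto simp: R_def)
  ultimately show ?thesis
    unfolding ham_path_iff_successively by (intro exI[of _ ?ps]) auto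
qed

lemma split_at_consecutive:
  assumes "Suc l < length xs"
  shows "\<exists>C D. xs = C @ xs ! l # xs ! Suc l # D \<and> length C = l"
proof (intro exI conjI)
  show "xs = take l xs @ xs ! l # xs ! Suc l # drop (Suc (Suc l)) xs"
    using assms by (simp add: Cons_nth_drop_Suc id_take_nth_drop[symmetric])
qed (use assms in simp)

text \<open>The step from \<open>s\<close> to \<open>r\<close> is to be avoided; consecutive
  vertices adjacent to \<open>s\<close> and to \<open>r\<close>, respectively, permit a crossing
  exchange. \<open>l \<noteq> length A\<close> excludes the pair \<open>s\<close>, \<open>r\<close>
  itself.\<close>

lemma ham_path_reroute:
  assumes "distinct (A @ s # r # B)" "successively E (A @ [s])" "successively E (r # B)" "symp E"
    and "Suc l < length (A @ s # r # B)" "l \<noteq> length A"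
    and "E ((A @ s # r # B) ! l) s" "E ((A @ s # r # B) ! Suc l) r"
  shows "ham_path E (set (A @ s # r # B)) (hd (A @ [s])) (last (r # B))"
proof (cases "l < length A")
  case True
  let ?as = "A @ [s]"
  obtain C D where CD: "?as = C @ ?as ! l # ?as ! Suc l # D" "length C = l"
    using split_at_consecutive[of l ?as] True by auto
  have nth: "?as ! l = (A @ s # r # B) ! l" "?as ! Suc l = (A @ s # r # B) ! Suc l"
    using True by (auto simp: nth_append)
  define p q where "p = ?as ! l" and "q = ?as ! Suc l"
  have as: "?as = C @ p # q # D" using CD p_def q_def by simp
  have list: "A @ s # r # B = C @ p # q # D @ r # B"
    using arg_cong[OF as, of "\<lambda>z. z @ r # B"] by simp
  have last: "last (q # D) = s" using arg_cong[OF as, of last] by simp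
  have "ham_path E (set (C @ p # q # D @ r # B)) (hd (C @ [p])) (last (r # B))"
  proof (rule ham_path_reroute_left)
    show "distinct (C @ p # q # D @ r # B)" using assms(1) unfolding list .
    show "successively E (C @ p # q # D)" using assms(2) unfolding as .
    show "E p (last (q # D))" unfolding last p_def nth by (rule assms(7))
    show "E q r" unfolding q_def nth by (rule assms(8))
  qed fact+
  moreover have "hd (C @ [p]) = hd (A @ [s])" using as by (cases C) auto
  ultimately show ?thesis by (simp only: list)
next
  case False
  \<comment> \<open>The crossing pair lies behind \<open>r\<close>. In the reversed path it lies in
    front, with the roles of \<open>s\<close> and \<open>r\<close> exchanged.\<close>
  then have l: "l > length A" using assms(6) by simp
  let ?bs = "r # B"
  obtain j where j: "l = length A + Suc j" using l less_imp_Suc_add by auto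
  have nth: "?bs ! j = (A @ s # r # B) ! l" "?bs ! Suc j = (A @ s # r # B) ! Suc l"
    using j by (auto simp: nth_append)
  obtain C D where CD: "?bs = C @ ?bs ! j # ?bs ! Suc j # D"
    using split_at_consecutive[of j ?bs] j assms(5) by auto
  define p q where "p = ?bs ! j" and "q = ?bs ! Suc j"
  have bs: "?bs = C @ p # q # D" using CD p_def q_def by simp
  have rev_bs: "rev ?bs = rev D @ q # p # rev C" using bs by simp
  have list: "rev (A @ s # r # B) = rev D @ q # p # rev C @ s # rev A"
    using rev_bs by simp
  have sym: "E a b \<Longrightarrow> E b a" for a b using assms(4) by (auto dest: sympD)
  have "ham_path E (set (rev D @ q # p # rev C @ s # rev A)) (hd (rev D @ [q])) (last (s # rev A))"
  proof (rule ham_path_reroute_left)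
    show "distinct (rev D @ q # p # rev C @ s # rev A)" 
      using assms(1) list by (metis distinct_rev)
    have "successively E (rev ?bs)" unfolding successively_rev
      by (rule successively_mono[OF assms(3)]) (use sym in auto)
    then show "successively E (rev D @ q # p # rev C)" using rev_bs by simp
    have "successively E (rev (A @ [s]))" unfolding successively_rev
      by (rule successively_mono[OF assms(2)]) (use sym in auto)
    then show "successively E (s # rev A)" by simp
    have "last (p # rev C) = r"
      using arg_cong[OF bs, of hd] by (cases C) auto
    then show "E q (last (p # rev C))" using assms(8) nth q_def by simp
    show "E p s" using assms(7) nth p_def by simp
  qed fact
  moreover have "hd (rev D @ [q]) = last (r # B)"
    unfolding bs by (cases D rule: rev_cases) auto
  moreover have "last (s # rev A) = hd (A @ [s])" by (cases A) auto
  moreover have "set (rev D @ q # p # rev C @ s # rev A) = set (A @ s # r # B)"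
    unfolding list[symmetric] by (rule set_rev)
  ultimately show ?thesis
    using ham_path_rev[OF _ assms(4)] by metis
qed

lemma (in balanced_bipartite) alternating_nth:
  assumes "successively E ps" "set ps \<subseteq> X \<union> Y" "hd ps \<in> X" "l < length ps"
  shows "ps ! l \<in> X \<longleftrightarrow> even l"
  using assms(4)
proof (induction l)
  case 0
  then show ?case using assms(3) by (simp add: hd_conv_nth)
next
  case (Suc l)
  obtain C D where "ps = C @ ps ! l # ps ! Suc l # D"
    using split_at_consecutive[OF Suc.prems] by blast
  then have "E (ps ! l) (ps ! Suc l)"
    using assms(1) by (metis successively_append_iff successively.simps(3))
  moreover have "ps ! l \<in> X \<union> Y" "ps ! Suc l \<in> X \<union> Y"
    using Suc.prems assms(2) nth_mem by (metis Suc_lessD subsetD)+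
  ultimately have "ps ! Suc l \<in> X \<longleftrightarrow> ps ! l \<notin> X"
    using indep_X indep_Y by blast
  then show ?case using Suc by simp
qed

definition add_edge :: "(nat \<Rightarrow> nat \<Rightarrow> bool) \<Rightarrow> nat \<Rightarrow> nat \<Rightarrow> nat \<Rightarrow> nat \<Rightarrow> bool" where
  "add_edge E x y a b \<longleftrightarrow> E a b \<or> (a = x \<and> b = y) \<or> (a = y \<and> b = x)"

lemma successively_split_failure:
  assumes "successively Q ps" "\<not> successively P ps"
  shows "\<exists>A s r B. ps = A @ s # r # B \<and> Q s r \<and> \<not> P s r"
  using assms
proof (induction ps rule: induct_list012)
  case (3 x y zs)
  show ?case
  proof (cases "P x y")
    case True
    then obtain A s r B where "y # zs = A @ s # r # B" "Q s r" "\<not> P s r"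
      using 3 by auto
    then show ?thesis by (intro exI[of _ "x # A"]) auto
  next
    case False
    then show ?thesis using 3 by (intro exI[of _ "[]"]) auto
  qed
qed auto

text \<open>Read cyclically, the path has \<open>card X\<close> consecutive pairs that start on the side opposite to \<open>s\<close>. By
  the degree condition at least two of them join a neighbour of \<open>s\<close> to a neighbour of \<open>r\<close>, so one of
  these does not wrap around.\<close>

lemma (in balanced_bipartite) ham_path_add_edge:
  assumes xy: "x \<in> X" "y \<in> Y" "deg_in E Y x + deg_in E X y \<ge> card X + 2"
    and path: "ham_path (add_edge E x y) (X \<union> Y) u v" and uv: "u \<in> X" "v \<in> Y"
  shows "ham_path E (X \<union> Y) u v"
proof -
  interpret F: balanced_bipartite X Y "add_edge E x y"
    using finite_X finite_Y disjoint card_eq indep_X indep_Y xy sym_E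
    by unfold_locales (auto simp: add_edge_def symp_def)
  obtain ps where ps: "ps \<noteq> []" "distinct ps" "set ps = X \<union> Y" "hd ps = u" "last ps = v"
    "successively (add_edge E x y) ps"
    using path by (auto simp: ham_path_iff_successively)
  have len: "length ps = 2 * card X"
    using distinct_card[OF ps(2)] ps(3) finite_X finite_Y disjoint card_eq by (simp add: card_Un_disjoint)
  have cX: "card X > 0" using uv(1) finite_X by (auto simp: card_gt_0_iff)
  have alt: "ps ! l \<in> X \<longleftrightarrow> even l" if "l < length ps" for l
    using F.alternating_nth[of ps l] ps uv that by auto
  show ?thesis
  proof (cases "successively E ps")
    case True
    then show ?thesis using ps by (auto simp: ham_path_iff_successively)
  next
    case False
    obtain A s r B where split: "ps = A @ s # r # B" "add_edge E x y s r" "\<not> E s r"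
      using successively_split_failure[OF ps(6) False] by blast
    have sr: "(s = x \<and> r = y) \<or> (s = y \<and> r = x)"
      using split by (auto simp: add_edge_def)
    \<comment> \<open>A distinct path traverses the added edge only once, so both halves are paths
      of \<open>E\<close>.\<close>
    have E_left: "successively E (A @ [s])"
    proof (rule successively_mono)
      show "successively (add_edge E x y) (A @ [s])"
        using ps(6) split(1) by (auto simp: successively_append_iff)
      show "E a b" if "a \<in> set (A @ [s])" "b \<in> set (A @ [s])" "add_edge E x y a b" for a b
        using that ps(2) split(1) sr by (auto simp: add_edge_def)
    qed
    have E_right: "successively E (r # B)"
    proof (rule successively_mono)
      show "successively (add_edge E x y) (r # B)"
        using ps(6) split(1) by (auto simp: successively_append_iff)
      show "E a b" if "a \<in> set (r # B)" "b \<in> set (r # B)" "add_edge E x y a b" for a b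
        using that ps(2) split(1) sr by (auto simp: add_edge_def)
    qed
    let ?n = "length ps"
    \<comment> \<open>Positions of neighbours of \<open>s\<close>, and positions whose cyclic
      successor is a neighbour of \<open>r\<close>. Both sets lie in \<open>?J\<close>, which has
      \<open>card X\<close> elements.\<close>
    let ?K1 = "{l. l < ?n \<and> E (ps ! l) s}"
    let ?K2 = "{l. l < ?n \<and> E (ps ! (Suc l mod ?n)) r}"
    let ?J = "{l. l < ?n \<and> (ps ! l \<in> X \<longleftrightarrow> s \<notin> X)}"
    have mem: "s \<in> X \<union> Y" "r \<in> X \<union> Y" "s \<in> X \<longleftrightarrow> r \<notin> X"
      using sr xy disjoint by auto
    have nbr: "a \<in> X \<longleftrightarrow> b \<notin> X" if "E a b" "a \<in> X \<union> Y" "b \<in> X \<union> Y" for a b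
      using that indep_X indep_Y by blast
    have nth: "ps ! l \<in> X \<union> Y" if "l < ?n" for l
      using that ps(3) nth_mem by blast
    have bij_nth: "bij_betw ((!) ps) {..<?n} (X \<union> Y)"
      using ps(2,3) by (metis bij_betw_nth)
    have bij_suc: "bij_betw (\<lambda>l. Suc l mod ?n) {..<?n} {..<?n}"
    proof -
      have "inj_on (\<lambda>l. Suc l mod ?n) {..<?n}"
        by (auto simp: inj_on_def mod_Suc split: if_splits)
      moreover have "(\<lambda>l. Suc l mod ?n) ` {..<?n} \<subseteq> {..<?n}" using len cX by auto
      ultimately show ?thesis
        by (simp add: bij_betw_def endo_inj_surj)
    qed
    have bij_suc_nth: "bij_betw (\<lambda>l. ps ! (Suc l mod ?n)) {..<?n} (X \<union> Y)"
      using bij_betw_trans[OF bij_suc bij_nth] by (simp add: comp_def)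
    have cardP: "card {l. l < ?n \<and> P (g l)} = card {z \<in> X \<union> Y. P z}"
      if "bij_betw g {..<?n} (X \<union> Y)" for g P
    proof -
      have "bij_betw g {l. l < ?n \<and> P (g l)} {z \<in> X \<union> Y. P z}"
        using that unfolding bij_betw_def by (auto intro: inj_on_subset)
      then show ?thesis by (rule bij_betw_same_card)
    qed
    have degE: "card {z \<in> X \<union> Y. E z w} = (if w \<in> X then deg_in E Y w else deg_in E X w)"
      if "w \<in> X \<union> Y" for w
    proof -
      have "{z \<in> X \<union> Y. E z w} = {z \<in> Y. E w z}" if "w \<in> X"
        using that sym_E indep_X by blast
      moreover have "{z \<in> X \<union> Y. E z w} = {z \<in> X. E w z}" if "w \<in> Y"
        using that sym_E indep_Y by blast
      moreover have "w \<in> Y" if "w \<notin> X" using that \<open>w \<in> X \<union> Y\<close> by blast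
      ultimately show ?thesis unfolding deg_in_def by presburger
    qed
    have "card ?K1 + card ?K2 \<ge> card X + 2"
      unfolding cardP[OF bij_nth, of "\<lambda>z. E z s"] cardP[OF bij_suc_nth, of "\<lambda>z. E z r"]
      using degE[OF mem(1)] degE[OF mem(2)] sr xy disjoint by auto
    moreover have "card ?J = card X"
    proof -
      have "card ?J = card {z \<in> X \<union> Y. z \<in> X \<longleftrightarrow> s \<notin> X}" by (rule cardP[OF bij_nth])
      also have "{z \<in> X \<union> Y. z \<in> X \<longleftrightarrow> s \<notin> X} = (if s \<in> X then Y else X)"
        using disjoint by auto
      finally show ?thesis using card_eq by simp
    qed
    moreover have "?K1 \<union> ?K2 \<subseteq> ?J"
    proof -
      have "?K1 \<subseteq> ?J" using nbr nth mem by auto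
      moreover have "l \<in> ?J" if l: "l \<in> ?K2" for l
      proof -
        have m: "Suc l mod ?n < ?n" using len cX by simp
        have "ps ! (Suc l mod ?n) \<in> X \<longleftrightarrow> r \<notin> X" using l nbr nth[OF m] mem by auto
        \<comment> \<open>Parity flips at the wrap-around too, since the length
          \<open>2 * card X\<close> is even.\<close>
        moreover have "even (Suc l mod ?n) \<longleftrightarrow> odd l"
          using l len by (auto simp: mod_Suc) presburger
        ultimately show ?thesis using alt[OF m] alt[of l] l mem by auto
      qed
      ultimately show ?thesis by blast
    qed
    then have "card (?K1 \<union> ?K2) \<le> card ?J" by (intro card_mono) auto
    moreover have "card (?K1 \<union> ?K2) + card (?K1 \<inter> ?K2) = card ?K1 + card ?K2"
      using card_Un_Int[of ?K1 ?K2] by simp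
    ultimately have "card (?K1 \<inter> ?K2) \<ge> 2" by linarith
    then have "\<not> ?K1 \<inter> ?K2 \<subseteq> {?n - 1}"
      using card_mono[of "{?n - 1}" "?K1 \<inter> ?K2"] by auto
    then obtain l where l: "l < ?n" "l \<noteq> ?n - 1" "E (ps ! l) s" "E (ps ! (Suc l mod ?n)) r" by blast
    then have Sl: "Suc l < ?n" "E (ps ! Suc l) r" by auto
    have "l \<noteq> length A" using l(3) split(1) indep_X indep_Y mem(1) by auto
    then have "ham_path E (set (A @ s # r # B)) (hd (A @ [s])) (last (r # B))"
      using E_left E_right symp_E ps(2) Sl l(3) unfolding split(1)
      by (intro ham_path_reroute[where l = l]) auto
    moreover have "hd (A @ [s]) = u" "last (r # B) = v" "set (A @ s # r # B) = X \<union> Y"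
      using ps(3-5) split(1) by (auto simp: hd_append)
    ultimately show ?thesis by simp
  qed
qed

text \<open>Adding an edge wherever closedness fails terminates, as the number of non-adjacent pairs
  drops; each single addition is harmless by \<open>ham_path_add_edge\<close>.\<close>

lemma (in balanced_bipartite) closure_exists:
  "\<exists>H. balanced_bipartite X Y H \<and> degree_closed X Y H \<and> (\<forall>a b. E a b \<longrightarrow> H a b) \<and>
     (\<forall>u\<in>X. \<forall>v\<in>Y. ham_path H (X \<union> Y) u v \<longrightarrow> ham_path E (X \<union> Y) u v)"
  using balanced_bipartite_axioms
proof (induction "card {z \<in> X \<times> Y. \<not> E (fst z) (snd z)}" arbitrary: E rule: less_induct)
  case less
  interpret balanced_bipartite X Y E by (rule less.prems)
  show ?case
  proof (cases "degree_closed X Y E")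
    case True
    then show ?thesis using less.prems by blast
  next
    case False
    then obtain x y where xy: "x \<in> X" "y \<in> Y" "\<not> E x y" "deg_in E Y x + deg_in E X y \<ge> card X + 2"
      unfolding degree_closed_def by (metis add_2_eq_Suc' add.right_neutral add_Suc_right not_less_eq_eq One_nat_def)
    let ?F = "add_edge E x y"
    have F: "balanced_bipartite X Y ?F"
      using finite_X finite_Y disjoint card_eq indep_X indep_Y xy sym_E
      by unfold_locales (auto simp: add_edge_def symp_def)
    have "card {z \<in> X \<times> Y. \<not> ?F (fst z) (snd z)} < card {z \<in> X \<times> Y. \<not> E (fst z) (snd z)}"
    proof (rule psubset_card_mono)
      show "finite {z \<in> X \<times> Y. \<not> E (fst z) (snd z)}" using finite_X finite_Y by auto
      have "(x, y) \<in> {z \<in> X \<times> Y. \<not> E (fst z) (snd z)}" "(x, y) \<notin> {z \<in> X \<times> Y. \<not> ?F (fst z) (snd z)}"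
        using xy by (auto simp: add_edge_def)
      moreover have "{z \<in> X \<times> Y. \<not> ?F (fst z) (snd z)} \<subseteq> {z \<in> X \<times> Y. \<not> E (fst z) (snd z)}"
        by (auto simp: add_edge_def)
      ultimately show "{z \<in> X \<times> Y. \<not> ?F (fst z) (snd z)} \<subset> {z \<in> X \<times> Y. \<not> E (fst z) (snd z)}"
        by blast
    qed
    from less.hyps[OF this F] obtain H where H: "balanced_bipartite X Y H" "degree_closed X Y H"
      "\<forall>a b. ?F a b \<longrightarrow> H a b" "\<forall>u\<in>X. \<forall>v\<in>Y. ham_path H (X \<union> Y) u v \<longrightarrow> ham_path ?F (X \<union> Y) u v"
      by blast
    then show ?thesis
      using ham_path_add_edge[OF xy(1,2,4)] by (intro exI[of _ H]) (auto simp: add_edge_def)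
  qed
qed

section \<open>Threading low-degree vertices into a path\<close>

lemma (in balanced_bipartite) ham_path_all:
  assumes "alt_path E u v \<pi> Y" "\<pi> ` Y = X"
  shows "ham_path E (X \<union> Y) u v"
  using ham_path_alt_path[OF assms disjoint] .

text \<open>The end \<open>v\<close> cannot be brought in by a detour. At the only place where
  \<open>f\<close> would do so, the two neighbours trade roles.\<close>

lemma exchange_avoiding:
  assumes "inj_on f M" "inj_on g M" "f ` M \<inter> g ` M = {}"
  shows "\<exists>f' g'. inj_on f' M \<and> inj_on g' M \<and> f' ` M \<inter> g' ` M = {} \<and> v \<notin> f' ` M \<and>
    (\<forall>l\<in>M. f' l \<in> {f l, g l} \<and> g' l \<in> {f l, g l} \<and> (f l \<noteq> v \<longrightarrow> f' l = f l))"
proof -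
  let ?f = "\<lambda>l. if f l = v then g l else f l" and ?g = "\<lambda>l. if f l = v then f l else g l"
  have ne: "f a \<noteq> g b" if "a \<in> M" "b \<in> M" for a b using that assms(3) by blast
  have "inj_on ?f M" "inj_on ?g M"
    using assms(1,2) ne by (auto simp: inj_on_def) metis+
  moreover have "?f ` M \<inter> ?g ` M = {}"
    using assms(1,2) ne by (auto simp: inj_on_def) metis+
  moreover have "v \<notin> ?f ` M" using ne by auto
  ultimately show ?thesis by (intro exI[of _ ?f] exI[of _ ?g]) auto
qed

text \<open>A path through the vertices outside \<open>L\<close> can be laid at will, so only the
  vertices of \<open>L\<close> need care.\<close>

locale high_complete = balanced_bipartite +
  fixes L :: "nat set"
  assumes L_subset: "L \<subseteq> X" and L_proper: "L \<noteq> X"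
    and high_adj: "x \<in> X - L \<Longrightarrow> y \<in> Y \<Longrightarrow> E x y"
begin

lemma finite_L: "finite L"
  using L_subset finite_X by (rule finite_subset)

lemma card_high: "card (X - L) = card Y - card L"
  using L_subset finite_L card_eq by (simp add: card_Diff_subset)

lemma base_high:
  assumes "u \<in> X - L" "v \<in> Y0" "Y0 \<subseteq> Y" "card Y0 = card Y - card L"
  shows "\<exists>\<pi>. alt_path E u v \<pi> Y0 \<and> \<pi> ` Y0 = X - L"
  by (rule alt_path_complete)
     (use assms finite_X finite_Y card_high symp_E high_adj in \<open>auto intro: finite_subset\<close>)

text \<open>A low start is attached through a neighbour \<open>c\<close> reserved for it, which
  leads on to an arbitrary high vertex where the base path begins.\<close>

lemma base_low:
  assumes "u \<in> L" "v \<in> Y0" "Y0 \<subseteq> Y" "card Y0 = card Y - card L" "c \<in> Y - Y0" "E u c"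
  shows "\<exists>\<pi>. alt_path E u v \<pi> (insert c Y0) \<and> \<pi> c = u \<and> \<pi> ` Y0 = X - L"
proof -
  obtain a where a: "a \<in> X - L" using L_subset L_proper by blast
  obtain \<pi> where \<pi>: "alt_path E a v \<pi> Y0" "\<pi> ` Y0 = X - L"
    using base_high[OF a assms(2-4)] by blast
  have "alt_path E u v (\<pi>(c := u)) (insert c Y0)"
  proof (rule alt_path_Cons[OF \<pi>(1)])
    show "E c a" using high_adj[OF a] assms(5) sym_E by blast
  qed (use assms \<pi>(2) in auto)
  moreover have "(\<pi>(c := u)) ` Y0 = \<pi> ` Y0" using assms(5) by (intro image_cong) auto
  ultimately show ?thesis using \<pi>(2) by (intro exI[of _ "\<pi>(c := u)"]) auto
qed

lemma pred_high: "\<pi> ` Y0 = X - L \<Longrightarrow> c \<in> Y0 \<Longrightarrow> y \<in> Y \<Longrightarrow> E (\<pi> c) y"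
  using high_adj by blast

text \<open>A chain through all of \<open>L\<close> in the interior of a path alternates with
  \<open>card L + 1\<close> vertices of \<open>Y\<close>, and \<open>C\<close> supplies
  these.\<close>

lemma ham_path_common_nbrs:
  assumes C: "C \<subseteq> Y" "card C = card L + 1" and adj: "\<And>l y. l \<in> L \<Longrightarrow> y \<in> C \<Longrightarrow> E l y"
    and uv: "u \<in> X" "v \<in> Y"
  shows "ham_path E (X \<union> Y) u v"
proof -
  have finC: "finite C" using C finite_Y by (blast intro: finite_subset)
  have "C \<noteq> {}" using C(2) by auto
  \<comment> \<open>One vertex of \<open>C\<close> stays on the base path; if \<open>v\<close>
    belongs to \<open>C\<close>, it has to be \<open>v\<close>.\<close>
  then obtain w where w: "w \<in> C" "v \<in> C \<Longrightarrow> w = v" by blast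
  define Y0 where "Y0 = Y - (C - {w})"
  have Y0: "Y0 \<subseteq> Y" "v \<in> Y0" "w \<in> Y0" using w uv C by (auto simp: Y0_def)
  have cY0: "card Y0 = card Y - card L"
    unfolding Y0_def using C w(1) finC by (subst card_Diff_subset) auto
  have un: "Y0 \<union> (C - {w}) = Y" using C by (auto simp: Y0_def)
  show ?thesis
  proof (cases "u \<in> L")
    case False
    obtain \<pi> where \<pi>: "alt_path E u v \<pi> Y0" "\<pi> ` Y0 = X - L"
      using base_high[of u v Y0] uv False Y0 cY0 by blast
    have "\<exists>\<pi>' d. alt_path E u v \<pi>' (Y0 \<union> (C - {w})) \<and> \<pi>' ` (Y0 \<union> (C - {w})) = \<pi> ` Y0 \<union> L \<and>
        d \<in> insert w (C - {w}) \<and> \<pi>' d = \<pi> w \<and> (\<forall>b. b \<notin> insert w (C - {w}) \<longrightarrow> \<pi>' b = \<pi> b)"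
    proof (rule alt_path_chain)
      show "L \<inter> \<pi> ` Y0 = {}" unfolding \<pi>(2) by auto
      show "E (\<pi> w) y" if "y \<in> C - {w}" for y using pred_high[OF \<pi>(2) Y0(3)] that C by auto
      show "card L = card (C - {w})" using C w(1) finC by simp
    qed (use finite_L finC \<pi> symp_E adj w Y0 in \<open>auto simp: Y0_def\<close>)
    then obtain \<pi>' where "alt_path E u v \<pi>' Y" "\<pi>' ` Y = X - L \<union> L" unfolding un \<pi>(2) by blast
    then show ?thesis using L_subset by (intro ham_path_all) auto
  next
    \<comment> \<open>The path begins \<open>u, c\<close>, and the rest of \<open>L\<close> is
      chained between these two. A low start saves one vertex of \<open>C\<close>, so
      \<open>w\<close> is left on the base path.\<close>
    case True
    have "card (C - {w}) \<noteq> 0" using C w(1) finC finite_L True by auto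
    then obtain c where c: "c \<in> C" "c \<noteq> w" by (metis card.empty Diff_iff ex_in_conv singletonI)
    obtain \<pi> where \<pi>: "alt_path E u v \<pi> (insert c Y0)" "\<pi> c = u" "\<pi> ` Y0 = X - L"
      using base_low[of u v Y0 c] True Y0 cY0 c C adj by (auto simp: Y0_def)
    have img: "\<pi> ` insert c Y0 = insert u (X - L)" using \<pi> by auto
    have un': "insert c Y0 \<union> (C - {w, c}) = Y" using un c C by auto
    have "\<exists>\<pi>' d. alt_path E u v \<pi>' (insert c Y0 \<union> (C - {w, c})) \<and>
        \<pi>' ` (insert c Y0 \<union> (C - {w, c})) = \<pi> ` insert c Y0 \<union> (L - {u}) \<and> d \<in> insert c (C - {w, c}) \<and>
           \<pi>' d = \<pi> c \<and> (\<forall>b. b \<notin> insert c (C - {w, c}) \<longrightarrow> \<pi>' b = \<pi> b)"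
    proof (rule alt_path_chain)
      show "card (L - {u}) = card (C - {w, c})"
        using True C w(1) c finC finite_L by (simp add: card_Diff_subset)
      show "(L - {u}) \<inter> \<pi> ` insert c Y0 = {}" unfolding img by auto
      show "E (\<pi> c) y" if "y \<in> C - {w, c}" for y using that \<pi>(2) True adj by auto
    qed (use finite_L finC \<pi> symp_E adj c in \<open>auto simp: Y0_def\<close>)
    then obtain \<pi>' where "alt_path E u v \<pi>' Y" "\<pi>' ` Y = insert u (X - L) \<union> (L - {u})"
      unfolding un' img by blast
    then show ?thesis using True L_subset by (intro ham_path_all) auto
  qed
qed

text \<open>For an interior chain through \<open>L\<close> the set \<open>C\<close> is one vertex
  short, and \<open>q\<close> fills the gap next to \<open>x0\<close>. The cases depend on whether
  the start is low and on which of these vertices is the forced end \<open>v\<close>.\<close>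

lemma ham_path_common_nbrs_extra:
  assumes C: "C \<subseteq> Y" "card C = card L" and adj: "\<And>l y. l \<in> L \<Longrightarrow> y \<in> C \<Longrightarrow> E l y"
    and q: "x0 \<in> L" "q \<in> Y - C" "E x0 q" and uv: "u \<in> X" "v \<in> Y"
  shows "ham_path E (X \<union> Y) u v"
proof -
  have finC: "finite C" using C finite_Y by (blast intro: finite_subset)
  have "card L > 0" using q(1) finite_L by (auto simp: card_gt_0_iff)
  then have neC: "C \<noteq> {}" using C by auto
  have card_rem: "card (L - {x}) = card (C - {c})" if "x \<in> L" "c \<in> C" for x c
    using that C finC finite_L by simp
  have cYC: "card (Y - C) = card Y - card L"
    using C finC by (simp add: card_Diff_subset)
  have cYq: "card (Y - (C - {c}) - {q}) = card Y - card L" if "c \<in> C" for c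
  proof -
    have "Y - (C - {c}) - {q} = Y - insert q (C - {c})" by auto
    moreover have "card (insert q (C - {c})) = card L"
      using that q finC C(2) \<open>card L > 0\<close> by simp
    moreover have "card (Y - insert q (C - {c})) = card Y - card (insert q (C - {c}))"
      by (rule card_Diff_subset) (use finC q C in auto)
    ultimately show ?thesis by simp
  qed
  consider (1) "u \<notin> L" "v = q" | (2) "u \<notin> L" "v \<noteq> q" | (3) "u \<in> L" "v \<notin> C"
    | (4) "u = x0" "v \<in> C" | (5) "u \<in> L" "u \<noteq> x0" "v \<in> C" using q(1) by blast
  then show ?thesis
  proof cases
    \<comment> \<open>Since \<open>q\<close> ends the path, \<open>x0\<close> comes right before it,
      reached from \<open>c\<close>, and the others are chained in front of
      \<open>c\<close>.\<close>
    case 1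
    obtain c where c: "c \<in> C" using neC by blast
    obtain \<pi> where \<pi>: "alt_path E u v \<pi> (Y - C)" "\<pi> ` (Y - C) = X - L"
      using base_high[of u v "Y - C"] uv 1 q cYC by auto
    define \<pi>1 where "\<pi>1 = \<pi>(c := \<pi> q, q := x0)"
    have \<pi>1: "alt_path E u v \<pi>1 (insert c (Y - C))" unfolding \<pi>1_def
      by (rule alt_path_insert[OF \<pi>(1)])
         (use c C q adj symp_E pred_high[OF \<pi>(2)] \<pi>(2) in auto)
    have img: "\<pi>1 ` insert c (Y - C) = insert x0 (X - L)"
      unfolding \<pi>1_def \<pi>(2)[symmetric] by (rule image_alt_path_insert) (use q c in auto)
    have c1: "\<pi>1 c = \<pi> q" using c q by (auto simp: \<pi>1_def)
    have un: "insert c (Y - C) \<union> (C - {c}) = Y" using c C by auto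
    have "\<exists>\<pi>' d. alt_path E u v \<pi>' (insert c (Y - C) \<union> (C - {c})) \<and>
        \<pi>' ` (insert c (Y - C) \<union> (C - {c})) = \<pi>1 ` insert c (Y - C) \<union> (L - {x0}) \<and>
        d \<in> insert c (C - {c}) \<and> \<pi>' d = \<pi>1 c \<and> (\<forall>b. b \<notin> insert c (C - {c}) \<longrightarrow> \<pi>' b = \<pi>1 b)"
    proof (rule alt_path_chain)
      show "(L - {x0}) \<inter> \<pi>1 ` insert c (Y - C) = {}" unfolding img by auto
      show "E (\<pi>1 c) y" if "y \<in> C - {c}" for y unfolding c1 using pred_high[OF \<pi>(2)] q that C by auto
      show "card (L - {x0}) = card (C - {c})" using card_rem q c by simp
    qed (use finite_L finC \<pi>1 symp_E adj c in auto)
    then obtain \<pi>' where "alt_path E u v \<pi>' Y" "\<pi>' ` Y = insert x0 (X - L) \<union> (L - {x0})"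
      unfolding un img by blast
    then show ?thesis using q L_subset by (intro ham_path_all) auto
  next
    \<comment> \<open>The others are chained first, within \<open>C\<close>; the chain then begins
      at \<open>d\<close>, and \<open>q, x0\<close> is put in front of it.\<close>
    case 2
    obtain c where c: "c \<in> C" "v \<in> C \<Longrightarrow> c = v" using neC by blast
    define Y0 where "Y0 = Y - (C - {c}) - {q}"
    have Y0: "Y0 \<subseteq> Y" "v \<in> Y0" "c \<in> Y0" using c uv 2 C q by (auto simp: Y0_def)
    obtain \<pi> where \<pi>: "alt_path E u v \<pi> Y0" "\<pi> ` Y0 = X - L"
      using base_high[of u v Y0] uv 2 Y0 cYq[OF c(1)] unfolding Y0_def by auto
    have un: "Y0 \<union> (C - {c}) = Y - {q}" using C q by (auto simp: Y0_def)
    have "\<exists>\<pi>' d. alt_path E u v \<pi>' (Y0 \<union> (C - {c})) \<and> \<pi>' ` (Y0 \<union> (C - {c})) = \<pi> ` Y0 \<union> (L - {x0}) \<and>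
        d \<in> insert c (C - {c}) \<and> \<pi>' d = \<pi> c \<and> (\<forall>b. b \<notin> insert c (C - {c}) \<longrightarrow> \<pi>' b = \<pi> b)"
    proof (rule alt_path_chain)
      show "(L - {x0}) \<inter> \<pi> ` Y0 = {}" unfolding \<pi>(2) by auto
      show "E (\<pi> c) y" if "y \<in> C - {c}" for y using pred_high[OF \<pi>(2) Y0(3)] that C by auto
      show "card (L - {x0}) = card (C - {c})" using card_rem q c by simp
    qed (use finite_L finC \<pi> symp_E adj c Y0 in \<open>auto simp: Y0_def\<close>)
    then obtain \<pi>' d where \<pi>': "alt_path E u v \<pi>' (Y - {q})" "\<pi>' ` (Y - {q}) = (X - L) \<union> (L - {x0})"
      "d \<in> C" "\<pi>' d = \<pi> c" unfolding un \<pi>(2) using c by auto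
    have "alt_path E u v (\<pi>'(q := \<pi>' d, d := x0)) (insert q (Y - {q}))"
      by (rule alt_path_insert[OF \<pi>'(1)])
         (use \<pi>' C q adj symp_E pred_high[OF \<pi>(2) Y0(3)] in auto)
    moreover have "(\<pi>'(q := \<pi>' d, d := x0)) ` insert q (Y - {q}) = insert x0 ((X - L) \<union> (L - {x0}))"
      unfolding \<pi>'(2)[symmetric] by (rule image_alt_path_insert) (use \<pi>' q C in auto)
    moreover have "insert q (Y - {q}) = Y" "insert x0 ((X - L) \<union> (L - {x0})) = X"
      using q L_subset by auto
    ultimately show ?thesis using ham_path_all by metis
  next
    \<comment> \<open>A chain that begins at a low start needs only \<open>card L\<close> vertices
      of \<open>Y\<close>, so \<open>C\<close> suffices as long as \<open>v\<close> is outside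
      it.\<close>
    case 3
    obtain c where c: "c \<in> C" using neC by blast
    obtain \<pi> where \<pi>: "alt_path E u v \<pi> (insert c (Y - C))" "\<pi> c = u" "\<pi> ` (Y - C) = X - L"
      using base_low[of u v "Y - C" c] uv 3 c cYC C adj by auto
    have img: "\<pi> ` insert c (Y - C) = insert u (X - L)" using \<pi> by auto
    have un: "insert c (Y - C) \<union> (C - {c}) = Y" using c C by auto
    have "\<exists>\<pi>' d. alt_path E u v \<pi>' (insert c (Y - C) \<union> (C - {c})) \<and>
        \<pi>' ` (insert c (Y - C) \<union> (C - {c})) = \<pi> ` insert c (Y - C) \<union> (L - {u}) \<and>
        d \<in> insert c (C - {c}) \<and> \<pi>' d = \<pi> c \<and> (\<forall>b. b \<notin> insert c (C - {c}) \<longrightarrow> \<pi>' b = \<pi> b)"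
    proof (rule alt_path_chain)
      show "(L - {u}) \<inter> \<pi> ` insert c (Y - C) = {}" unfolding img by auto
      show "E (\<pi> c) y" if "y \<in> C - {c}" for y using \<pi>(2) 3 adj that by auto
      show "card (L - {u}) = card (C - {c})" using card_rem 3 c by simp
    qed (use finite_L finC \<pi> symp_E adj c in auto)
    then obtain \<pi>' where "alt_path E u v \<pi>' Y" "\<pi>' ` Y = insert u (X - L) \<union> (L - {u})"
      unfolding un img by blast
    then show ?thesis using 3 L_subset by (intro ham_path_all) auto
  next
    \<comment> \<open>As \<open>v\<close> is in \<open>C\<close> and must come last, the start
      \<open>x0\<close> leaves through \<open>q\<close> and the others are chained in front of
      \<open>v\<close>.\<close>
    case 4
    define Y0 where "Y0 = Y - (C - {v}) - {q}"
    have Y0: "Y0 \<subseteq> Y" "v \<in> Y0" "q \<notin> Y0" using uv 4 C q by (auto simp: Y0_def)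
    obtain \<pi> where \<pi>: "alt_path E u v \<pi> (insert q Y0)" "\<pi> q = u" "\<pi> ` Y0 = X - L"
      using base_low[of u v Y0 q] 4 q Y0 cYq[of v] unfolding Y0_def by auto
    have img: "\<pi> ` insert q Y0 = insert u (X - L)" using \<pi> by auto
    have un: "insert q Y0 \<union> (C - {v}) = Y" using C q by (auto simp: Y0_def)
    have "\<exists>\<pi>' d. alt_path E u v \<pi>' (insert q Y0 \<union> (C - {v})) \<and>
        \<pi>' ` (insert q Y0 \<union> (C - {v})) = \<pi> ` insert q Y0 \<union> (L - {u}) \<and>
        d \<in> insert v (C - {v}) \<and> \<pi>' d = \<pi> v \<and> (\<forall>b. b \<notin> insert v (C - {v}) \<longrightarrow> \<pi>' b = \<pi> b)"
    proof (rule alt_path_chain)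
      show "(L - {u}) \<inter> \<pi> ` insert q Y0 = {}" unfolding img by auto
      show "E (\<pi> v) y" if "y \<in> C - {v}" for y using pred_high[OF \<pi>(3) Y0(2)] that C by auto
      show "card (L - {u}) = card (C - {v})" using card_rem 4 q by simp
    qed (use finite_L finC \<pi> symp_E adj Y0 4 q in \<open>auto simp: Y0_def\<close>)
    then obtain \<pi>' where "alt_path E u v \<pi>' Y" "\<pi>' ` Y = insert u (X - L) \<union> (L - {u})"
      unfolding un img by blast
    then show ?thesis using 4 q L_subset by (intro ham_path_all) auto
  next
    \<comment> \<open>Low vertices sit at both ends: \<open>q, x0\<close> comes just before
      \<open>v\<close>, and the rest is chained between the start \<open>u\<close> and
      \<open>c\<close>.\<close>
    case 5
    have "card {x0, u} \<le> card L" using 5 q finite_L by (intro card_mono) auto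
    then have "card (C - {v}) \<noteq> 0" using 5 C finC by auto
    then obtain c where c: "c \<in> C" "c \<noteq> v" by (metis card.empty Diff_iff ex_in_conv singletonI)
    define Y0 where "Y0 = Y - (C - {v}) - {q}"
    have Y0: "Y0 \<subseteq> Y" "v \<in> Y0" "q \<notin> Y0" "c \<notin> Y0" using uv 5 C q c by (auto simp: Y0_def)
    obtain \<pi> where \<pi>: "alt_path E u v \<pi> (insert c Y0)" "\<pi> c = u" "\<pi> ` Y0 = X - L"
      using base_low[of u v Y0 c] 5 q Y0 c C adj cYq[of v] unfolding Y0_def by auto
    have img: "\<pi> ` insert c Y0 = insert u (X - L)" using \<pi> by auto
    define \<pi>1 where "\<pi>1 = \<pi>(q := \<pi> v, v := x0)"
    have ne: "c \<noteq> q" "q \<noteq> v" using c q 5 by auto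
    have \<pi>1: "alt_path E u v \<pi>1 (insert q (insert c Y0))" unfolding \<pi>1_def
    proof (rule alt_path_insert[OF \<pi>(1)])
      show "x0 \<notin> \<pi> ` insert c Y0" unfolding img using 5 q by auto
      show "E (\<pi> v) q" using pred_high[OF \<pi>(3) Y0(2)] q by auto
    qed (use Y0 ne 5 q adj symp_E in auto)
    have img1: "\<pi>1 ` insert q (insert c Y0) = insert x0 (insert u (X - L))"
      unfolding \<pi>1_def img[symmetric] by (rule image_alt_path_insert) (use Y0 ne in auto)
    have c1: "\<pi>1 c = u" using ne c \<pi> by (auto simp: \<pi>1_def)
    have un: "insert q (insert c Y0) \<union> (C - {v, c}) = Y" using C q c by (auto simp: Y0_def)
    have "\<exists>\<pi>' d. alt_path E u v \<pi>' (insert q (insert c Y0) \<union> (C - {v, c})) \<and>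
        \<pi>' ` (insert q (insert c Y0) \<union> (C - {v, c})) = \<pi>1 ` insert q (insert c Y0) \<union> (L - {u, x0}) \<and>
        d \<in> insert c (C - {v, c}) \<and> \<pi>' d = \<pi>1 c \<and> (\<forall>b. b \<notin> insert c (C - {v, c}) \<longrightarrow> \<pi>' b = \<pi>1 b)"
    proof (rule alt_path_chain)
      show "(L - {u, x0}) \<inter> \<pi>1 ` insert q (insert c Y0) = {}" unfolding img1 by auto
      show "E (\<pi>1 c) y" if "y \<in> C - {v, c}" for y unfolding c1 using that adj 5 by auto
      show "card (L - {u, x0}) = card (C - {v, c})"
        using C 5 q c finC finite_L by (simp add: card_Diff_subset)
    qed (use finite_L finC \<pi>1 symp_E adj Y0 5 q c in \<open>auto simp: Y0_def\<close>)
    then obtain \<pi>' where "alt_path E u v \<pi>' Y" "\<pi>' ` Y = insert x0 (insert u (X - L)) \<union> (L - {u, x0})"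
      unfolding un img1 by blast
    then show ?thesis using 5 q L_subset by (intro ham_path_all) auto
  qed
qed

text \<open>\<open>P\<close> and \<open>U\<close> describe the beginning of the path: nothing if \<open>u\<close> is a high vertex, and an edge
  from \<open>u\<close> to the vertex in \<open>P\<close> if \<open>u\<close> is low.\<close>

definition path_start :: "nat \<Rightarrow> nat set \<Rightarrow> nat set \<Rightarrow> bool" where
  "path_start u P U \<longleftrightarrow> (u \<in> X - L \<and> P = {} \<and> U = {}) \<or>
     (u \<in> L \<and> U = {u} \<and> (\<exists>c\<in>Y. P = {c} \<and> E u c))"

lemma path_start_facts:
  assumes "path_start u P U"
  shows "U \<subseteq> L" "P \<subseteq> Y" "card U = card P" "finite U" "finite P"
  using assms by (auto simp: path_start_def)

lemma base_start:
  assumes "path_start u P U" "v \<in> Y0" "Y0 \<subseteq> Y - P" "card Y0 = card Y - card L"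
  shows "\<exists>\<pi>. alt_path E u v \<pi> (Y0 \<union> P) \<and> \<pi> ` Y0 = X - L \<and> \<pi> ` (Y0 \<union> P) = (X - L) \<union> U"
  using assms(1) unfolding path_start_def
proof (elim disjE conjE bexE)
  assume "u \<in> X - L" "P = {}" "U = {}"
  then show ?thesis using base_high[of u v Y0] assms by auto
next
  fix c assume c: "u \<in> L" "U = {u}" "c \<in> Y" "P = {c}" "E u c"
  then obtain \<pi> where "alt_path E u v \<pi> (insert c Y0)" "\<pi> c = u" "\<pi> ` Y0 = X - L"
    using base_low[of u v Y0 c] assms by auto
  then show ?thesis using c by (intro exI[of _ \<pi>]) auto
qed

text \<open>Two private neighbours per low vertex permit independent detours: the predecessors
  involved are high, hence adjacent to whatever is brought in.\<close>

lemma ham_path_private_pairs: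
  assumes start: "path_start u P U" and v: "v \<in> Y - P"
    and inj: "inj_on f (L - U)" "inj_on g (L - U)" "f ` (L - U) \<inter> g ` (L - U) = {}"
    and sub: "f ` (L - U) \<subseteq> Y - P" "g ` (L - U) \<subseteq> Y - P"
    and adj: "\<And>l. l \<in> L - U \<Longrightarrow> E l (f l)" "\<And>l. l \<in> L - U \<Longrightarrow> E l (g l)"
  shows "ham_path E (X \<union> Y) u v"
proof -
  note st = path_start_facts[OF start]
  let ?M = "L - U"
  obtain f' g' where fg: "inj_on f' ?M" "inj_on g' ?M" "f' ` ?M \<inter> g' ` ?M = {}" "v \<notin> f' ` ?M"
    "\<forall>l\<in>?M. f' l \<in> {f l, g l} \<and> g' l \<in> {f l, g l} \<and> (f l \<noteq> v \<longrightarrow> f' l = f l)"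
    using exchange_avoiding[OF inj, of v] by blast
  have mem: "f' l \<in> {f l, g l}" "g' l \<in> {f l, g l}" if "l \<in> ?M" for l
    using fg(5) that by blast+
  have sub': "f' ` ?M \<subseteq> Y - P" "g' ` ?M \<subseteq> Y - P"
  proof -
    have "f' l \<in> Y - P \<and> g' l \<in> Y - P" if "l \<in> ?M" for l
    proof -
      have "f l \<in> Y - P" "g l \<in> Y - P" using that sub by blast+
      then show ?thesis using mem[OF that] by auto
    qed
    then show "f' ` ?M \<subseteq> Y - P" "g' ` ?M \<subseteq> Y - P" by auto
  qed
  have adj': "E l (f' l)" "E l (g' l)" if "l \<in> ?M" for l using mem[OF that] adj[OF that] by auto
  define Y0 where "Y0 = Y - (P \<union> f' ` ?M)"
  have "card (P \<union> f' ` ?M) = card P + card ?M"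
    using sub' st finite_L fg(1) by (subst card_Un_disjoint) (auto simp: card_image)
  also have "\<dots> = card L"
    using st finite_L card_mono[of L U] by (simp add: card_Diff_subset)
  finally have "card (P \<union> f' ` ?M) = card L" .
  then have cY0: "card Y0 = card Y - card L"
    unfolding Y0_def using st sub' finite_L by (subst card_Diff_subset) auto
  obtain \<pi> where \<pi>: "alt_path E u v \<pi> (Y0 \<union> P)" "\<pi> ` Y0 = X - L" "\<pi> ` (Y0 \<union> P) = (X - L) \<union> U"
  proof -
    have "v \<in> Y0" "Y0 \<subseteq> Y - P" using v fg(4) by (auto simp: Y0_def)
    then show ?thesis using base_start[OF start _ _ cY0] that by blast
  qed
  have g'Y0: "g' ` ?M \<subseteq> Y0" using sub' fg(3) by (auto simp: Y0_def)
  have un: "Y0 \<union> P \<union> f' ` ?M = Y" using st sub' by (auto simp: Y0_def)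
  have "\<exists>\<pi>'. alt_path E u v \<pi>' (Y0 \<union> P \<union> f' ` ?M) \<and> \<pi>' ` (Y0 \<union> P \<union> f' ` ?M) = \<pi> ` (Y0 \<union> P) \<union> ?M \<and>
           (\<forall>l\<in>?M. \<pi>' (f' l) = \<pi> (g' l)) \<and> (\<forall>b. b \<notin> f' ` ?M \<union> g' ` ?M \<longrightarrow> \<pi>' b = \<pi> b)"
  proof (rule alt_path_parallel)
    show "g' ` ?M \<subseteq> Y0 \<union> P" using g'Y0 by blast
    show "f' ` ?M \<inter> (Y0 \<union> P) = {}" using sub' by (auto simp: Y0_def)
    show "?M \<inter> \<pi> ` (Y0 \<union> P) = {}" unfolding \<pi>(3) by auto
    show "E (\<pi> (g' l)) (f' l)" if "l \<in> ?M" for l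
      using pred_high[OF \<pi>(2)] g'Y0 sub' that by blast
  qed (use finite_L \<pi> fg symp_E adj' in auto)
  then obtain \<pi>' where "alt_path E u v \<pi>' Y" "\<pi>' ` Y = (X - L) \<union> U \<union> ?M"
    unfolding un \<pi>(3) by blast
  then show ?thesis using st L_subset by (intro ham_path_all) auto
qed

text \<open>Common neighbours stand in for second private ones, but there is one too few. All low
  vertices except \<open>z\<close> get a pair \<open>h l\<close>, \<open>f l\<close>; then
  \<open>z\<close> is inserted between its own \<open>f z\<close> and a vertex \<open>c\<close> of
  \<open>C\<close> that already serves another low vertex \<open>l1\<close>.\<close>

lemma ham_path_private_common:
  assumes start: "path_start u P U" and v: "v \<in> Y - P"
    and C: "C \<subseteq> Y - P" "card C + 1 = card (L - U)" "c \<in> C" "c \<noteq> v"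
    and f: "inj_on f (L - U)" "f ` (L - U) \<subseteq> Y - P - C"
    and adj: "\<And>l. l \<in> L - U \<Longrightarrow> E l (f l)" "\<And>l y. l \<in> L - U \<Longrightarrow> y \<in> C \<Longrightarrow> E l y"
  shows "ham_path E (X \<union> Y) u v"
proof -
  note st = path_start_facts[OF start]
  have finC: "finite C" using C finite_Y by (meson finite_Diff finite_subset)
  have "card C > 0" using finC C(3) by (auto simp: card_gt_0_iff)
  then have "card (L - U) \<ge> 2" using C(2) by simp
  then obtain T where "T \<subseteq> L - U" "card T = 2" by (rule obtain_subset_with_card_n)
  then obtain a b where ab: "a \<in> L - U" "b \<in> L - U" "a \<noteq> b" by (auto simp: card_2_iff)
  have "f a \<noteq> f b" using f(1) ab by (auto dest: inj_onD)
  \<comment> \<open>\<open>f z\<close> is brought in by a detour, so it must differ from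
    \<open>v\<close>.\<close>
  then obtain z l1 where z: "z \<in> L - U" "l1 \<in> L - U" "z \<noteq> l1" "f z \<noteq> v"
    using ab by metis
  let ?M = "L - U - {z}"
  have cM: "card ?M = card C" using z C finite_L by simp
  \<comment> \<open>Forcing \<open>h l1 = c\<close> matters: as \<open>c \<noteq> v\<close>, the
    exchange keeps \<open>f' l1 = c\<close>, so the predecessor of \<open>c\<close> after the
    parallel detours is high and adjacent to \<open>f z\<close>.\<close>
  have "bij_betw (\<lambda>_. c) {l1} {c}" by (simp add: bij_betw_def)
  then obtain h where h: "bij_betw h ?M C" "h l1 = c"
    using exists_bij_betw_extending[of ?M C "{l1}" "{c}" "\<lambda>_. c"] finite_L finC cM z C by auto
  have fz: "f z \<in> Y - P - C" "f z \<notin> f ` ?M" using f z(1) by (auto dest: inj_onD)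
  have "inj_on h ?M" "inj_on f ?M" "h ` ?M \<inter> f ` ?M = {}"
    using h f by (auto simp: bij_betw_def intro: inj_on_subset)
  from exchange_avoiding[OF this, of v] obtain f' g' where
    fg: "inj_on f' ?M" "inj_on g' ?M" "f' ` ?M \<inter> g' ` ?M = {}" "v \<notin> f' ` ?M"
    "\<forall>l\<in>?M. f' l \<in> {h l, f l} \<and> g' l \<in> {h l, f l} \<and> (h l \<noteq> v \<longrightarrow> f' l = h l)" by blast
  have hC: "h l \<in> C" if "l \<in> ?M" for l using h that by (auto simp: bij_betw_def)
  have mem: "f' l \<in> {h l, f l}" "g' l \<in> {h l, f l}" if "l \<in> ?M" for l
    using fg(5) that by blast+
  have sub': "f' ` ?M \<subseteq> Y - P - {f z}" "g' ` ?M \<subseteq> Y - P - {f z}"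
  proof -
    have "f' l \<in> Y - P - {f z} \<and> g' l \<in> Y - P - {f z}" if "l \<in> ?M" for l
    proof -
      have "h l \<in> Y - P - {f z}" using hC[OF that] C(1) fz by auto
      moreover have "f l \<in> Y - P - {f z}" using that f(2) fz by (metis DiffD1 DiffI imageI image_subset_iff singletonD)
      ultimately show ?thesis using mem[OF that] by auto
    qed
    then show "f' ` ?M \<subseteq> Y - P - {f z}" "g' ` ?M \<subseteq> Y - P - {f z}" by auto
  qed
  have adj': "E l (f' l)" "E l (g' l)" if "l \<in> ?M" for l
    using mem[OF that] adj that hC[OF that] by auto
  have l1: "f' l1 = c" "l1 \<in> ?M" using fg(5) z h C by auto
  define R where "R = insert (f z) (P \<union> f' ` ?M)"
  define Y0 where "Y0 = Y - R"
  have "card (P \<union> f' ` ?M) = card P + card ?M"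
    using sub' st finite_L fg(1) by (subst card_Un_disjoint) (auto simp: card_image)
  moreover have "f z \<notin> P \<union> f' ` ?M" "finite (P \<union> f' ` ?M)" using fz sub' st finite_L by auto
  ultimately have "card R = Suc (card P + card C)" using cM by (simp add: R_def)
  also have "\<dots> = card L"
    using st finite_L C(2) card_mono[of L U] by (simp add: card_Diff_subset)
  finally have "card R = card L" .
  moreover have "R \<subseteq> Y" "finite R" using st sub' fz finite_L by (auto simp: R_def)
  ultimately have cY0: "card Y0 = card Y - card L"
    unfolding Y0_def by (simp add: card_Diff_subset)
  obtain \<pi> where \<pi>: "alt_path E u v \<pi> (Y0 \<union> P)" "\<pi> ` Y0 = X - L" "\<pi> ` (Y0 \<union> P) = (X - L) \<union> U"
  proof -
    have "v \<in> Y0" "Y0 \<subseteq> Y - P" using v fg(4) z(4) by (auto simp: Y0_def R_def)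
    then show ?thesis using base_start[OF start _ _ cY0] that by blast
  qed
  have g'Y0: "g' ` ?M \<subseteq> Y0" using sub' fg(3) by (auto simp: Y0_def R_def)
  have un: "Y0 \<union> P \<union> f' ` ?M = Y - {f z}" using st sub' fz by (auto simp: Y0_def R_def)
  have "\<exists>\<pi>'. alt_path E u v \<pi>' (Y0 \<union> P \<union> f' ` ?M) \<and> \<pi>' ` (Y0 \<union> P \<union> f' ` ?M) = \<pi> ` (Y0 \<union> P) \<union> ?M \<and>
           (\<forall>l\<in>?M. \<pi>' (f' l) = \<pi> (g' l)) \<and> (\<forall>b. b \<notin> f' ` ?M \<union> g' ` ?M \<longrightarrow> \<pi>' b = \<pi> b)"
  proof (rule alt_path_parallel)
    show "g' ` ?M \<subseteq> Y0 \<union> P" using g'Y0 by blast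
    show "f' ` ?M \<inter> (Y0 \<union> P) = {}" using sub' by (auto simp: Y0_def R_def)
    show "?M \<inter> \<pi> ` (Y0 \<union> P) = {}" unfolding \<pi>(3) by auto
    show "E (\<pi> (g' l)) (f' l)" if "l \<in> ?M" for l
      using pred_high[OF \<pi>(2)] g'Y0 sub' that by blast
  qed (use finite_L \<pi> fg symp_E adj' in auto)
  then obtain \<pi>' where \<pi>': "alt_path E u v \<pi>' (Y - {f z})" "\<pi>' ` (Y - {f z}) = (X - L) \<union> U \<union> ?M"
    "\<forall>l\<in>?M. \<pi>' (f' l) = \<pi> (g' l)"
    unfolding un \<pi>(3) by blast
  have pc: "\<pi>' c = \<pi> (g' l1)" using \<pi>'(3) l1 by metis
  have cY: "c \<in> Y - {f z}" using C fz by auto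
  have "alt_path E u v (\<pi>'(f z := \<pi>' c, c := z)) (insert (f z) (Y - {f z}))"
  proof (rule alt_path_insert[OF \<pi>'(1) cY])
    show "z \<notin> \<pi>' ` (Y - {f z})" unfolding \<pi>'(2) using z by auto
    show "E (\<pi>' c) (f z)" unfolding pc using pred_high[OF \<pi>(2)] g'Y0 l1(2) fz by blast
  qed (use adj z C symp_E in auto)
  moreover have "(\<pi>'(f z := \<pi>' c, c := z)) ` insert (f z) (Y - {f z}) = insert z ((X - L) \<union> U \<union> ?M)"
    unfolding \<pi>'(2)[symmetric] by (rule image_alt_path_insert) (use cY in auto)
  moreover have "insert (f z) (Y - {f z}) = Y" "insert z ((X - L) \<union> U \<union> ?M) = X"
    using fz z st L_subset by auto
  ultimately show ?thesis using ham_path_all by metis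
qed

end

section \<open>Hamiltonian paths with one deficient vertex on each side\<close>

context balanced_bipartite
begin

text \<open>\<open>y\<close> goes between \<open>d1\<close> and \<open>d2\<close>, and
  \<open>x\<close> between \<open>c1\<close> and \<open>c2\<close>: the base path omits
  \<open>x\<close>, \<open>d2\<close>, \<open>y\<close>, \<open>c1\<close>, and two detours restore
  them. If \<open>x\<close> is the start, \<open>x, c1\<close> is attached in front of
  \<open>d1\<close> instead.\<close>

lemma ham_path_two_defects_inner:
  assumes xy: "x \<in> X" "y \<in> Y" and compl: "\<And>a b. a \<in> X - {x} \<Longrightarrow> b \<in> Y - {y} \<Longrightarrow> E a b"
    and c: "c1 \<in> Y - {y}" "c2 \<in> Y - {y}" "c1 \<noteq> c2" "E x c1" "E x c2"
    and d: "d1 \<in> X - {x}" "d2 \<in> X - {x}" "d1 \<noteq> d2" "E d1 y" "E d2 y"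
    and uv: "u \<in> X" "v \<in> Y - {y}" "v \<noteq> c1" "u \<noteq> d2"
  shows "ham_path E (X \<union> Y) u v"
proof -
  let ?A = "X - {x, d2}" and ?B = "Y - {y, c1}"
  have cAB: "card ?A = card ?B"
    using xy c d finite_X finite_Y card_eq by (simp add: card_Diff_subset)
  have base: "\<exists>\<pi>. alt_path E u' v \<pi> ?B \<and> \<pi> ` ?B = ?A" if "u' \<in> ?A" for u'
    by (rule alt_path_complete) (use that cAB finite_X finite_Y uv symp_E compl in auto)
  have y_ins: "\<exists>\<pi>'. alt_path E u v \<pi>' (insert y B) \<and> \<pi>' ` insert y B = insert d2 (\<pi> ` B) \<and>
        (\<forall>b\<in>B. \<pi> b \<noteq> d1 \<longrightarrow> \<pi>' b = \<pi> b)"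
    if "alt_path E u v \<pi> B" "w \<in> B" "w \<in> ?B" "\<pi> w = d1" "y \<notin> B" "d2 \<notin> \<pi> ` B" for \<pi> B w
  proof -
    have "alt_path E u v (\<pi>(y := \<pi> w, w := d2)) (insert y B)"
      by (rule alt_path_insert) (use that d compl symp_E in auto)
    moreover have "(\<pi>(y := \<pi> w, w := d2)) ` insert y B = insert d2 (\<pi> ` B)"
      by (rule image_alt_path_insert) (use that in auto)
    ultimately show ?thesis using that by (intro exI[of _ "\<pi>(y := \<pi> w, w := d2)"]) auto
  qed
  show ?thesis
  proof (cases "u = x")
    case False
    then obtain \<pi> where \<pi>: "alt_path E u v \<pi> ?B" "\<pi> ` ?B = ?A" using base[of u] uv by auto
    have "d1 \<in> \<pi> ` ?B" unfolding \<pi>(2) using d by auto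
    then obtain w where w: "w \<in> ?B" "\<pi> w = d1" by auto
    obtain \<pi>1 where \<pi>1: "alt_path E u v \<pi>1 (insert y ?B)" "\<pi>1 ` insert y ?B = insert d2 ?A"
      using y_ins[OF \<pi>(1) w(1) w] unfolding \<pi>(2) by auto
    have c2: "c2 \<in> insert y ?B" using c by auto
    then have "\<pi>1 c2 \<in> insert d2 ?A" using \<pi>1(2) by blast
    then have E1: "E (\<pi>1 c2) c1" using d c compl by auto
    have "alt_path E u v (\<pi>1(c1 := \<pi>1 c2, c2 := x)) (insert c1 (insert y ?B))"
    proof (rule alt_path_insert[OF \<pi>1(1) c2])
      show "x \<notin> \<pi>1 ` insert y ?B" unfolding \<pi>1(2) using d by auto
    qed (use E1 c symp_E in auto)
    moreover have "(\<pi>1(c1 := \<pi>1 c2, c2 := x)) ` insert c1 (insert y ?B) = insert x (insert d2 ?A)"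
      unfolding \<pi>1(2)[symmetric] by (rule image_alt_path_insert) (use c2 c in auto)
    moreover have "insert c1 (insert y ?B) = Y" "insert x (insert d2 ?A) = X"
      using xy c d by auto
    ultimately show ?thesis using ham_path_all by metis
  next
    case True
    obtain \<pi> where \<pi>: "alt_path E d1 v \<pi> ?B" "\<pi> ` ?B = ?A" using base[of d1] d by auto
    have "d1 \<in> \<pi> ` ?B" unfolding \<pi>(2) using d by auto
    then obtain w where w: "w \<in> ?B" "\<pi> w = d1" by auto
    let ?p = "\<pi>(c1 := x)"
    have img: "?p ` insert c1 ?B = insert x ?A"
      unfolding \<pi>(2)[symmetric] by (auto simp: image_iff)
    have "alt_path E u v ?p (insert c1 ?B)" unfolding True
      by (rule alt_path_Cons[OF \<pi>(1)]) (use \<pi>(2) c d compl sym_E in auto)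
    then obtain \<pi>1 where \<pi>1: "alt_path E u v \<pi>1 (insert y (insert c1 ?B))"
      "\<pi>1 ` insert y (insert c1 ?B) = insert d2 (insert x ?A)"
      using y_ins[of ?p "insert c1 ?B" w] w c d unfolding img by auto
    moreover have "insert y (insert c1 ?B) = Y" "insert d2 (insert x ?A) = X"
      using xy c d by auto
    ultimately show ?thesis using ham_path_all by metis
  qed
qed

text \<open>Renaming neighbours achieves \<open>u \<noteq> d2'\<close> and
  \<open>v \<noteq> c1'\<close>; if \<open>v = y\<close> but \<open>u \<noteq> x\<close>, the sides
  are exchanged. If both deficient vertices are ends, they are attached to a path from
  \<open>c1\<close> to \<open>d1\<close> through the rest.\<close>

lemma ham_path_two_defects:
  assumes xy: "x \<in> X" "y \<in> Y" and compl: "\<And>a b. a \<in> X - {x} \<Longrightarrow> b \<in> Y - {y} \<Longrightarrow> E a b"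
    and c: "c1 \<in> Y - {y}" "c2 \<in> Y - {y}" "c1 \<noteq> c2" "E x c1" "E x c2"
    and d: "d1 \<in> X - {x}" "d2 \<in> X - {x}" "d1 \<noteq> d2" "E d1 y" "E d2 y"
    and uv: "u \<in> X" "v \<in> Y"
  shows "ham_path E (X \<union> Y) u v"
proof -
  interpret S: balanced_bipartite Y X E by (rule swap)
  obtain d1' d2' where d': "d1' \<in> X - {x}" "d2' \<in> X - {x}" "d1' \<noteq> d2'" "E d1' y" "E d2' y" "u \<noteq> d2'"
    using d by (metis (full_types))
  obtain c1' c2' where c': "c1' \<in> Y - {y}" "c2' \<in> Y - {y}" "c1' \<noteq> c2'" "E x c1'" "E x c2'" "v \<noteq> c1'"
    using c by (metis (full_types))
  consider "v \<noteq> y" | "v = y" "u \<noteq> x" | "v = y" "u = x" by blast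
  then show ?thesis
  proof cases
    case 1
    then show ?thesis
      by (intro ham_path_two_defects_inner[OF xy compl c'(1-5) d'(1-5)]) (use uv c' d' in auto)
  next
    case 2
    have "ham_path E (Y \<union> X) v u"
      by (rule S.ham_path_two_defects_inner[of y x d2' d1' c2' c1'])
         (use 2 uv c' d' xy compl sym_E in auto)
    then show ?thesis using ham_path_rev[OF _ symp_E] by (simp add: Un_commute)
  next
    case 3
    have "\<exists>\<pi>. alt_path E d1 c1 \<pi> (Y - {y}) \<and> \<pi> ` (Y - {y}) = X - {x}"
      by (rule alt_path_complete) (use xy c d finite_X finite_Y card_eq symp_E compl in auto)
    then obtain \<pi> where \<pi>: "alt_path E d1 c1 \<pi> (Y - {y})" "\<pi> ` (Y - {y}) = X - {x}" by blast
    have "ham_path E ((X - {x}) \<union> (Y - {y})) d1 c1"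
      using ham_path_alt_path[OF \<pi>] disjoint by auto
    then have "ham_path E ((X - {x}) \<union> (Y - {y})) c1 d1" by (rule ham_path_rev[OF _ symp_E])
    then obtain ps where ps: "ps \<noteq> []" "distinct ps" "set ps = (X - {x}) \<union> (Y - {y})"
      "hd ps = c1" "last ps = d1" "successively E ps"
      by (auto simp: ham_path_iff_successively)
    show ?thesis
      unfolding ham_path_iff_successively using ps 3 c d xy disjoint
      by (intro exI[of _ "x # ps @ [y]"]) (auto simp: successively_Cons successively_append_iff)
  qed
qed

end

section \<open>Dense closed graphs\<close>

definition missing :: "nat set \<Rightarrow> nat set \<Rightarrow> (nat \<Rightarrow> nat \<Rightarrow> bool) \<Rightarrow> nat" where
  "missing X Y E = card {z \<in> X \<times> Y. \<not> E (fst z) (snd z)}"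

lemma missing_commute:
  assumes "symp E"
  shows "missing Y X E = missing X Y E"
proof -
  have "{z \<in> Y \<times> X. \<not> E (fst z) (snd z)} = prod.swap ` {z \<in> X \<times> Y. \<not> E (fst z) (snd z)}"
    using assms by (auto simp: image_iff symp_def)
  then show ?thesis unfolding missing_def by (simp only: card_image[OF inj_swap])
qed

lemma card_nonneighbours:
  assumes "finite Y"
  shows "card {y \<in> Y. \<not> E x y} = card Y - deg_in E Y x"
proof -
  have "{y \<in> Y. \<not> E x y} = Y - {y \<in> Y. E x y}" by auto
  then show ?thesis unfolding deg_in_def using assms by (simp add: card_Diff_subset)
qed

lemma card_missing_rows:
  assumes "finite A" "finite Y" "\<And>a. a \<in> A \<Longrightarrow> deg_in E Y a \<le> d"
  shows "card {z \<in> A \<times> Y. \<not> E (fst z) (snd z)} \<ge> card A * (card Y - d)"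
proof -
  have "{z \<in> A \<times> Y. \<not> E (fst z) (snd z)} = Sigma A (\<lambda>a. {y \<in> Y. \<not> E a y})" by auto
  then have "card {z \<in> A \<times> Y. \<not> E (fst z) (snd z)} = (\<Sum>a\<in>A. card Y - deg_in E Y a)"
    using assms(1,2) by (simp add: card_nonneighbours)
  also have "\<dots> \<ge> (\<Sum>a\<in>A. card Y - d)"
    by (rule sum_mono) (use assms(3) in \<open>simp add: diff_le_mono2\<close>)
  finally show ?thesis by simp
qed

text \<open>Rows in \<open>A\<close> and columns in \<open>B\<close> are counted separately; the
  pairs counted twice lie in \<open>A \<times> B\<close>. The additive form avoids truncated
  subtraction.\<close>

lemma (in balanced_bipartite) missing_ge:
  assumes "A \<subseteq> X" "B \<subseteq> Y" "\<And>a. a \<in> A \<Longrightarrow> deg_in E Y a \<le> d" "\<And>b. b \<in> B \<Longrightarrow> deg_in E X b \<le> d'"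
  shows "missing X Y E + card A * card B \<ge> card A * (card X - d) + card B * (card X - d')"
proof -
  let ?Z1 = "{z \<in> A \<times> Y. \<not> E (fst z) (snd z)}" and ?Z2 = "{z \<in> X \<times> B. \<not> E (fst z) (snd z)}"
  have fin: "finite A" "finite B" "finite (X \<times> Y)"
    using assms finite_X finite_Y by (auto intro: finite_subset)
  have fin': "finite ?Z1" "finite ?Z2" using fin finite_X finite_Y by auto
  have "card A * (card X - d) \<le> card ?Z1"
    using card_missing_rows[of A Y E d] fin finite_Y assms(3) card_eq by simp
  moreover have "card B * (card X - d') \<le> card ?Z2"
    using card_missing_rows[of B X E d'] fin finite_X assms(4) missing_commute[OF symp_E, of B X]
    unfolding missing_def by simp
  moreover have "card ?Z1 + card ?Z2 = card (?Z1 \<union> ?Z2) + card (?Z1 \<inter> ?Z2)"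
    by (rule card_Un_Int[OF fin'])
  moreover have "card (?Z1 \<union> ?Z2) \<le> missing X Y E"
    unfolding missing_def using assms(1,2) fin by (intro card_mono) auto
  moreover have "card (?Z1 \<inter> ?Z2) \<le> card A * card B"
    using card_mono[of "A \<times> B" "?Z1 \<inter> ?Z2"] fin by (auto simp: card_cartesian_product)
  ultimately show ?thesis by linarith
qed

text \<open>The shape of \<open>M\<close> as seen after the deletion: putting back the
  \<open>p\<close> deleted vertices of \<open>Y\<close> enlarges \<open>C\<close> to size
  \<open>p + t\<close>.\<close>

definition confined :: "nat set \<Rightarrow> nat set \<Rightarrow> (nat \<Rightarrow> nat \<Rightarrow> bool) \<Rightarrow> nat \<Rightarrow> bool" where
  "confined X Y E t \<longleftrightarrow> (\<exists>S\<subseteq>X. \<exists>C\<subseteq>Y. card S = t \<and> card C = t \<and> (\<forall>s\<in>S. \<forall>y\<in>Y. E s y \<longrightarrow> y \<in> C))"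

definition two_of_degree :: "nat set \<Rightarrow> nat set \<Rightarrow> (nat \<Rightarrow> nat \<Rightarrow> bool) \<Rightarrow> nat \<Rightarrow> bool" where
  "two_of_degree X Y E d \<longleftrightarrow>
     (\<exists>x\<in>X. \<exists>x'\<in>X. x \<noteq> x' \<and> deg_in E Y x \<le> d \<and> deg_in E Y x' \<le> d)"

text \<open>The bound in \<open>dense\<close> is the number of pairs lost by \<open>t + 1\<close>
  vertices of degree \<open>t + 2\<close> on one side.\<close>

locale dense_closed = balanced_bipartite +
  fixes t :: nat
  assumes closed: "degree_closed X Y E"
    and min_deg_X: "x \<in> X \<Longrightarrow> t \<le> deg_in E Y x" and min_deg_Y: "y \<in> Y \<Longrightarrow> t \<le> deg_in E X y"
    and t_pos: "t \<ge> 1" and large: "card X \<ge> 2 * t + 4"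
    and dense: "missing X Y E < (t + 1) * (card X - (t + 2))"
begin

lemma dense_closed_swap: "dense_closed Y X E t"
proof -
  interpret S: balanced_bipartite Y X E by (rule swap)
  show ?thesis
  proof
    show "degree_closed Y X E"
      using closed sym_E card_eq unfolding degree_closed_def by (metis add.commute)
    show "missing Y X E < (t + 1) * (card Y - (t + 2))"
      using dense missing_commute[OF symp_E] card_eq by simp
  qed (use min_deg_X min_deg_Y t_pos large card_eq in auto)
qed

lemma closedD: "x \<in> X \<Longrightarrow> y \<in> Y \<Longrightarrow> deg_in E Y x + deg_in E X y \<ge> card X + 2 \<Longrightarrow> E x y"
  using closed unfolding degree_closed_def by fastforce

text \<open>With \<open>i = deg_in E Y x\<close>, closedness gives \<open>y\<close> at least
  \<open>i - 1\<close> non-neighbours, all of degree at most \<open>i\<close>, which costs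
  \<open>(i - 1) * (card X - i)\<close> pairs. This grows with \<open>i\<close> up to
  \<open>(card X + 1) / 2\<close>, and at the smallest value \<open>i = t + 2\<close> it already
  equals the bound in \<open>dense\<close>.\<close>

lemma no_large_sparse_pair:
  assumes "x \<in> X" "y \<in> Y" "\<not> E x y" "deg_in E Y x \<ge> t + 2" "deg_in E Y x \<le> deg_in E X y"
    and "\<And>x'. x' \<in> X \<Longrightarrow> \<not> E x' y \<Longrightarrow> deg_in E Y x' \<le> deg_in E Y x"
  shows False
proof -
  define i where "i = deg_in E Y x"
  let ?S = "{x' \<in> X. \<not> E y x'}"
  have sum: "i + deg_in E X y \<le> card X + 1"
    using closed assms(1-3) unfolding degree_closed_def i_def by blast
  have "card ?S = card X - deg_in E X y" by (rule card_nonneighbours[OF finite_X])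
  then have S: "card ?S \<ge> i - 1" using sum by linarith
  have "missing X Y E + card ?S * card ({} :: nat set) \<ge> card ?S * (card X - i) + card ({} :: nat set) * (card X - 0)"
    by (rule missing_ge) (use assms(6) sym_E in \<open>auto simp: i_def\<close>)
  then have "missing X Y E \<ge> card ?S * (card X - i)" by simp
  moreover have "card ?S * (card X - i) \<ge> (i - 1) * (card X - i)" using S by (rule mult_le_mono1)
  moreover have "(i - 1) * (card X - i) \<ge> (t + 1) * (card X - (t + 2))"
  proof -
    \<comment> \<open>\<open>e\<close> and \<open>g\<close> are the slacks in
      \<open>i \<ge> t + 2\<close> and \<open>2 * i \<le> card X + 1\<close>; they remove all
      truncated subtractions.\<close>
    obtain e where e: "i = t + 2 + e" using assms(4) le_Suc_ex unfolding i_def by blast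
    have "2 * i \<le> card X + 1" using sum assms(5) unfolding i_def by linarith
    then obtain g where g: "card X = 2 * t + 3 + 2 * e + g"
      using e le_Suc_ex[of "2 * t + 3 + 2 * e" "card X"] by auto
    have "(t + 1) * (t + 1 + 2 * e + g) \<le> (t + 1 + e) * (t + 1 + e + g)"
      by (simp add: algebra_simps)
    moreover have "i - 1 = t + 1 + e" "card X - i = t + 1 + e + g" "card X - (t + 2) = t + 1 + 2 * e + g"
      using e g by auto
    ultimately show ?thesis by simp
  qed
  ultimately show False using dense by linarith
qed

definition "LX = {x \<in> X. deg_in E Y x \<le> t + 1}"
definition "LY = {y \<in> Y. deg_in E X y \<le> t + 1}"

lemma LX_subset: "LX \<subseteq> X" and LY_subset: "LY \<subseteq> Y"
  by (auto simp: LX_def LY_def)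

lemma finite_LX: "finite LX" and finite_LY: "finite LY"
  using LX_subset LY_subset finite_X finite_Y by (auto intro: finite_subset)

text \<open>In a non-adjacent high pair of maximal degree sum, each vertex has the largest degree
  among the non-neighbours of the other. The one of smaller degree then contradicts
  \<open>no_large_sparse_pair\<close>.\<close>

lemma high_adjacent:
  assumes "x \<in> X - LX" "y \<in> Y - LY"
  shows "E x y"
proof (rule ccontr)
  assume nE: "\<not> E x y"
  let ?Z = "{z \<in> (X - LX) \<times> (Y - LY). \<not> E (fst z) (snd z)}"
  let ?w = "\<lambda>z. deg_in E Y (fst z) + deg_in E X (snd z)"
  have fin: "finite ?Z" using finite_X finite_Y by simp
  have "(x, y) \<in> ?Z" using assms nE by simp
  then have "Max (?w ` ?Z) \<in> ?w ` ?Z" using fin by (intro Max_in) blast+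
  then obtain z where z: "z \<in> ?Z" "?w z = Max (?w ` ?Z)" by (metis (no_types, lifting) imageE)
  obtain a b where z_eq: "z = (a, b)" by (cases z)
  have ab: "a \<in> X - LX" "b \<in> Y - LY" "\<not> E a b" using z(1) z_eq by auto
  have mx: "deg_in E Y a' + deg_in E X b' \<le> deg_in E Y a + deg_in E X b"
    if "a' \<in> X - LX" "b' \<in> Y - LY" "\<not> E a' b'" for a' b'
  proof -
    have "(a', b') \<in> ?Z" using that by simp
    then have "?w (a', b') \<le> Max (?w ` ?Z)" using fin by (intro Max_ge finite_imageI imageI)
    then show ?thesis unfolding z(2)[symmetric] z_eq by simp
  qed
  have da: "deg_in E Y a \<ge> t + 2" "deg_in E X b \<ge> t + 2" using ab by (auto simp: LX_def LY_def)
  interpret S: dense_closed Y X E t by (rule dense_closed_swap)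
  show False
  proof (cases "deg_in E Y a \<le> deg_in E X b")
    case True
    show False
    proof (rule no_large_sparse_pair[of a b])
      show "deg_in E Y x' \<le> deg_in E Y a" if "x' \<in> X" "\<not> E x' b" for x'
      proof (cases "x' \<in> LX")
        case True
        then show ?thesis using da by (auto simp: LX_def)
      next
        case False
        then show ?thesis using mx[of x' b] that ab by auto
      qed
    qed (use ab da True in auto)
  next
    case False
    show False
    proof (rule S.no_large_sparse_pair[of b a])
      show "deg_in E X y' \<le> deg_in E X b" if "y' \<in> Y" "\<not> E y' a" for y'
      proof (cases "y' \<in> LY")
        case True
        then show ?thesis using da by (auto simp: LY_def)
      next
        case False
        then show ?thesis using mx[of a y'] that ab sym_E by auto
      qed
      show "\<not> E b a" using ab sym_E by blast
    qed (use ab da False in auto)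
  qed
qed

lemma missing_low:
  assumes "a \<le> card LX" "b \<le> card LY" "\<And>x. x \<in> LX \<Longrightarrow> deg_in E Y x \<le> d" "\<And>y. y \<in> LY \<Longrightarrow> deg_in E X y \<le> d'"
  shows "missing X Y E + a * b \<ge> a * (card X - d) + b * (card X - d')"
proof -
  obtain A B where "A \<subseteq> LX" "card A = a" "B \<subseteq> LY" "card B = b"
    using assms(1,2) obtain_subset_with_card_n by metis
  then show ?thesis
    using missing_ge[of A B d d'] assms(3,4) LX_subset LY_subset by blast
qed

text \<open>\<open>t + 1\<close> vertices of degree at most \<open>t + 1\<close> would lose more
  pairs than \<open>dense\<close> allows.\<close>

lemma card_LX_le: "card LX \<le> t"
proof (rule ccontr)
  assume "\<not> card LX \<le> t"
  then have "missing X Y E + (t + 1) * 0 \<ge> (t + 1) * (card X - (t + 1)) + 0 * (card X - (t + 1))"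
    by (intro missing_low) (auto simp: LX_def LY_def)
  moreover have "(t + 1) * (card X - (t + 2)) \<le> (t + 1) * (card X - (t + 1))"
    by (intro mult_le_mono2) simp
  ultimately show False using dense by simp
qed

lemma card_LY_le: "card LY \<le> t"
proof -
  interpret S: dense_closed Y X E t by (rule dense_closed_swap)
  have "S.LX = LY" unfolding S.LX_def LY_def ..
  then show ?thesis using S.card_LX_le by simp
qed

lemma deg_Y_ge:
  assumes "y \<in> Y - LY" "T \<subseteq> LX" "\<And>x. x \<in> T \<Longrightarrow> E x y"
  shows "deg_in E X y \<ge> card X - card LX + card T"
proof -
  have "card ((X - LX) \<union> T) \<le> deg_in E X y" unfolding deg_in_def
  proof (rule card_mono)
    show "(X - LX) \<union> T \<subseteq> {w \<in> X. E y w}"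
      using high_adjacent assms LX_subset sym_E by blast
  qed (use finite_X in simp)
  moreover have "card ((X - LX) \<union> T) = card X - card LX + card T"
  proof -
    have "finite T" "finite (X - LX)" "(X - LX) \<inter> T = {}"
      using assms finite_LX finite_X by (auto intro: finite_subset)
    then have "card ((X - LX) \<union> T) = card (X - LX) + card T" by (intro card_Un_disjoint) auto
    then show ?thesis using LX_subset finite_LX by (simp add: card_Diff_subset)
  qed
  ultimately show ?thesis by simp
qed

text \<open>High vertices of \<open>Y\<close> outnumber the neighbours of \<open>x\<close>, so
  \<open>x\<close> misses one of them; that one is adjacent to every high vertex of
  \<open>X\<close>, and closedness then caps the degree of \<open>x\<close>.\<close>

lemma deg_low:
  assumes "x \<in> LX"
  shows "deg_in E Y x \<le> card LX + 1"
proof -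
  have x: "x \<in> X" "deg_in E Y x \<le> t + 1" using assms by (auto simp: LX_def)
  have "card (Y - LY) = card X - card LY"
    using LY_subset finite_LY card_eq by (simp add: card_Diff_subset)
  then have "card (Y - LY) > t + 1" using card_LY_le large by simp
  then have "\<not> Y - LY \<subseteq> {y \<in> Y. E x y}"
    using card_mono[of "{y \<in> Y. E x y}" "Y - LY"] finite_Y x(2) unfolding deg_in_def by fastforce
  then obtain y where y: "y \<in> Y - LY" "\<not> E x y" by blast
  have "deg_in E X y \<ge> card X - card LX" using deg_Y_ge[OF y(1), of "{}"] by simp
  moreover have "deg_in E Y x + deg_in E X y \<le> card X + 1"
    using closed x(1) y unfolding degree_closed_def by blast
  ultimately show ?thesis using card_LX_le large by linarith
qed

lemma card_LX_ge: "LX \<noteq> {} \<Longrightarrow> t \<le> card LX + 1"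
  using deg_low min_deg_X LX_subset by (metis ex_in_conv order_trans subsetD)

text \<open>If one side had \<open>t\<close> low vertices, a single one on the other side would
  already break the bound in \<open>dense\<close>. So both have \<open>t - 1\<close>, of degree at
  most \<open>t\<close>; for \<open>t \<ge> 3\<close>, taking \<open>t - 1\<close> on one side and
  \<open>2\<close> on the other is again too expensive, and \<open>t = 1\<close> would leave
  none.\<close>

lemma both_low:
  assumes "LX \<noteq> {}" "LY \<noteq> {}"
  shows "t = 2 \<and> card LX = 1 \<and> card LY = 1"
proof -
  interpret S: dense_closed Y X E t by (rule dense_closed_swap)
  have eq: "S.LX = LY" unfolding S.LX_def LY_def ..
  have pos: "card LX \<ge> 1" "card LY \<ge> 1"
    using assms finite_LX finite_LY by (auto simp: Suc_le_eq card_gt_0_iff)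
  have ge: "t \<le> card LX + 1" "t \<le> card LY + 1"
    using card_LX_ge S.card_LX_ge assms eq by auto
  have dX: "\<And>x. x \<in> LX \<Longrightarrow> deg_in E Y x \<le> t + 1" and dY: "\<And>y. y \<in> LY \<Longrightarrow> deg_in E X y \<le> t + 1"
    by (auto simp: LX_def LY_def)
  obtain r where r: "card X = t + 2 + r" using large le_Suc_ex[of "t + 2" "card X"] by auto
  have less: "card LX < t" "card LY < t"
  proof -
    show "card LX < t"
    proof (rule ccontr)
      assume "\<not> card LX < t"
      then have "missing X Y E + t * 1 \<ge> t * (card X - (t + 1)) + 1 * (card X - (t + 1))"
        using pos by (intro missing_low dX dY) auto
      then show False using dense by (simp add: r algebra_simps)
    qed
    show "card LY < t"
    proof (rule ccontr)
      assume "\<not> card LY < t"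
      then have "missing X Y E + 1 * t \<ge> 1 * (card X - (t + 1)) + t * (card X - (t + 1))"
        using pos by (intro missing_low dX dY) auto
      then show False using dense by (simp add: r algebra_simps)
    qed
  qed
  then have ab: "card LX + 1 = t" "card LY + 1 = t" using ge by auto
  have "t < 3"
  proof (rule ccontr)
    assume "\<not> t < 3"
    then have "missing X Y E + (t - 1) * 2 \<ge> (t - 1) * (card X - t) + 2 * (card X - t)"
      using ab deg_low S.deg_low eq by (intro missing_low) auto
    moreover obtain s where "t = s + 3" using \<open>\<not> t < 3\<close> le_Suc_ex[of 3 t] by auto
    ultimately show False using dense by (simp add: r algebra_simps)
  qed
  then show ?thesis using ab pos by auto
qed

text \<open>Closedness lets adjacency propagate: a vertex of \<open>Y\<close> with enough low
  neighbours is adjacent to all low vertices (\<open>spread\<close>). This yields enough common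
  neighbours, or enough private ones, or coinciding neighbourhoods.\<close>

lemma one_sided:
  assumes LY: "LY = {}" and LX: "LX \<noteq> {}"
  shows "(\<forall>u\<in>X. \<forall>v\<in>Y. ham_path E (X \<union> Y) u v) \<or> (t \<noteq> 2 \<and> confined X Y E t) \<or>
    (t = 2 \<and> two_of_degree X Y E 2)"
proof -
  have proper: "LX \<noteq> X" using card_LX_le large by auto
  interpret HC: high_complete X Y E LX
    using LX_subset proper high_adjacent LY by unfold_locales auto
  have mem: "x \<in> X" "deg_in E Y x \<le> t + 1" if "x \<in> LX" for x
    using that by (auto simp: LX_def)
  have spread: "E l' y" if "y \<in> Y" "T \<subseteq> LX" "\<And>x. x \<in> T \<Longrightarrow> E x y" "l' \<in> LX"
    "card T + deg_in E Y l' \<ge> card LX + 2" for y T l'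
  proof (rule closedD)
    show "card X + 2 \<le> deg_in E Y l' + deg_in E X y"
      using deg_Y_ge[of y T] that LY card_LX_le large by auto
  qed (use that mem in auto)
  obtain x0 where x0: "x0 \<in> LX" using LX by blast
  consider (1) "card LX + 1 = t" | (2) "card LX = t"
    using card_LX_ge[OF LX] card_LX_le by linarith
  then show ?thesis
  proof cases
    \<comment> \<open>All degrees equal \<open>card LX + 1\<close>, so a single low neighbour
      suffices in \<open>spread\<close> and all neighbourhoods of low vertices coincide.\<close>
    case 1
    have deg: "deg_in E Y l = t" if "l \<in> LX" for l
      using deg_low[OF that] 1 min_deg_X mem(1)[OF that] by (simp add: le_antisym)
    have "ham_path E (X \<union> Y) u v" if "u \<in> X" "v \<in> Y" for u v
    proof (rule HC.ham_path_common_nbrs[where C = "{y \<in> Y. E x0 y}"])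
      show "card {y \<in> Y. E x0 y} = card LX + 1" using deg[OF x0] 1 by (simp add: deg_in_def)
      show "E l y" if "l \<in> LX" "y \<in> {y \<in> Y. E x0 y}" for l y
        using that x0 1 deg by (intro spread[of y "{x0}" l]) auto
    qed (use that in auto)
    then show ?thesis by blast
  next
    case 2
    \<comment> \<open>Now \<open>card LX = t\<close>, and two low neighbours reach the threshold of
      \<open>spread\<close>.\<close>
    have two: "E l y" if "y \<in> Y" "a \<in> LX" "b \<in> LX" "a \<noteq> b" "E a y" "E b y" "l \<in> LX" for a b l y
      using that 2 min_deg_X[OF mem(1)[OF that(7)]] by (intro spread[of y "{a, b}" l]) auto
    show ?thesis
    proof (cases "\<exists>x1\<in>LX. deg_in E Y x1 = t + 1")
      \<comment> \<open>With one degree to spare, \<open>x1\<close> sees every neighbour of another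
        low vertex \<open>x2\<close>, and by \<open>two\<close> these are common to all of
        \<open>LX\<close>. For \<open>t = 1\<close> there is no other one and
        \<open>x2 = x1\<close>.\<close>
      case True
      then obtain x1 where x1: "x1 \<in> LX" "deg_in E Y x1 = t + 1" by blast
      obtain x2 where x2: "x2 \<in> LX" "t \<ge> 2 \<Longrightarrow> x2 \<noteq> x1"
      proof (cases "t \<ge> 2")
        case True
        then have "\<not> LX \<subseteq> {x1}" using 2 card_mono[of "{x1}" LX] by auto
        then show ?thesis using that by blast
      next
        case False
        then show ?thesis using that x1 by auto
      qed
      have "t \<le> card {y \<in> Y. E x2 y}" using min_deg_X mem(1)[OF x2(1)] by (simp add: deg_in_def)
      then obtain C where C: "C \<subseteq> {y \<in> Y. E x2 y}" "card C = t" "finite C"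
        by (rule obtain_subset_with_card_n)
      have "\<not> {y \<in> Y. E x1 y} \<subseteq> C"
        using card_mono[of C "{y \<in> Y. E x1 y}"] C x1(2) by (auto simp: deg_in_def)
      then obtain q where q: "q \<in> Y - C" "E x1 q" by blast
      have "ham_path E (X \<union> Y) u v" if "u \<in> X" "v \<in> Y" for u v
      proof (rule HC.ham_path_common_nbrs_extra[where C = C and q = q])
        show "E l y" if "l \<in> LX" "y \<in> C" for l y
        proof (cases "t \<ge> 2")
          case True
          have y: "y \<in> Y" "E x2 y" using that C by auto
          have "E x1 y" by (rule spread[of y "{x2}"]) (use y x1 x2 2 in auto)
          then show ?thesis using two[of y x2 x1 l] y x1 x2 True that by auto
        next
          case False
          then have "card LX = 1" using 2 t_pos by simp
          then have "l = x2" using that(1) x2(1) by (auto simp: card_1_singleton_iff)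
          then show ?thesis using that C by auto
        qed
      qed (use that C q x1 2 in auto)
      then show ?thesis by blast
    next
      case False
      have deg: "deg_in E Y l = t" if "l \<in> LX" for l
        using mem[OF that] min_deg_X[of l] False that by (metis Suc_eq_plus1 le_SucE le_antisym)
      consider "t = 1" | "t = 2" | "t \<ge> 3" using t_pos by linarith
      then show ?thesis
      proof cases
        case 1
        then have "LX = {x0}" using 2 x0 by (auto simp: card_1_singleton_iff)
        have "confined X Y E t" unfolding confined_def
        proof (intro exI conjI ballI impI)
          show "LX \<subseteq> X" by (rule LX_subset)
          show "{y \<in> Y. E x0 y} \<subseteq> Y" by blast
          show "card LX = t" by (rule 2)
          show "card {y \<in> Y. E x0 y} = t" using deg[OF x0] by (simp add: deg_in_def)
          show "y \<in> {y \<in> Y. E x0 y}" if "s \<in> LX" "y \<in> Y" "E s y" for s y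
            using that \<open>LX = {x0}\<close> by simp
        qed
        then show ?thesis using 1 by simp
      next
        \<comment> \<open>No path is sought here: two such vertices on one side are left to the
          spectral bound.\<close>
        case t2: 2
        then obtain a b where "LX = {a, b}" "a \<noteq> b" using 2 by (auto simp: card_2_iff)
        then have "two_of_degree X Y E 2" unfolding two_of_degree_def
          using deg mem(1) t2 by (metis insertCI order_refl)
        then show ?thesis using t2 by simp
      next
        case t3: 3
        \<comment> \<open>By \<open>two\<close>, a neighbour of a low vertex is either common to all
          of them or private to one, and the number of common ones decides the case.\<close>
        define C where "C = {y \<in> Y. \<forall>l\<in>LX. E l y}"
        define Q where "Q l = {y \<in> Y. E l y} - C" for l
        have finC: "finite C" "C \<subseteq> Y" using finite_Y by (auto simp: C_def)
        have CN: "C \<subseteq> {y \<in> Y. E l y}" if "l \<in> LX" for l using that by (auto simp: C_def)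
        have cQ: "card (Q l) + card C = t" if "l \<in> LX" for l
        proof -
          have "card (Q l) = card {y \<in> Y. E l y} - card C"
            unfolding Q_def using CN[OF that] finC by (simp add: card_Diff_subset)
          moreover have "card C \<le> card {y \<in> Y. E l y}"
            using CN[OF that] finite_Y by (intro card_mono) auto
          ultimately show ?thesis using deg[OF that] by (simp add: deg_in_def)
        qed
        have finQ: "finite (Q l)" for l using finite_Y by (auto simp: Q_def)
        have Qsub: "Q l \<subseteq> Y - C" for l by (auto simp: Q_def)
        have QE: "E l y" if "y \<in> Q l" for l y using that by (auto simp: Q_def)
        have Qdisj: "a = b" if "a \<in> LX" "b \<in> LX" "y \<in> Q a" "y \<in> Q b" for a b y
        proof (rule ccontr)
          assume "a \<noteq> b"
          then have "y \<in> C" using two[of y a b] that by (auto simp: C_def Q_def)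
          then show False using that(3) by (simp add: Q_def)
        qed
        have inj_sel: "inj_on f LX" if "\<And>l. l \<in> LX \<Longrightarrow> f l \<in> Q l" for f
          using that Qdisj by (metis inj_onI)
        consider (full) "card C = t" | (one) "card C + 1 = t" | (few) "card C + 2 \<le> t"
          using cQ[OF x0] by linarith
        then show ?thesis
        proof cases
          case full
          have "confined X Y E t" unfolding confined_def
          proof (intro exI conjI ballI impI)
            show "LX \<subseteq> X" by (rule LX_subset)
            show "card LX = t" by (rule 2)
            show "y \<in> C" if "s \<in> LX" "y \<in> Y" "E s y" for s y
            proof -
              have "Q s = {}" using cQ[OF that(1)] full finQ by auto
              then show ?thesis using that by (auto simp: Q_def)
            qed
          qed (use full finC in auto)
          then show ?thesis using t3 by simp
        next
          case few
          have "\<exists>a b. a \<in> Q l \<and> b \<in> Q l \<and> a \<noteq> b" if "l \<in> LX" for l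
          proof -
            have "2 \<le> card (Q l)" using cQ[OF that] few by linarith
            then obtain T where "T \<subseteq> Q l" "card T = 2" by (rule obtain_subset_with_card_n)
            then show ?thesis by (auto simp: card_2_iff)
          qed
          then obtain f g where fg: "\<And>l. l \<in> LX \<Longrightarrow> f l \<in> Q l \<and> g l \<in> Q l \<and> f l \<noteq> g l" by metis
          have inj: "inj_on f LX" "inj_on g LX" using inj_sel fg by auto
          have disj: "f a \<noteq> g b" if "a \<in> LX" "b \<in> LX" for a b
            using fg[OF that(1)] fg[OF that(2)] Qdisj that by metis
          have adj: "E l (f l)" "E l (g l)" if "l \<in> LX" for l using fg[OF that] QE by auto
          have sub: "f l \<in> Y" "g l \<in> Y" if "l \<in> LX" for l using fg[OF that] Qsub by auto
          have "ham_path E (X \<union> Y) u v" if uv: "u \<in> X" "v \<in> Y" for u v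
          proof (cases "u \<in> LX")
            case False
            show ?thesis
              by (rule HC.ham_path_private_pairs[of u "{}" "{}" v f g])
                 (use False uv inj disj sub adj in \<open>auto simp: HC.path_start_def\<close>)
          next
            case True
            obtain c where c: "c \<in> Q u" "c \<noteq> v" using fg[OF True] by metis
            have away: "f l \<noteq> c" "g l \<noteq> c" if "l \<in> LX - {u}" for l
              using fg[of l] that Qdisj[OF _ True _ c(1)] by auto
            show ?thesis
            proof (rule HC.ham_path_private_pairs[of u "{c}" "{u}" v f g])
              show "HC.path_start u {c} {u}"
                using True c QE Qsub unfolding HC.path_start_def by blast
              show "f ` (LX - {u}) \<subseteq> Y - {c}" "g ` (LX - {u}) \<subseteq> Y - {c}"
                using away sub by auto
              show "f ` (LX - {u}) \<inter> g ` (LX - {u}) = {}" using disj by auto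
              show "inj_on f (LX - {u})" "inj_on g (LX - {u})" using inj by (auto intro: inj_on_subset)
            qed (use uv c adj in auto)
          qed
          then show ?thesis by blast
        next
          case one
          have "\<exists>y. y \<in> Q l" if "l \<in> LX" for l
          proof -
            have "Q l \<noteq> {}" using cQ[OF that] one by auto
            then show ?thesis by blast
          qed
          then obtain f where f: "\<And>l. l \<in> LX \<Longrightarrow> f l \<in> Q l" by metis
          have inj: "inj_on f LX" using inj_sel f by auto
          have adj: "E l (f l)" if "l \<in> LX" for l using f[OF that] QE by auto
          have adjC: "E l y" if "l \<in> LX" "y \<in> C" for l y using that by (auto simp: C_def)
          have sub: "f l \<in> Y - C" if "l \<in> LX" for l using f[OF that] Qsub by auto
          have two_C: "\<exists>c\<in>C. c \<noteq> z" for z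
          proof -
            have "card C \<ge> 2" using one t3 by linarith
            then have "\<not> C \<subseteq> {z}" using card_mono[of "{z}" C] by auto
            then show ?thesis by blast
          qed
          have "ham_path E (X \<union> Y) u v" if uv: "u \<in> X" "v \<in> Y" for u v
          proof (cases "u \<in> LX")
            case False
            obtain c where "c \<in> C" "c \<noteq> v" using two_C by blast
            then show ?thesis
              by (intro HC.ham_path_private_common[of u "{}" "{}" v C c f])
                 (use False uv inj sub adj adjC finC one 2 in \<open>auto simp: HC.path_start_def\<close>)
          next
            case True
            have inj': "inj_on f (LX - {u})" using inj by (auto intro: inj_on_subset)
            have fu: "f l \<noteq> f u" if "l \<in> LX - {u}" for l
              using inj that True by (auto dest: inj_onD)
            have cL: "card (LX - {u}) = card C" using True 2 one finite_LX by simp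
            show ?thesis
            proof (cases "v = f u")
              \<comment> \<open>The start takes its private \<open>f u\<close>; the other
                \<open>t - 1\<close> low vertices find their second neighbours in \<open>C\<close>,
                which has \<open>t - 1\<close> elements.\<close>
              case False
              obtain h where h: "bij_betw h (LX - {u}) C"
                using cL finC finite_LX by (metis finite_same_card_bij finite_Diff)
              have h_image: "h ` (LX - {u}) = C" using h by (simp add: bij_betw_def)
              have hC: "h l \<in> C" if "l \<in> LX - {u}" for l using h that by (auto simp: bij_betw_def)
              show ?thesis
              proof (rule HC.ham_path_private_pairs[of u "{f u}" "{u}" v f h])
                show "HC.path_start u {f u} {u}"
                  using True adj sub unfolding HC.path_start_def by blast
                show "f ` (LX - {u}) \<subseteq> Y - {f u}" using fu sub by auto
                show "h ` (LX - {u}) \<subseteq> Y - {f u}" unfolding h_image using finC(2) sub[OF True] by blast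
                show "f ` (LX - {u}) \<inter> h ` (LX - {u}) = {}" unfolding h_image using sub by blast
                show "inj_on h (LX - {u})" using h by (simp add: bij_betw_def)
              qed (use uv False adj adjC hC inj' in auto)
            next
              \<comment> \<open>\<open>f u\<close> must end the path, so the start leaves through
                \<open>c0\<close> in \<open>C\<close>; this leaves \<open>t - 2\<close> common
                neighbours for \<open>t - 1\<close> low vertices.\<close>
              case v: True
              obtain c0 where c0: "c0 \<in> C" "c0 \<noteq> v" using two_C by blast
              obtain c where c: "c \<in> C" "c \<noteq> c0" using two_C by blast
              have vC: "v \<notin> C" using v sub[OF True] by auto
              show ?thesis
              proof (rule HC.ham_path_private_common[of u "{c0}" "{u}" v "C - {c0}" c f])
                show "HC.path_start u {c0} {u}"
                  using True adjC c0 finC unfolding HC.path_start_def by blast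
                show "card (C - {c0}) + 1 = card (LX - {u})" using cL c0 finC one t3 by simp
                show "f ` (LX - {u}) \<subseteq> Y - {c0} - (C - {c0})" using sub c0 by auto
              qed (use uv c0 c vC inj' adj adjC finC in auto)
            qed
          qed
          then show ?thesis by blast
        qed
      qed
    qed
  qed
qed

text \<open>Low vertices on both sides occur only for \<open>t = 2\<close>, one on each. If these
  two are not adjacent, each has two high neighbours and a path exists; if they are, the graph has
  the shape of \<open>N\<close>.\<close>

theorem ham_path_or_exceptional:
  "(\<forall>u\<in>X. \<forall>v\<in>Y. ham_path E (X \<union> Y) u v) \<or>
   (t \<noteq> 2 \<and> (confined X Y E t \<or> confined Y X E t)) \<or>
   (t = 2 \<and> (two_of_degree X Y E 2 \<or> two_of_degree Y X E 2 \<or>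
      (\<exists>x\<in>X. \<exists>y\<in>Y. E x y \<and> deg_in E Y x \<le> 2 \<and> deg_in E X y \<le> 2)))"
proof -
  interpret S: dense_closed Y X E t by (rule dense_closed_swap)
  have eq: "S.LX = LY" "S.LY = LX" unfolding S.LX_def LY_def S.LY_def LX_def by auto
  consider (1) "LX = {}" "LY = {}" | (2) "LX \<noteq> {}" "LY = {}" | (3) "LX = {}" "LY \<noteq> {}"
    | (4) "LX \<noteq> {}" "LY \<noteq> {}" by blast
  then show ?thesis
  proof cases
    case 1
    have "ham_path E (X \<union> Y) u v" if "u \<in> X" "v \<in> Y" for u v
    proof -
      have "\<exists>\<pi>. alt_path E u v \<pi> Y \<and> \<pi> ` Y = X"
        by (rule alt_path_complete) (use finite_X finite_Y card_eq that symp_E high_adjacent 1 in auto)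
      then show ?thesis using ham_path_all by blast
    qed
    then show ?thesis by blast
  next
    case 2
    then show ?thesis using one_sided by blast
  next
    case 3
    have "(\<forall>u\<in>X. \<forall>v\<in>Y. ham_path E (X \<union> Y) u v)" if "\<forall>u\<in>Y. \<forall>v\<in>X. ham_path E (Y \<union> X) u v"
      using that ham_path_rev[OF _ symp_E] by (metis Un_commute)
    then show ?thesis using S.one_sided 3 eq by metis
  next
    case 4
    have c: "t = 2" "card LX = 1" "card LY = 1" using both_low[OF 4] by auto
    then obtain x y where xy: "LX = {x}" "LY = {y}" by (auto simp: card_1_singleton_iff)
    have mem: "x \<in> X" "y \<in> Y" using xy LX_subset LY_subset by auto
    have deg: "deg_in E Y x \<le> 2" "deg_in E X y \<le> 2"
      using deg_low[of x] S.deg_low[of y] c xy eq by auto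
    show ?thesis
    proof (cases "E x y")
      case True
      then show ?thesis using c mem deg by blast
    next
      case False
      have "card {z \<in> Y. E x z} = 2" "card {z \<in> X. E y z} = 2"
        using deg min_deg_X[OF mem(1)] min_deg_Y[OF mem(2)] c(1) by (auto simp: deg_in_def)
      then obtain c1 c2 d1 d2 where cd: "{z \<in> Y. E x z} = {c1, c2}" "c1 \<noteq> c2" "{z \<in> X. E y z} = {d1, d2}" "d1 \<noteq> d2"
        by (auto simp: card_2_iff)
      have nb: "c1 \<in> {z \<in> Y. E x z}" "c2 \<in> {z \<in> Y. E x z}" "d1 \<in> {z \<in> X. E y z}" "d2 \<in> {z \<in> X. E y z}"
        unfolding cd by auto
      have "ham_path E (X \<union> Y) u v" if "u \<in> X" "v \<in> Y" for u v
      proof (rule ham_path_two_defects[of x y c1 c2 d1 d2])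
        show "E a b" if "a \<in> X - {x}" "b \<in> Y - {y}" for a b using high_adjacent that xy by auto
        show "E d1 y" "E d2 y" using nb sym_E by auto
        show "d1 \<in> X - {x}" "d2 \<in> X - {x}" using nb False sym_E by auto
        show "c1 \<in> Y - {y}" "c2 \<in> Y - {y}" using nb False by auto
      qed (use nb mem cd that in auto)
      then show ?thesis by blast
    qed
  qed
qed

end

section \<open>The spectral radius as a maximum of the Rayleigh quotient\<close>

text \<open>Functions on \<open>nat\<close> replace vectors so that compactness can be taken from
  the product topology.\<close>

definition adj_form :: "nat \<Rightarrow> (nat \<Rightarrow> nat \<Rightarrow> bool) \<Rightarrow> (nat \<Rightarrow> real) \<Rightarrow> (nat \<Rightarrow> real) \<Rightarrow> real" where
  "adj_form N E w z = (\<Sum>i<N. \<Sum>j<N. of_bool (E i j) * (w i * z j))"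

definition inner_form :: "nat \<Rightarrow> (nat \<Rightarrow> real) \<Rightarrow> (nat \<Rightarrow> real) \<Rightarrow> real" where
  "inner_form N w z = (\<Sum>i<N. w i * z i)"

lemma adj_form_commute:
  assumes "symp E"
  shows "adj_form N E w z = adj_form N E z w"
proof -
  have "E i j \<longleftrightarrow> E j i" for i j using assms by (auto dest: sympD)
  then have "adj_form N E w z = (\<Sum>i<N. \<Sum>j<N. of_bool (E j i) * (z j * w i))"
    unfolding adj_form_def by (intro sum.cong refl) (auto simp: mult.commute)
  also have "\<dots> = adj_form N E z w" unfolding adj_form_def by (rule sum.swap)
  finally show ?thesis .
qed

lemma adj_form_add_scale:
  assumes "symp E"
  shows "adj_form N E (\<lambda>i. w i + s * z i) (\<lambda>i. w i + s * z i) =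
    adj_form N E w w + 2 * s * adj_form N E w z + s\<^sup>2 * adj_form N E z z"
proof -
  have "adj_form N E (\<lambda>i. w i + s * z i) (\<lambda>i. w i + s * z i) =
    adj_form N E w w + s * adj_form N E w z + s * adj_form N E z w + s\<^sup>2 * adj_form N E z z"
    unfolding adj_form_def sum_distrib_left sum.distrib[symmetric]
    by (intro sum.cong refl) (simp add: algebra_simps power2_eq_square)
  then show ?thesis using adj_form_commute[OF assms, of N z w] by simp
qed

lemma inner_form_add_scale:
  "inner_form N (\<lambda>i. w i + s * z i) (\<lambda>i. w i + s * z i) =
    inner_form N w w + 2 * s * inner_form N w z + s\<^sup>2 * inner_form N z z"
  unfolding inner_form_def sum_distrib_left sum.distrib[symmetric]
  by (intro sum.cong refl) (simp add: algebra_simps power2_eq_square)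

lemma adj_form_scale: "adj_form N E (\<lambda>i. c * w i) (\<lambda>i. c * w i) = c\<^sup>2 * adj_form N E w w"
  unfolding adj_form_def sum_distrib_left
  by (intro sum.cong refl) (simp add: algebra_simps power2_eq_square)

lemma inner_form_scale: "inner_form N (\<lambda>i. c * w i) (\<lambda>i. c * w i) = c\<^sup>2 * inner_form N w w"
  unfolding inner_form_def sum_distrib_left
  by (intro sum.cong refl) (simp add: algebra_simps power2_eq_square)

lemma inner_form_nonneg: "inner_form N w w \<ge> 0"
  unfolding inner_form_def by (intro sum_nonneg) simp

lemma inner_form_eq_0: "inner_form N w w = 0 \<longleftrightarrow> (\<forall>i<N. w i = 0)"
  unfolding inner_form_def by (subst sum_nonneg_eq_0_iff) auto

lemma adj_form_attains_max:
  assumes "N > 0"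
  shows "\<exists>w. inner_form N w w = 1 \<and> (\<forall>z. adj_form N E z z \<le> adj_form N E w w * inner_form N z z)"
proof -
  \<comment> \<open>Coordinates from \<open>N\<close> on are pinned to \<open>0\<close>, which makes
    the cube compact; the forms do not read them.\<close>
  define K where "K = PiE UNIV (\<lambda>i. if i < N then {-1..1} else {0 :: real})"
  define S where "S = K \<inter> {w. inner_form N w w = 1}"
  have "compactin (product_topology (\<lambda>_. euclidean) UNIV) K"
    unfolding K_def compactin_PiE by (auto simp: compactin_euclidean_iff)
  then have "compact K"
    by (simp add: euclidean_product_topology compactin_euclidean_iff)
  moreover have coord: "continuous_on A (\<lambda>w :: nat \<Rightarrow> real. w i)" for A i
    by (rule continuous_on_subset[OF continuous_on_product_coordinates]) simp
  have cont: "continuous_on A (\<lambda>w. inner_form N w w)" for A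
    unfolding inner_form_def by (intro continuous_intros coord)
  have "closed {w :: nat \<Rightarrow> real. inner_form N w w = 1}"
    by (intro closed_Collect_eq cont continuous_on_const)
  ultimately have "compact S" unfolding S_def by (rule compact_Int_closed)
  moreover have "S \<noteq> {}"
  proof -
    have "(\<lambda>i. if i = 0 then 1 else 0) \<in> S"
      using assms unfolding S_def K_def by (auto simp: inner_form_def if_distrib cong: if_cong)
    then show ?thesis by blast
  qed
  moreover have "continuous_on S (\<lambda>w. adj_form N E w w)"
    unfolding adj_form_def by (intro continuous_intros coord)
  ultimately obtain w where w: "w \<in> S" "\<And>z. z \<in> S \<Longrightarrow> adj_form N E z z \<le> adj_form N E w w"
    using continuous_attains_sup[of S "\<lambda>w. adj_form N E w w"] by blast
  have "adj_form N E z z \<le> adj_form N E w w * inner_form N z z" for z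
  proof (cases "inner_form N z z = 0")
    case True
    then have "adj_form N E z z = 0" unfolding adj_form_def inner_form_eq_0 by simp
    then show ?thesis using True by simp
  next
    case False
    then have pos: "inner_form N z z > 0" using inner_form_nonneg[of N z] by simp
    define c where "c = 1 / sqrt (inner_form N z z)"
    have c2: "c\<^sup>2 * inner_form N z z = 1" using pos by (simp add: c_def power_divide)
    define y where "y = (\<lambda>i. if i < N then c * z i else 0)"
    have yi: "inner_form N y y = inner_form N (\<lambda>i. c * z i) (\<lambda>i. c * z i)"
      unfolding inner_form_def y_def by (intro sum.cong) auto
    have ya: "adj_form N E y y = adj_form N E (\<lambda>i. c * z i) (\<lambda>i. c * z i)"
      unfolding adj_form_def y_def by (intro sum.cong) auto
    have y1: "inner_form N y y = 1" using c2 yi inner_form_scale by simp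
    have "\<bar>y i\<bar> \<le> 1" if "i < N" for i
    proof -
      have "y i * y i \<le> inner_form N y y"
        unfolding inner_form_def using that by (intro member_le_sum) auto
      then have "(y i)\<^sup>2 \<le> 1" using y1 by (simp add: power2_eq_square)
      then show ?thesis by (simp add: abs_square_le_1)
    qed
    then have "y \<in> S" unfolding S_def K_def using y1 by (auto simp: y_def abs_le_iff)
    then have "c\<^sup>2 * adj_form N E z z \<le> adj_form N E w w"
      using w(2)[of y] ya adj_form_scale[of N E c z] by simp
    then have "c\<^sup>2 * adj_form N E z z * inner_form N z z \<le> adj_form N E w w * inner_form N z z"
      using pos by (intro mult_right_mono) auto
    moreover have "c\<^sup>2 * adj_form N E z z * inner_form N z z = adj_form N E z z * (c\<^sup>2 * inner_form N z z)"
      by (simp add: ac_simps)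
    ultimately show ?thesis unfolding c2 by simp
  qed
  moreover have "inner_form N w w = 1" using w(1) by (simp add: S_def)
  ultimately show ?thesis by blast
qed

text \<open>Moving \<open>w\<close> along the \<open>i\<close>-th unit vector changes the form to
  first order by a multiple of \<open>b\<close>, and the second-order term cannot compensate it
  unless \<open>b = 0\<close>. This is the \<open>i\<close>-th eigenvalue equation.\<close>

lemma eigen_equation_of_max:
  assumes "symp E" and max: "\<And>z. adj_form N E z z \<le> c * inner_form N z z"
    and eq: "adj_form N E w w = c * inner_form N w w" and "i < N"
  shows "(\<Sum>j<N. of_bool (E i j) * w j) = c * w i"
proof -
  define z where "z = (\<lambda>j. if j = i then 1 else 0 :: real)"
  define b where "b = adj_form N E w z - c * inner_form N w z"
  define d where "d = c * inner_form N z z - adj_form N E z z"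
  have quad: "2 * s * b \<le> s\<^sup>2 * d" for s
    using max[of "\<lambda>j. w j + s * z j"] eq
    unfolding adj_form_add_scale[OF assms(1)] inner_form_add_scale b_def d_def
    by (simp add: algebra_simps)
  have "b = 0"
  proof (rule ccontr)
    assume "b \<noteq> 0"
    then have b2: "b\<^sup>2 > 0" by simp
    \<comment> \<open>A positive number above \<open>d\<close>, which may be \<open>0\<close>; the
      choice \<open>s = b / e\<close> then refutes \<open>quad\<close>.\<close>
    define e where "e = \<bar>d\<bar> + 1"
    have e: "e > 0" "d \<le> e" by (auto simp: e_def)
    have "2 * (b / e) * b \<le> (b / e)\<^sup>2 * d" by (rule quad)
    then have "2 * b\<^sup>2 * e \<le> b\<^sup>2 * d" using e(1) by (simp add: field_simps power2_eq_square)
    also have "\<dots> \<le> b\<^sup>2 * e" using b2 e(2) by (intro mult_left_mono) auto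
    finally have "2 * (b\<^sup>2 * e) \<le> b\<^sup>2 * e" by (simp only: mult.assoc)
    then show False using mult_pos_pos[OF b2 e(1)] by linarith
  qed
  moreover have "inner_form N w z = w i"
    using assms(4) unfolding inner_form_def z_def by (simp add: if_distrib cong: if_cong)
  moreover have "adj_form N E w z = adj_form N E z w" by (rule adj_form_commute[OF assms(1)])
  moreover have "adj_form N E z w = (\<Sum>j<N. of_bool (E i j) * w j)"
  proof -
    have "adj_form N E z w = (\<Sum>k<N. if k = i then \<Sum>j<N. of_bool (E i j) * w j else 0)"
      unfolding adj_form_def z_def by (intro sum.cong refl) auto
    then show ?thesis using assms(4) by simp
  qed
  ultimately show ?thesis unfolding b_def by simp
qed

lemma eigenvalue_adj_matrix_iff:
  "eigenvalue (adj_matrix N E) c \<longleftrightarrow>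
     (\<exists>w. (\<exists>i<N. w i \<noteq> 0) \<and> (\<forall>i<N. (\<Sum>j<N. of_bool (E i j) * w j) = c * w i))"
proof -
  have dim: "dim_row (adj_matrix N E) = N" by (simp add: adj_matrix_def)
  have row: "(adj_matrix N E *\<^sub>v v) $ i = (\<Sum>j<N. of_bool (E i j) * v $ j)"
    if "i < N" "v \<in> carrier_vec N" for v i
  proof -
    have "(adj_matrix N E *\<^sub>v v) $ i = (\<Sum>j\<in>{0..<N}. of_bool (E i j) * v $ j)"
      using that by (simp add: adj_matrix_def scalar_prod_def of_bool_def)
    then show ?thesis by (simp add: atLeast0LessThan)
  qed
  show ?thesis
  proof
    assume "eigenvalue (adj_matrix N E) c"
    then obtain v where v: "v \<in> carrier_vec N" "v \<noteq> 0\<^sub>v N" "adj_matrix N E *\<^sub>v v = c \<cdot>\<^sub>v v"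
      unfolding eigenvalue_def eigenvector_def dim by blast
    have "\<exists>i<N. v $ i \<noteq> 0" using v(1,2) by (metis carrier_vecD eq_vecI index_zero_vec(1,2))
    moreover have "(\<Sum>j<N. of_bool (E i j) * v $ j) = c * v $ i" if "i < N" for i
      using row[OF that v(1)] v(1,3) that by simp
    ultimately show "\<exists>w. (\<exists>i<N. w i \<noteq> 0) \<and> (\<forall>i<N. (\<Sum>j<N. of_bool (E i j) * w j) = c * w i)"
      by (intro exI[of _ "\<lambda>i. v $ i"]) auto
  next
    assume "\<exists>w. (\<exists>i<N. w i \<noteq> 0) \<and> (\<forall>i<N. (\<Sum>j<N. of_bool (E i j) * w j) = c * w i)"
    then obtain w i where w: "i < N" "w i \<noteq> 0" "\<forall>i<N. (\<Sum>j<N. of_bool (E i j) * w j) = c * w i" by blast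
    let ?v = "vec N w"
    have "?v \<noteq> 0\<^sub>v N" using w(1,2) by (metis index_vec index_zero_vec(1))
    moreover have "adj_matrix N E *\<^sub>v ?v = c \<cdot>\<^sub>v ?v"
    proof (rule eq_vecI)
      fix i assume "i < dim_vec (c \<cdot>\<^sub>v ?v)"
      then have i: "i < N" by simp
      have "(\<Sum>j<N. of_bool (E i j) * ?v $ j) = (\<Sum>j<N. of_bool (E i j) * w j)"
        by (intro sum.cong) auto
      then show "(adj_matrix N E *\<^sub>v ?v) $ i = (c \<cdot>\<^sub>v ?v) $ i"
        using row[OF i, of ?v] w(3) i by simp
    qed (simp add: dim)
    ultimately have "eigenvector (adj_matrix N E) ?v c" unfolding eigenvector_def dim by simp
    then show "eigenvalue (adj_matrix N E) c" unfolding eigenvalue_def by blast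
  qed
qed

lemma sum_adj_form: "adj_form N E z w = (\<Sum>i<N. z i * (\<Sum>j<N. of_bool (E i j) * w j))"
  unfolding adj_form_def sum_distrib_left by (intro sum.cong refl) (simp add: algebra_simps)

text \<open>A maximiser of the Rayleigh quotient is an eigenvector, and every eigenvalue is the
  quotient of its eigenvector.\<close>

lemma spectral_radius_graph_eqI:
  assumes "symp E" and max: "\<And>z. adj_form N E z z \<le> c * inner_form N z z"
    and w: "adj_form N E w w = c * inner_form N w w" "inner_form N w w = 1"
  shows "spectral_radius_graph N E = c"
  unfolding spectral_radius_graph_def
proof (rule Max_eqI)
  have "adj_matrix N E \<in> carrier_mat N N" by (simp add: adj_matrix_def)
  then show "finite {ev. eigenvalue (adj_matrix N E) ev}"
    using card_finite_spectrum(1) unfolding spectrum_def by blast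
  have "\<not> (\<forall>i<N. w i = 0)" using w(2) inner_form_eq_0[of N w] by auto
  then show "c \<in> {ev. eigenvalue (adj_matrix N E) ev}"
    using eigen_equation_of_max[OF assms(1) max w(1)]
    unfolding eigenvalue_adj_matrix_iff mem_Collect_eq by blast
  fix ev assume "ev \<in> {ev. eigenvalue (adj_matrix N E) ev}"
  then obtain v where v: "\<exists>i<N. v i \<noteq> 0" "\<forall>i<N. (\<Sum>j<N. of_bool (E i j) * v j) = ev * v i"
    unfolding eigenvalue_adj_matrix_iff mem_Collect_eq by blast
  have "adj_form N E v v = (\<Sum>i<N. v i * (ev * v i))"
    unfolding sum_adj_form by (rule sum.cong) (use v(2) in auto)
  also have "\<dots> = ev * inner_form N v v"
    unfolding inner_form_def sum_distrib_left by (rule sum.cong) auto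
  finally have "adj_form N E v v = ev * inner_form N v v" .
  then have "ev * inner_form N v v \<le> c * inner_form N v v" using max[of v] by simp
  moreover have "inner_form N v v > 0"
    using v(1) inner_form_eq_0[of N v] inner_form_nonneg[of N v] by (metis less_eq_real_def)
  ultimately show "ev \<le> c" by simp
qed

text \<open>Passing to absolute values cannot decrease the form, as the adjacency entries are
  non-negative; this gives the non-negative maximiser.\<close>

lemma spectral_radius_graph_max:
  assumes "N > 0" "symp E"
  shows "adj_form N E z z \<le> spectral_radius_graph N E * inner_form N z z"
    and "\<exists>w. inner_form N w w = 1 \<and> (\<forall>i. w i \<ge> 0) \<and> adj_form N E w w = spectral_radius_graph N E"
proof -
  obtain w where w: "inner_form N w w = 1" "\<And>z. adj_form N E z z \<le> adj_form N E w w * inner_form N z z"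
    using adj_form_attains_max[OF assms(1)] by blast
  have eq: "spectral_radius_graph N E = adj_form N E w w"
    by (rule spectral_radius_graph_eqI[OF assms(2) w(2), of w]) (use w in auto)
  show mx: "adj_form N E z z \<le> spectral_radius_graph N E * inner_form N z z" for z
    using w(2) eq by simp
  let ?a = "\<lambda>i. \<bar>w i\<bar>"
  have "inner_form N ?a ?a = 1" using w(1) unfolding inner_form_def by simp
  moreover have "adj_form N E w w \<le> adj_form N E ?a ?a"
    unfolding adj_form_def
    by (intro sum_mono) (auto simp: of_bool_def abs_mult[symmetric])
  ultimately show "\<exists>w. inner_form N w w = 1 \<and> (\<forall>i. w i \<ge> 0) \<and> adj_form N E w w = spectral_radius_graph N E"
    using mx[of ?a] eq by (intro exI[of _ ?a]) auto
qed

text \<open>A non-negative maximiser of the form of \<open>E\<close>, transported along \<open>f\<close>, is again a maximiser for \<open>E'\<close>,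
  hence an eigenvector; if it vanishes nowhere, every edge of \<open>E'\<close> must come from \<open>E\<close>.\<close>

lemma graph_iso_of_spectral_radius_ge:
  assumes "N > 0" "symp E" "symp E'" and f: "bij_betw f {0..<N} {0..<N}"
    and sub: "\<And>i j. i < N \<Longrightarrow> j < N \<Longrightarrow> E i j \<Longrightarrow> E' (f i) (f j)"
    and rigid: "\<And>z i j c. (\<And>i. z i \<ge> 0) \<Longrightarrow> (\<And>i. i < N \<Longrightarrow> (\<Sum>j<N. of_bool (E' i j) * z j) = c * z i) \<Longrightarrow>
        i < N \<Longrightarrow> z i = 0 \<Longrightarrow> j < N \<Longrightarrow> (z j :: real) = 0"
    and ge: "spectral_radius_graph N E \<ge> spectral_radius_graph N E'"
  shows "graph_iso N E E'"
proof -
  obtain w where w: "inner_form N w w = 1" "\<And>i. w i \<ge> 0" "adj_form N E w w = spectral_radius_graph N E"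
    using spectral_radius_graph_max(2)[OF assms(1,2)] by blast
  define z where "z = w \<circ> inv_into {0..<N} f"
  have zf: "z (f i) = w i" if "i < N" for i
    using that f unfolding z_def by (simp add: bij_betw_inv_into_left)
  have f': "bij_betw f {..<N} {..<N}" using f by (simp add: atLeast0LessThan)
  have reindex: "(\<Sum>i<N. g i) = (\<Sum>i<N. g (f i))" for g :: "nat \<Rightarrow> real"
    using sum.reindex_bij_betw[OF f', of g] by simp
  have iz: "inner_form N z z = 1"
    unfolding inner_form_def reindex[of "\<lambda>i. z i * z i"] using w(1)
    by (simp add: zf inner_form_def)
  have az: "adj_form N E' z z = (\<Sum>i<N. \<Sum>j<N. of_bool (E' (f i) (f j)) * (w i * w j))"
    unfolding adj_form_def reindex[of "\<lambda>i. \<Sum>j<N. of_bool (E' i j) * (z i * z j)"]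
  proof (rule sum.cong[OF refl])
    fix i assume "i \<in> {..<N}"
    then show "(\<Sum>j<N. of_bool (E' (f i) j) * (z (f i) * z j)) =
        (\<Sum>j<N. of_bool (E' (f i) (f j)) * (w i * w j))"
      unfolding reindex[of "\<lambda>j. of_bool (E' (f i) j) * (z (f i) * z j)"]
      by (intro sum.cong refl) (simp add: zf)
  qed
  have term_le: "of_bool (E i j) * (w i * w j) \<le> of_bool (E' (f i) (f j)) * (w i * w j)"
    if "i < N" "j < N" for i j
    using sub[OF that] w(2)[of i] w(2)[of j] by (auto simp: of_bool_def)
  have le: "adj_form N E w w \<le> adj_form N E' z z"
    unfolding az unfolding adj_form_def by (intro sum_mono term_le) auto
  have eqs: "adj_form N E' z z = spectral_radius_graph N E'"
    using le ge w(3) spectral_radius_graph_max(1)[OF assms(1,3), of z] iz by simp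
  have eigen: "(\<Sum>j<N. of_bool (E' i j) * z j) = spectral_radius_graph N E' * z i" if "i < N" for i
    by (rule eigen_equation_of_max[OF assms(3)])
       (use spectral_radius_graph_max(1)[OF assms(1,3)] eqs iz that in auto)
  have z0: "z i \<ge> 0" for i using w(2) by (simp add: z_def)
  have zpos: "z i > 0" if "i < N" for i
  proof (rule ccontr)
    assume "\<not> z i > 0"
    then have "z i = 0" using z0[of i] by simp
    then have "\<forall>j<N. z j = 0" using rigid[OF z0 eigen that] by blast
    then show False using iz inner_form_eq_0[of N z] by simp
  qed
  have wpos: "w i > 0" if "i < N" for i
    using zpos[of "f i"] zf[OF that] f' that by (auto simp: bij_betw_def)
  have "adj_form N E w w = adj_form N E' z z" using le ge w(3) eqs by simp
  then have total: "(\<Sum>i<N. \<Sum>j<N. of_bool (E i j) * (w i * w j)) =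
      (\<Sum>i<N. \<Sum>j<N. of_bool (E' (f i) (f j)) * (w i * w j))"
    unfolding az unfolding adj_form_def .
  \<comment> \<open>Termwise \<open>\<le>\<close> with equal totals forces equality of all terms;
    the weights are positive, so the adjacencies agree.\<close>
  have row: "(\<Sum>j<N. of_bool (E i j) * (w i * w j)) = (\<Sum>j<N. of_bool (E' (f i) (f j)) * (w i * w j))"
    if "i < N" for i
  proof (rule sum_mono_inv[OF total])
    show "(\<Sum>j<N. of_bool (E i j) * (w i * w j)) \<le> (\<Sum>j<N. of_bool (E' (f i) (f j)) * (w i * w j))"
      if "i \<in> {..<N}" for i
      by (rule sum_mono, rule term_le) (use that in auto)
  qed (use that in auto)
  have "of_bool (E i j) * (w i * w j) = of_bool (E' (f i) (f j)) * (w i * w j)"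
    if "i < N" "j < N" for i j
  proof (rule sum_mono_inv[OF row[OF that(1)]])
    show "of_bool (E i j) * (w i * w j) \<le> of_bool (E' (f i) (f j)) * (w i * w j)" if "j \<in> {..<N}" for j
      by (rule term_le) (use that \<open>i < N\<close> in auto)
  qed (use that in auto)
  then have "E i j \<longleftrightarrow> E' (f i) (f j)" if "i < N" "j < N" for i j
    using wpos[OF that(1)] wpos[OF that(2)] that by (fastforce simp: of_bool_def split: if_splits)
  then show ?thesis using f unfolding graph_iso_def by blast
qed

section \<open>Spectral radii of bipartite graphs\<close>

lemma mult_le_quarter:
  assumes "a + b = (1 :: real)"
  shows "4 * (a * b) \<le> 1"
proof -
  have "4 * (a * b) = (a + b)\<^sup>2 - (a - b)\<^sup>2" by (simp add: power2_eq_square algebra_simps)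
  then show ?thesis using assms by simp
qed

text \<open>Cauchy-Schwarz on \<open>D\<close> and on its complement, weighted so as to clear both
  denominators.\<close>

lemma sum_sq_split_ge:
  fixes w :: "nat \<Rightarrow> real"
  assumes "finite V" "D \<subseteq> V"
  shows "real (card D) * real (card V - card D) * (\<Sum>y\<in>V. (w y)\<^sup>2) \<ge>
    real (card V - card D) * (\<Sum>y\<in>D. w y)\<^sup>2 + real (card D) * (\<Sum>y\<in>V - D. w y)\<^sup>2"
proof -
  have finD: "finite D" using assms by (auto intro: finite_subset)
  have cs: "(\<Sum>y\<in>T. w y)\<^sup>2 \<le> real (card T) * (\<Sum>y\<in>T. (w y)\<^sup>2)" for T
    using Cauchy_Schwarz_ineq_sum[of "\<lambda>_. 1" w T] by simp
  have "(\<Sum>y\<in>V. (w y)\<^sup>2) = (\<Sum>y\<in>V - D. (w y)\<^sup>2) + (\<Sum>y\<in>D. (w y)\<^sup>2)"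
    using assms(1,2) by (rule sum.subset_diff[rotated])
  moreover have "card (V - D) = card V - card D" using assms finD by (simp add: card_Diff_subset)
  moreover have "real (card V - card D) * (\<Sum>y\<in>D. w y)\<^sup>2 \<le>
      real (card V - card D) * (real (card D) * (\<Sum>y\<in>D. (w y)\<^sup>2))"
    using cs[of D] by (intro mult_left_mono) auto
  moreover have "real (card D) * (\<Sum>y\<in>V - D. w y)\<^sup>2 \<le>
      real (card D) * (real (card (V - D)) * (\<Sum>y\<in>V - D. (w y)\<^sup>2))"
    using cs[of "V - D"] by (intro mult_left_mono) auto
  ultimately show ?thesis by (simp add: algebra_simps)
qed

context balanced_bipartite
begin

lemma adj_form_bipartite:
  assumes "X \<union> Y = {..<N}"
  shows "adj_form N E w w = 2 * (\<Sum>x\<in>X. \<Sum>y\<in>Y. of_bool (E x y) * (w x * w y))"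
proof -
  have split: "(\<Sum>i<N. g i) = (\<Sum>x\<in>X. g x) + (\<Sum>y\<in>Y. g y)" for g :: "nat \<Rightarrow> real"
    unfolding assms[symmetric] using finite_X finite_Y disjoint by (rule sum.union_disjoint)
  have "(\<Sum>j<N. of_bool (E x j) * (w x * w j)) = (\<Sum>y\<in>Y. of_bool (E x y) * (w x * w y))" if "x \<in> X" for x
    unfolding split using indep_X that by (auto intro!: sum.neutral simp: of_bool_def)
  moreover have "(\<Sum>j<N. of_bool (E y j) * (w y * w j)) = (\<Sum>x\<in>X. of_bool (E x y) * (w x * w y))" if "y \<in> Y" for y
  proof -
    have "(\<Sum>z\<in>Y. of_bool (E y z) * (w y * w z)) = 0"
      using indep_Y that by (intro sum.neutral) auto
    moreover have "E y x \<longleftrightarrow> E x y" for x using sym_E by blast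
    then have "(\<Sum>x\<in>X. of_bool (E y x) * (w y * w x)) = (\<Sum>x\<in>X. of_bool (E x y) * (w x * w y))"
      by (intro sum.cong refl) (simp add: mult.commute)
    ultimately show ?thesis unfolding split by simp
  qed
  ultimately have "adj_form N E w w = (\<Sum>x\<in>X. \<Sum>y\<in>Y. of_bool (E x y) * (w x * w y)) +
      (\<Sum>y\<in>Y. \<Sum>x\<in>X. of_bool (E x y) * (w x * w y))"
    unfolding adj_form_def split[of "\<lambda>i. \<Sum>j<N. of_bool (E i j) * (w i * w j)"] by simp
  then show ?thesis using sum.swap[of "\<lambda>y x. of_bool (E x y) * (w x * w y)" X Y] by simp
qed

lemma inner_form_bipartite:
  assumes "X \<union> Y = {..<N}"
  shows "inner_form N w w = (\<Sum>x\<in>X. (w x)\<^sup>2) + (\<Sum>y\<in>Y. (w y)\<^sup>2)"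
  unfolding inner_form_def assms[symmetric] power2_eq_square
  using finite_X finite_Y disjoint by (rule sum.union_disjoint)

lemma card_edges: "card {z \<in> X \<times> Y. E (fst z) (snd z)} + missing X Y E = card X * card X"
proof -
  have "card {z \<in> X \<times> Y. E (fst z) (snd z)} + missing X Y E =
      card ({z \<in> X \<times> Y. E (fst z) (snd z)} \<union> {z \<in> X \<times> Y. \<not> E (fst z) (snd z)})"
    unfolding missing_def using finite_X finite_Y by (intro card_Un_disjoint[symmetric]) auto
  also have "{z \<in> X \<times> Y. E (fst z) (snd z)} \<union> {z \<in> X \<times> Y. \<not> E (fst z) (snd z)} = X \<times> Y" by blast
  finally show ?thesis by (simp add: card_cartesian_product card_eq)
qed

text \<open>Cauchy-Schwarz over the pairs in \<open>X \<times> Y\<close> separates adjacency from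
  the weights, whose squares sum to \<open>a * b \<le> 1 / 4\<close>.\<close>

lemma spectral_radius_sq_le:
  assumes "X \<union> Y = {..<N}" "N > 0"
  shows "(spectral_radius_graph N E)\<^sup>2 + real (missing X Y E) \<le> (real (card X))\<^sup>2"
proof -
  obtain w where w: "inner_form N w w = 1" "adj_form N E w w = spectral_radius_graph N E"
    using spectral_radius_graph_max(2)[OF assms(2) symp_E] by blast
  let ?Z = "X \<times> Y"
  let ?e = "\<lambda>z. of_bool (E (fst z) (snd z)) :: real"
  let ?g = "\<lambda>z. w (fst z) * w (snd z)"
  define s where "s = (\<Sum>z\<in>?Z. ?e z * ?g z)"
  have s: "spectral_radius_graph N E = 2 * s"
    unfolding w(2)[symmetric] adj_form_bipartite[OF assms(1)] s_def
    by (simp add: sum.cartesian_product split_beta)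
  define a b where "a = (\<Sum>x\<in>X. (w x)\<^sup>2)" and "b = (\<Sum>y\<in>Y. (w y)\<^sup>2)"
  have ab: "a + b = 1" using w(1) inner_form_bipartite[OF assms(1), of w] by (simp add: a_def b_def)
  have "s\<^sup>2 \<le> (\<Sum>z\<in>?Z. (?e z)\<^sup>2) * (\<Sum>z\<in>?Z. (?g z)\<^sup>2)"
    unfolding s_def by (rule Cauchy_Schwarz_ineq_sum)
  also have "(\<Sum>z\<in>?Z. (?g z)\<^sup>2) = a * b"
    unfolding a_def b_def sum_product by (simp add: sum.cartesian_product split_beta power_mult_distrib)
  also have "(\<Sum>z\<in>?Z. (?e z)\<^sup>2) = real (card {z \<in> ?Z. E (fst z) (snd z)})"
  proof -
    have "(\<Sum>z\<in>?Z. (?e z)\<^sup>2) = (\<Sum>z\<in>?Z. if E (fst z) (snd z) then 1 else 0)"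
      by (intro sum.cong) auto
    also have "\<dots> = (\<Sum>z\<in>{z \<in> ?Z. E (fst z) (snd z)}. 1)"
      using finite_X finite_Y by (intro sum.inter_filter[symmetric]) auto
    finally show ?thesis by simp
  qed
  finally have "4 * s\<^sup>2 \<le> real (card {z \<in> ?Z. E (fst z) (snd z)}) * (4 * (a * b))" by simp
  also have "\<dots> \<le> real (card {z \<in> ?Z. E (fst z) (snd z)}) * 1"
    using mult_le_quarter[OF ab] by (intro mult_left_mono) auto
  finally have "4 * s\<^sup>2 \<le> real (card {z \<in> ?Z. E (fst z) (snd z)})" by simp
  moreover have "real (card {z \<in> ?Z. E (fst z) (snd z)}) + real (missing X Y E) = (real (card X))\<^sup>2"
    using arg_cong[OF card_edges, of real] by (simp add: power2_eq_square)
  ultimately show ?thesis by (simp add: s power_mult_distrib)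
qed

text \<open>Weights \<open>b\<close> on \<open>A\<close> and \<open>a\<close> on \<open>B\<close>
  attain the radius of the complete part. A weight \<open>e\<close> on \<open>y0\<close> gains at
  least \<open>2 * b * e\<close> in the form and costs only
  \<open>a * b * e\<^sup>2\<close>.\<close>

lemma spectral_radius_gt_complete:
  assumes V: "X \<union> Y = {..<N}" and A: "A \<subseteq> X" and B: "B \<subseteq> Y" "B \<noteq> {}"
    and compl: "\<And>a b. a \<in> A \<Longrightarrow> b \<in> B \<Longrightarrow> E a b"
    and x0: "x0 \<in> A" and y0: "y0 \<in> Y - B" "E x0 y0"
  shows "spectral_radius_graph N E > sqrt (real (card A) * real (card B))"
proof (rule ccontr)
  have fin: "finite A" "finite B" using A B finite_X finite_Y by (auto intro: finite_subset)
  define a b where "a = sqrt (real (card A))" and "b = sqrt (real (card B))"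
  have "card A > 0" "card B > 0" using fin x0 B(2) by (auto simp: card_gt_0_iff)
  then have pos: "a > 0" "b > 0" and sq: "real (card A) = a\<^sup>2" "real (card B) = b\<^sup>2"
    by (auto simp: a_def b_def)
  assume "\<not> ?thesis"
  then have le: "spectral_radius_graph N E \<le> a * b" by (simp add: a_def b_def real_sqrt_mult)
  \<comment> \<open>Any positive value below \<open>2 / a\<close> makes the gain exceed the
    cost.\<close>
  define e where "e = 1 / a"
  have e: "e > 0" "a * e = 1" using pos by (auto simp: e_def)
  define z where "z = (\<lambda>i. if i \<in> A then b else if i \<in> B then a else if i = y0 then e else 0)"
  have zA: "z x = b" if "x \<in> A" for x using that by (simp add: z_def)
  have notA: "y \<notin> A" if "y \<in> Y" for y using that A disjoint by blast
  have zX: "z x = 0" if "x \<in> X - A" for x using that B y0 disjoint by (auto simp: z_def)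
  have zB: "z y = a" if "y \<in> B" for y using that notA[of y] B by (auto simp: z_def)
  have zy0: "z y0 = e" using notA[of y0] y0 by (simp add: z_def)
  have zY: "z y = 0" if "y \<in> Y - insert y0 B" for y using that notA[of y] by (auto simp: z_def)
  have z0: "z i \<ge> 0" for i using pos e by (simp add: z_def)
  let ?t = "\<lambda>x y. of_bool (E x y) * (z x * z y)"
  have row: "(\<Sum>y\<in>Y. ?t x y) \<ge> b\<^sup>2 * (b * a) + of_bool (E x y0) * (b * e)" if x: "x \<in> A" for x
  proof -
    have "(\<Sum>y\<in>insert y0 B. ?t x y) = ?t x y0 + (\<Sum>y\<in>B. ?t x y)"
      using fin y0 by (intro sum.insert) auto
    also have "(\<Sum>y\<in>B. ?t x y) = (\<Sum>y\<in>B. b * a)"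
      by (intro sum.cong refl) (simp add: compl x zA zB)
    also have "\<dots> = b\<^sup>2 * (b * a)" by (simp add: sq)
    finally have "(\<Sum>y\<in>insert y0 B. ?t x y) = b\<^sup>2 * (b * a) + of_bool (E x y0) * (b * e)"
      by (simp add: zA[OF x] zy0)
    moreover have "(\<Sum>y\<in>insert y0 B. ?t x y) \<le> (\<Sum>y\<in>Y. ?t x y)"
      using finite_Y B y0 z0 by (intro sum_mono2) auto
    ultimately show ?thesis by simp
  qed
  have "a\<^sup>2 * (b\<^sup>2 * (b * a)) + b * e \<le> (\<Sum>x\<in>A. b\<^sup>2 * (b * a)) + (\<Sum>x\<in>A. of_bool (E x y0) * (b * e))"
  proof -
    have "of_bool (E x0 y0) * (b * e) \<le> (\<Sum>x\<in>A. of_bool (E x y0) * (b * e))"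
      by (rule member_le_sum[OF x0]) (use pos e fin in auto)
    then show ?thesis using y0 by (simp add: sq)
  qed
  also have "\<dots> \<le> (\<Sum>x\<in>A. \<Sum>y\<in>Y. ?t x y)"
    unfolding sum.distrib[symmetric] by (rule sum_mono) (rule row)
  also have "\<dots> \<le> (\<Sum>x\<in>X. \<Sum>y\<in>Y. ?t x y)"
    using finite_X A z0 by (intro sum_mono2 sum_nonneg) auto
  finally have "2 * (a\<^sup>2 * (b\<^sup>2 * (b * a)) + b * e) \<le> adj_form N E z z"
    unfolding adj_form_bipartite[OF V] by simp
  also have "\<dots> \<le> spectral_radius_graph N E * inner_form N z z"
    using spectral_radius_graph_max(1)[OF _ symp_E] V x0 A by (cases "N = 0") auto
  also have "\<dots> \<le> a * b * inner_form N z z"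
    using le inner_form_nonneg by (rule mult_right_mono)
  also have "inner_form N z z = 2 * a\<^sup>2 * b\<^sup>2 + e\<^sup>2"
  proof -
    have "(\<Sum>x\<in>X. (z x)\<^sup>2) = (\<Sum>x\<in>A. (z x)\<^sup>2)"
      using finite_X A zX by (intro sum.mono_neutral_right) auto
    also have "\<dots> = a\<^sup>2 * b\<^sup>2" by (simp add: zA sq)
    finally have 1: "(\<Sum>x\<in>X. (z x)\<^sup>2) = a\<^sup>2 * b\<^sup>2" .
    have "(\<Sum>y\<in>Y. (z y)\<^sup>2) = (\<Sum>y\<in>insert y0 B. (z y)\<^sup>2)"
      using finite_Y B y0 zY by (intro sum.mono_neutral_right) auto
    also have "\<dots> = (z y0)\<^sup>2 + (\<Sum>y\<in>B. (z y)\<^sup>2)" using fin y0 by (intro sum.insert) auto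
    also have "\<dots> = e\<^sup>2 + b\<^sup>2 * a\<^sup>2" by (simp add: zB zy0 sq)
    finally show ?thesis using 1 inner_form_bipartite[OF V, of z] by simp
  qed
  finally have "2 * (a\<^sup>2 * (b\<^sup>2 * (b * a)) + b * e) \<le> a * b * (2 * a\<^sup>2 * b\<^sup>2 + e\<^sup>2)" .
  then have "2 * (b * e) \<le> a * b * e\<^sup>2" by (simp add: algebra_simps)
  also have "\<dots> = b * e * (a * e)" by (simp add: power2_eq_square algebra_simps)
  finally show False using pos e by simp
qed

end

text \<open>Positive semidefiniteness of the quadratic form that compares \<open>(n - 1)\<^sup>2\<close> with the square of the
  spectral radius of a complete bipartite graph in which two vertices keep only \<open>k\<close> neighbours.\<close>

lemma two_defect_form_nonneg:
  fixes n k \<alpha> \<beta> :: real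
  assumes "k \<ge> 1" "n \<ge> 2 * k\<^sup>2 + 3"
  shows "k * (n - k) * ((n - 2) * (\<alpha> + \<beta>)\<^sup>2 + 2 * \<alpha>\<^sup>2) \<le> (n - 1)\<^sup>2 * ((n - k) * \<alpha>\<^sup>2 + k * \<beta>\<^sup>2)"
proof -
  define m where "m = n - 2"
  have n: "n = m + 2" by (simp add: m_def)
  have k2: "k\<^sup>2 \<ge> k" using assms(1) by (simp add: power2_eq_square)
  have m: "m \<ge> 2 * k\<^sup>2 + 1" using assms(2) by (simp add: m_def)
  then have mk: "m \<ge> 2 * k + 1" using k2 by linarith
  have mpos: "m > 0" using mk assms(1) by linarith
  \<comment> \<open>As a form in \<open>\<alpha>\<close> and \<open>\<beta>\<close>, right minus
    left side has the coefficients \<open>(n - k) * A\<close> at \<open>\<alpha>\<^sup>2\<close>,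
    \<open>- 2 * k * B\<close> at \<open>\<alpha> * \<beta>\<close> and \<open>k * C\<close> at
    \<open>\<beta>\<^sup>2\<close>; multiplying by \<open>C\<close> completes the square.\<close>
  define C where "C = 1 + k * m"
  define B where "B = (m + 2 - k) * m"
  define A where "A = (m + 1)\<^sup>2 - k * (m + 2)"
  have C: "C > 0" using mpos assms(1) by (simp add: C_def add_pos_pos)
  have nk: "n - k > 0" using mk n assms(1) by linarith
  have key: "A * C * (n - k) - k * B\<^sup>2 = (n - k) * ((m + 1)\<^sup>2 - 2 * k - 2 * k\<^sup>2 * m)"
    unfolding A_def B_def C_def n by (simp add: algebra_simps power2_eq_square power3_eq_cube)
  \<comment> \<open>The quadratic lower bound on \<open>n\<close> is what makes the discriminant
    term non-negative.\<close>
  have "m * m \<ge> (2 * k\<^sup>2 + 1) * m" using m mpos by (intro mult_right_mono) auto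
  then have "(m + 1)\<^sup>2 - 2 * k - 2 * k\<^sup>2 * m \<ge> 0" using mk mpos by (simp add: power2_eq_square algebra_simps)
  then have disc: "A * C * (n - k) - k * B\<^sup>2 \<ge> 0" unfolding key using nk by (intro mult_nonneg_nonneg) auto
  have "C * ((n - 1)\<^sup>2 * ((n - k) * \<alpha>\<^sup>2 + k * \<beta>\<^sup>2) - k * (n - k) * ((n - 2) * (\<alpha> + \<beta>)\<^sup>2 + 2 * \<alpha>\<^sup>2)) =
     k * (C * \<beta> - B * \<alpha>)\<^sup>2 + (A * C * (n - k) - k * B\<^sup>2) * \<alpha>\<^sup>2"
    unfolding A_def B_def C_def n by (simp add: algebra_simps power2_eq_square)
  also have "\<dots> \<ge> 0" using disc assms(1) by (intro add_nonneg_nonneg mult_nonneg_nonneg) auto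
  finally show ?thesis using C by (simp add: zero_le_mult_iff)
qed

context balanced_bipartite
begin

text \<open>With \<open>r x\<close> the weight seen by \<open>x\<close>, Cauchy-Schwarz reduces the
  claim to bounding the sum of the squares of \<open>r\<close> by
  \<open>(n - 1)\<^sup>2 * q\<close>. All rows see at most \<open>\<sigma>\<close>, and the two
  deficient ones at most the weight of \<open>k\<close> vertices.\<close>

lemma spectral_radius_le_two_defects:
  assumes V: "X \<union> Y = {..<N}" and two: "two_of_degree X Y E k"
    and k: "k \<ge> 1" "card X \<ge> 2 * k\<^sup>2 + 3"
  shows "spectral_radius_graph N E \<le> real (card X) - 1"
proof -
  define n where "n = real (card X)"
  obtain a b where ab: "a \<in> X" "b \<in> X" "a \<noteq> b" "deg_in E Y a \<le> k" "deg_in E Y b \<le> k"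
    using two unfolding two_of_degree_def by blast
  have N: "N > 0" using ab V by (cases "N = 0") auto
  have "k \<le> k\<^sup>2" using k(1) by (simp add: power2_eq_square)
  then have kn: "k < card X" using k(2) by linarith
  have rk: "real k \<ge> 1" "n \<ge> 2 * (real k)\<^sup>2 + 3"
  proof -
    show "real k \<ge> 1" using k by simp
    have "real (2 * k\<^sup>2 + 3) \<le> real (card X)" using k(2) by (rule of_nat_mono)
    then show "n \<ge> 2 * (real k)\<^sup>2 + 3" by (simp add: n_def)
  qed
  obtain w where w: "inner_form N w w = 1" "\<And>i. w i \<ge> 0" "adj_form N E w w = spectral_radius_graph N E"
    using spectral_radius_graph_max(2)[OF N symp_E] by blast
  define p q where "p = (\<Sum>x\<in>X. (w x)\<^sup>2)" and "q = (\<Sum>y\<in>Y. (w y)\<^sup>2)"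
  have pq: "p + q = 1" "q \<ge> 0" "p \<ge> 0"
    using w(1) inner_form_bipartite[OF V, of w] by (auto simp: p_def q_def sum_nonneg)
  define r where "r x = (\<Sum>y\<in>Y. of_bool (E x y) * w y)" for x
  define \<sigma> where "\<sigma> = (\<Sum>y\<in>Y. w y)"
  have r0: "r x \<ge> 0" for x unfolding r_def using w(2) by (intro sum_nonneg) auto
  have r_le: "r x \<le> \<sigma>" for x unfolding r_def \<sigma>_def using w(2) by (intro sum_mono) (auto simp: of_bool_def)
  \<comment> \<open>The neighbourhoods of \<open>a\<close> and \<open>b\<close> may differ, so the
    estimate is proved as if both deficient rows were \<open>x\<close>; averaging it over
    \<open>a\<close> and \<open>b\<close> gives \<open>rsum\<close>.\<close>
  have low: "(n - 2) * \<sigma>\<^sup>2 + 2 * (r x)\<^sup>2 \<le> (n - 1)\<^sup>2 * q" if x: "deg_in E Y x \<le> k" for x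
  proof -
    obtain D where D: "{y \<in> Y. E x y} \<subseteq> D" "D \<subseteq> Y" "card D = k"
      using exists_subset_between[of "{y \<in> Y. E x y}" k Y] x kn card_eq finite_Y
      unfolding deg_in_def by auto
    define \<alpha> \<beta> where "\<alpha> = (\<Sum>y\<in>D. w y)" and "\<beta> = (\<Sum>y\<in>Y - D. w y)"
    have finD: "finite D" using D finite_Y by (auto intro: finite_subset)
    have \<sigma>: "\<sigma> = \<alpha> + \<beta>"
      unfolding \<sigma>_def \<alpha>_def \<beta>_def using sum.subset_diff[OF D(2) finite_Y, of w] by simp
    have "r x = (\<Sum>y\<in>D. of_bool (E x y) * w y)" unfolding r_def
      using D finite_Y by (intro sum.mono_neutral_right) auto
    also have "\<dots> \<le> \<alpha>" unfolding \<alpha>_def using w(2) by (intro sum_mono) (auto simp: of_bool_def)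
    finally have rx: "(r x)\<^sup>2 \<le> \<alpha>\<^sup>2" using r0 by (intro power_mono)
    have nk: "real (card Y - card D) = n - k" using D kn card_eq by (simp add: n_def of_nat_diff)
    have pos: "real k * (n - k) > 0" using k kn by (simp add: n_def)
    have "(n - k) * \<alpha>\<^sup>2 + k * \<beta>\<^sup>2 \<le> k * (n - k) * q"
      using sum_sq_split_ge[OF finite_Y D(2), of w] D k kn card_eq
      unfolding nk \<alpha>_def \<beta>_def q_def by simp
    then have "(n - 1)\<^sup>2 * ((n - k) * \<alpha>\<^sup>2 + k * \<beta>\<^sup>2) \<le> (n - 1)\<^sup>2 * (k * (n - k) * q)"
      by (intro mult_left_mono) auto
    then have "k * (n - k) * ((n - 2) * (\<alpha> + \<beta>)\<^sup>2 + 2 * \<alpha>\<^sup>2) \<le> k * (n - k) * ((n - 1)\<^sup>2 * q)"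
      using two_defect_form_nonneg[OF rk, of \<alpha> \<beta>] by (simp add: mult.left_commute)
    then have "(n - 2) * (\<alpha> + \<beta>)\<^sup>2 + 2 * \<alpha>\<^sup>2 \<le> (n - 1)\<^sup>2 * q" using pos by (simp only: mult_le_cancel_left_pos)
    then show ?thesis using rx unfolding \<sigma> by linarith
  qed
  have "(\<Sum>x\<in>X. (r x)\<^sup>2) = (\<Sum>x\<in>X - {a, b}. (r x)\<^sup>2) + (\<Sum>x\<in>{a, b}. (r x)\<^sup>2)"
    using ab finite_X by (intro sum.subset_diff) auto
  also have "(\<Sum>x\<in>X - {a, b}. (r x)\<^sup>2) \<le> (\<Sum>x\<in>X - {a, b}. \<sigma>\<^sup>2)"
    using r0 r_le by (intro sum_mono power_mono)
  also have "(\<Sum>x\<in>X - {a, b}. \<sigma>\<^sup>2) = (n - 2) * \<sigma>\<^sup>2"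
  proof -
    have "card (X - {a, b}) = card X - 2" using ab finite_X by (simp add: card_Diff_subset)
    then show ?thesis using k(2) by (simp add: n_def of_nat_diff)
  qed
  also have "(\<Sum>x\<in>{a, b}. (r x)\<^sup>2) = (r a)\<^sup>2 + (r b)\<^sup>2" using ab by simp
  finally have rsum: "(\<Sum>x\<in>X. (r x)\<^sup>2) \<le> (n - 1)\<^sup>2 * q" using low[OF ab(4)] low[OF ab(5)] by linarith
  define s where "s = (\<Sum>x\<in>X. w x * r x)"
  have s: "spectral_radius_graph N E = 2 * s"
    unfolding w(3)[symmetric] adj_form_bipartite[OF V] s_def r_def sum_distrib_left
    by (intro sum.cong refl) (simp add: algebra_simps)
  have "s\<^sup>2 \<le> p * (\<Sum>x\<in>X. (r x)\<^sup>2)" unfolding s_def p_def by (rule Cauchy_Schwarz_ineq_sum)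
  also have "\<dots> \<le> p * ((n - 1)\<^sup>2 * q)" using rsum pq(3) by (rule mult_left_mono)
  finally have "(2 * s)\<^sup>2 \<le> (n - 1)\<^sup>2 * (4 * (p * q))" by (simp add: power_mult_distrib algebra_simps)
  also have "\<dots> \<le> (n - 1)\<^sup>2 * 1" using mult_le_quarter[OF pq(1)] by (intro mult_left_mono) auto
  finally have "(2 * s)\<^sup>2 \<le> (n - 1)\<^sup>2" by simp
  moreover have "n - 1 \<ge> 0" using rk(2) zero_le_power2[of "real k"] by linarith
  ultimately have "2 * s \<le> n - 1" by (rule power2_le_imp_le)
  then show ?thesis using s by (simp add: n_def)
qed

text \<open>A zero of a non-negative eigenvector spreads to all neighbours. Through
  \<open>x0\<close> and \<open>y0\<close> it reaches every vertex, which takes the place of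
  Perron-Frobenius irreducibility.\<close>

lemma dominated_eigenvector_zero:
  assumes V: "X \<union> Y = {..<N}" and x0: "x0 \<in> X" "\<And>y. y \<in> Y \<Longrightarrow> E x0 y"
    and y0: "y0 \<in> Y" "\<And>x. x \<in> X \<Longrightarrow> E x y0"
    and z: "\<And>i. z i \<ge> 0" "\<And>i. i < N \<Longrightarrow> (\<Sum>j<N. of_bool (E i j) * z j) = c * z i"
    and i: "i < N" "z i = 0" and j: "j < N"
  shows "z j = (0 :: real)"
proof -
  have nbr: "z b = 0" if "z a = 0" "a < N" "b < N" "E a b" for a b
  proof -
    have "(\<Sum>j<N. of_bool (E a j) * z j) = 0" using z(2)[OF that(2)] that(1) by simp
    then have "\<forall>j\<in>{..<N}. of_bool (E a j) * z j = 0"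
      using z(1) by (subst (asm) sum_nonneg_eq_0_iff) auto
    then show ?thesis using that by auto
  qed
  have lt: "x \<in> X \<Longrightarrow> x < N" "y \<in> Y \<Longrightarrow> y < N" for x y using V by auto
  have from_x0: "z y = 0" if "z x0 = 0" "y \<in> Y" for y
    using nbr[of x0 y] that x0 lt by blast
  have from_y0: "z x = 0" if "z y0 = 0" "x \<in> X" for x
    using nbr[of y0 x] that y0 lt sym_E by blast
  have "z x0 = 0 \<and> z y0 = 0"
  proof (cases "i \<in> X")
    case True
    then have "z y0 = 0" using nbr[of i y0] i y0 lt by blast
    then show ?thesis using from_y0 x0 by blast
  next
    case False
    then have "i \<in> Y" using V i by auto
    then have "z x0 = 0" using nbr[of i x0] i x0 lt sym_E by blast
    then show ?thesis using from_x0 y0 by blast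
  qed
  then show ?thesis using from_x0 from_y0 V j by blast
qed

end

section \<open>The extremal graphs\<close>

lemma M_graph_iff:
  assumes "x < n" "n \<le> y" "y < 2 * n" "k \<le> n" "t \<le> n"
  shows "M_graph n n (n - k) t x y \<longleftrightarrow> n - k \<le> x \<or> y < 2 * n - t"
    and "M_graph n n (n - k) t y x \<longleftrightarrow> n - k \<le> x \<or> y < 2 * n - t"
  using assms unfolding M_graph_def Let_def by auto

text \<open>For \<open>q = k - 2\<close> the blocks \<open>X2 \<union> X3\<close> and
  \<open>Y2 \<union> Y3\<close> are the last \<open>k\<close> vertices of their sides, and only the
  singletons \<open>X3\<close> and \<open>Y3\<close> restrict adjacency.\<close>

lemma N_graph_iff:
  assumes "x < n" "n \<le> y" "y < 2 * n" "2 \<le> k" "k \<le> n"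
  shows "N_graph n (k - 2) x y \<longleftrightarrow> (x = n - 1 \<longrightarrow> 2 * n - k \<le> y) \<and> (y = 2 * n - 1 \<longrightarrow> n - k \<le> x)"
    and "N_graph n (k - 2) y x \<longleftrightarrow> (x = n - 1 \<longrightarrow> 2 * n - k \<le> y) \<and> (y = 2 * n - 1 \<longrightarrow> n - k \<le> x)"
proof -
  obtain z where z: "y = z + n" "z < n" using assms(2,3) by (metis add.commute le_Suc_ex mult_2 nat_add_left_cancel_less)
  have shift: "z + n \<in> (\<lambda>x. x + n) ` S \<longleftrightarrow> z \<in> S" "x \<notin> (\<lambda>x. x + n) ` S" for S
    using assms(1) by auto
  have nk: "n - (k - 2) - 2 = n - k" using assms by simp
  have high: "z + n \<notin> {0..<n - k}" "z + n \<notin> {n - k..<n - 1}" "z + n \<noteq> n - 1"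
    using assms by auto
  have eq: "(x \<in> {0..<n - k} \<and> z \<in> {0..<n - k} \<or> x \<in> {n - k..<n - 1} \<and> z \<in> {n - k..<n - 1} \<or>
      x = n - 1 \<and> z + n = 2 * n - 1 \<or> x \<in> {0..<n - k} \<and> z \<in> {n - k..<n - 1} \<or>
      x \<in> {n - k..<n - 1} \<and> (z \<in> {0..<n - k} \<or> z + n = 2 * n - 1) \<or> x = n - 1 \<and> z \<in> {n - k..<n - 1}) \<longleftrightarrow>
      (x = n - 1 \<longrightarrow> 2 * n - k \<le> z + n) \<and> (z + n = 2 * n - 1 \<longrightarrow> n - k \<le> x)"
  proof -
    have "z + n = 2 * n - 1 \<longleftrightarrow> z = n - 1" "2 * n - k \<le> z + n \<longleftrightarrow> n - k \<le> z"
      using assms(4,5) z(2) by auto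
    moreover have "n - k < n - 1" "x \<noteq> n - 1 \<Longrightarrow> x < n - 1" "z \<noteq> n - 1 \<Longrightarrow> z < n - 1"
      using assms z(2) by auto
    ultimately show ?thesis
      by (cases "x = n - 1"; cases "z = n - 1"; cases "x < n - k"; cases "z < n - k") auto
  qed
  show "N_graph n (k - 2) x y \<longleftrightarrow> (x = n - 1 \<longrightarrow> 2 * n - k \<le> y) \<and> (y = 2 * n - 1 \<longrightarrow> n - k \<le> x)"
    "N_graph n (k - 2) y x \<longleftrightarrow> (x = n - 1 \<longrightarrow> 2 * n - k \<le> y) \<and> (y = 2 * n - 1 \<longrightarrow> n - k \<le> x)"
    unfolding z(1) N_graph_def Let_def nk Un_iff shift singleton_iff eq[symmetric]
    using high by (simp_all only: simp_thms)
qed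

lemma balanced_bipartite_M_graph:
  assumes "k \<le> n" "t \<le> n"
  shows "balanced_bipartite {0..<n} {n..<2 * n} (M_graph n n (n - k) t)"
proof
  show "symp (M_graph n n (n - k) t)"
    unfolding M_graph_def Let_def by (intro sympI) (rule disj_commute[THEN iffD1])
qed (use assms in \<open>auto simp: M_graph_def Let_def\<close>)

lemma balanced_bipartite_N_graph:
  assumes "q + 2 \<le> n"
  shows "balanced_bipartite {0..<n} {n..<2 * n} (N_graph n q)"
proof
  show "symp (N_graph n q)"
    unfolding N_graph_def Let_def by (intro sympI) (rule disj_commute[THEN iffD1])
qed (use assms in \<open>auto simp: N_graph_def Let_def\<close>)

text \<open>The target sides \<open>A\<close> and \<open>B\<close> are left open because an
  embedding may exchange the two sides.\<close>

lemma (in balanced_bipartite) exists_bij_edges: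
  assumes V: "X \<union> Y = {0..<2 * card X}"
    and g: "bij_betw g X A" and h: "bij_betw h Y B" and AB: "A \<inter> B = {}" "A \<union> B = {0..<2 * card X}"
    and F: "symp F" "\<And>x y. x \<in> X \<Longrightarrow> y \<in> Y \<Longrightarrow> E x y \<Longrightarrow> F (g x) (h y)"
  shows "\<exists>f. bij_betw f {0..<2 * card X} {0..<2 * card X} \<and>
    (\<forall>i<2 * card X. \<forall>j<2 * card X. E i j \<longrightarrow> F (f i) (f j))"
proof -
  let ?f = "\<lambda>i. if i \<in> X then g i else h i"
  have "bij_betw ?f X A" using g by (simp cong: bij_betw_cong)
  moreover have "bij_betw ?f Y B"
  proof -
    have "bij_betw ?f Y B \<longleftrightarrow> bij_betw h Y B" by (rule bij_betw_cong) (use disjoint in auto)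
    then show ?thesis using h by simp
  qed
  ultimately have "bij_betw ?f (X \<union> Y) (A \<union> B)" using AB(1) by (rule bij_betw_combine)
  moreover have "F (?f i) (?f j)" if "i < 2 * card X" "j < 2 * card X" "E i j" for i j
  proof -
    have ij: "i \<in> X \<union> Y" "j \<in> X \<union> Y" using that V by auto
    show ?thesis
    proof (cases "i \<in> X")
      case True
      then have "j \<notin> X" "j \<in> Y" using indep_X that(3) ij by auto
      then show ?thesis using True F(2) that(3) by simp
    next
      case False
      then have "i \<in> Y" "j \<in> X" using ij indep_Y that(3) by auto
      then have "F (h i) (g j)" using sympD[OF F(1) F(2)[of j i]] sym_E[OF that(3)] by blast
      then show ?thesis using False \<open>j \<in> X\<close> by simp
    qed
  qed
  ultimately show ?thesis unfolding V AB(2) by blast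
qed

lemma exists_bij_betw_mapping_subset:
  assumes "finite U" "finite V" "card U = card V" "A \<subseteq> U" "B \<subseteq> V" "bij_betw g A B"
  shows "\<exists>f. bij_betw f U V \<and> (\<forall>a\<in>A. f a = g a) \<and> (\<forall>u\<in>U. f u \<in> B \<longleftrightarrow> u \<in> A)"
proof -
  obtain f where f: "bij_betw f U V" "\<forall>a\<in>A. f a = g a"
    using exists_bij_betw_extending[OF assms] by blast
  have fA: "f ` A = B" using f(2) assms(6) unfolding bij_betw_def by force
  have "f u \<in> B \<longleftrightarrow> u \<in> A" if "u \<in> U" for u
    using inj_on_image_mem_iff[of f U u A] f(1) that assms(4) unfolding fA bij_betw_def by blast
  then show ?thesis using f by blast
qed

text \<open>\<open>S\<close> becomes \<open>Y2\<close> and \<open>C\<close> becomes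
  \<open>X2\<close>, where all neighbours of \<open>Y2\<close> lie; hence \<open>X\<close> goes to
  the second side of \<open>M\<close>.\<close>

lemma (in balanced_bipartite) embeds_in_M_graph:
  assumes V: "X \<union> Y = {0..<2 * card X}" and kt: "k \<le> card X" "t \<le> card X"
    and S: "S \<subseteq> X" "card S = t" and C: "C \<subseteq> Y" "card C = k"
    and conf: "\<And>s y. s \<in> S \<Longrightarrow> y \<in> Y \<Longrightarrow> E s y \<Longrightarrow> y \<in> C"
  shows "\<exists>f. bij_betw f {0..<2 * card X} {0..<2 * card X} \<and>
    (\<forall>i<2 * card X. \<forall>j<2 * card X. E i j \<longrightarrow> M_graph (card X) (card X) (card X - k) t (f i) (f j))"
proof -
  define n where "n = card X"
  interpret M: balanced_bipartite "{0..<n}" "{n..<2 * n}" "M_graph n n (n - k) t"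
    using balanced_bipartite_M_graph kt unfolding n_def by blast
  have fin: "finite S" "finite C" using S C finite_X finite_Y by (auto intro: finite_subset)
  have kt': "k \<le> n" "t \<le> n" using kt by (auto simp: n_def)
  have sub: "{2 * n - t..<2 * n} \<subseteq> {n..<2 * n}" "{n - k..<n} \<subseteq> {0..<n}" using kt' by auto
  have cards: "card X = card {n..<2 * n}" "card Y = card {0..<n}" using card_eq by (auto simp: n_def)
  obtain g0 where "bij_betw g0 S {2 * n - t..<2 * n}"
    using finite_same_card_bij[OF fin(1), of "{2 * n - t..<2 * n}"] S kt' by auto
  from exists_bij_betw_mapping_subset[OF finite_X _ cards(1) S(1) sub(1) this]
  obtain g where g: "bij_betw g X {n..<2 * n}" "\<forall>x\<in>X. g x \<in> {2 * n - t..<2 * n} \<longleftrightarrow> x \<in> S"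
    by blast
  obtain h0 where "bij_betw h0 C {n - k..<n}"
    using finite_same_card_bij[OF fin(2), of "{n - k..<n}"] C kt' by auto
  from exists_bij_betw_mapping_subset[OF finite_Y _ cards(2) C(1) sub(2) this]
  obtain h where h: "bij_betw h Y {0..<n}" "\<forall>y\<in>Y. h y \<in> {n - k..<n} \<longleftrightarrow> y \<in> C"
    by blast
  have "M_graph n n (n - k) t (g x) (h y)" if "x \<in> X" "y \<in> Y" "E x y" for x y
  proof -
    have gx: "n \<le> g x" "g x < 2 * n" and hy: "h y < n"
      using g(1) h(1) that by (auto simp: bij_betw_def)
    have "y \<in> C \<Longrightarrow> n - k \<le> h y" using h(2) that by auto
    moreover have "x \<notin> S \<Longrightarrow> g x < 2 * n - t" using g(2) that gx by force
    ultimately show ?thesis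
      unfolding M_graph_iff(2)[OF hy gx kt'] using conf[OF _ that(2,3)] by blast
  qed
  then have "\<exists>f. bij_betw f {0..<2 * card X} {0..<2 * card X} \<and>
    (\<forall>i<2 * card X. \<forall>j<2 * card X. E i j \<longrightarrow> M_graph n n (n - k) t (f i) (f j))"
    using V g h M.symp_E by (intro exists_bij_edges[OF V g(1) h(1)]) (auto simp: n_def)
  then show ?thesis unfolding n_def .
qed

text \<open>\<open>x\<close> and \<open>y\<close> become \<open>X3\<close> and \<open>Y3\<close>,
  and the neighbours of \<open>y\<close> and of \<open>x\<close> fill the last \<open>k\<close>
  places of the two sides. Adjacency of \<open>x\<close> and \<open>y\<close> puts them into these
  blocks themselves.\<close>

lemma (in balanced_bipartite) embeds_in_N_graph:
  assumes V: "X \<union> Y = {0..<2 * card X}" and k: "2 \<le> k" "k \<le> card X"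
    and xy: "x \<in> X" "y \<in> Y" "E x y" "deg_in E Y x = k" "deg_in E X y = k"
  shows "\<exists>f. bij_betw f {0..<2 * card X} {0..<2 * card X} \<and>
    (\<forall>i<2 * card X. \<forall>j<2 * card X. E i j \<longrightarrow> N_graph (card X) (k - 2) (f i) (f j))"
proof -
  define n where "n = card X"
  interpret M: balanced_bipartite "{0..<n}" "{n..<2 * n}" "N_graph n (k - 2)"
    using balanced_bipartite_N_graph k unfolding n_def by simp
  have block: "\<exists>g. bij_betw g U {b..<b + n} \<and> g u = b + n - 1 \<and> (\<forall>z\<in>U. g z \<in> {b + n - k..<b + n} \<longleftrightarrow> z \<in> A)"
    if "finite U" "card U = n" "A \<subseteq> U" "card A = k" "u \<in> A" for U A u and b :: nat
  proof -
    have finA: "finite A" using that by (auto intro: finite_subset)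
    have bij: "bij_betw (\<lambda>_. b + n - 1) {u} {b + n - 1}" by (simp add: bij_betw_def)
    moreover have "{b + n - 1} \<subseteq> {b + n - k..<b + n}" using k unfolding n_def by auto
    moreover have "card {b + n - k..<b + n} = k" using k unfolding n_def by simp
    ultimately have "\<exists>f. bij_betw f A {b + n - k..<b + n} \<and> (\<forall>a\<in>{u}. f a = b + n - 1)"
      using that finA by (intro exists_bij_betw_extending[OF _ _ _ _ _ bij]) simp_all
    then obtain g0 where g0: "bij_betw g0 A {b + n - k..<b + n}" "g0 u = b + n - 1" by blast
    have "{b + n - k..<b + n} \<subseteq> {b..<b + n}" using k unfolding n_def by auto
    then have "\<exists>g. bij_betw g U {b..<b + n} \<and> (\<forall>a\<in>A. g a = g0 a) \<and>
        (\<forall>z\<in>U. g z \<in> {b + n - k..<b + n} \<longleftrightarrow> z \<in> A)"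
      using that g0(1) by (intro exists_bij_betw_mapping_subset) simp_all
    then show ?thesis using g0(2) that(5) by metis
  qed
  obtain g where g: "bij_betw g X {0..<0 + n}" "g x = 0 + n - 1"
    "\<forall>z\<in>X. g z \<in> {0 + n - k..<0 + n} \<longleftrightarrow> z \<in> {z \<in> X. E y z}"
    using block[of X "{z \<in> X. E y z}" x 0] finite_X xy sym_E unfolding n_def deg_in_def by auto
  obtain h where h: "bij_betw h Y {n..<n + n}" "h y = n + n - 1"
    "\<forall>z\<in>Y. h z \<in> {n + n - k..<n + n} \<longleftrightarrow> z \<in> {z \<in> Y. E x z}"
    using block[of Y "{z \<in> Y. E x z}" y n] finite_Y xy card_eq unfolding n_def deg_in_def by auto
  have gx: "a = x" if "a \<in> X" "g a = n - 1" for a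
    using inj_onD[of g X a x] g(1,2) that xy(1) by (simp add: bij_betw_def)
  have hy: "b = y" if "b \<in> Y" "h b = 2 * n - 1" for b
    using inj_onD[of h Y b y] h(1,2) that xy(2) by (simp add: bij_betw_def mult_2)
  have "N_graph n (k - 2) (g a) (h b)" if ab: "a \<in> X" "b \<in> Y" "E a b" for a b
  proof -
    have ga: "g a < n" and hb: "n \<le> h b" "h b < 2 * n"
      using g(1) h(1) ab by (auto simp: bij_betw_def mult_2)
    have "2 * n - k \<le> h b" if "g a = n - 1"
      using gx[OF ab(1) that] h(3) ab by (auto simp: mult_2)
    moreover have "n - k \<le> g a" if "h b = 2 * n - 1"
      using hy[OF ab(2) that] g(3) ab sym_E by auto
    ultimately show ?thesis
      using N_graph_iff(1)[OF ga hb k(1)] k(2) unfolding n_def by blast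
  qed
  then have "\<exists>f. bij_betw f {0..<2 * card X} {0..<2 * card X} \<and>
    (\<forall>i<2 * card X. \<forall>j<2 * card X. E i j \<longrightarrow> N_graph n (k - 2) (f i) (f j))"
    using V g h M.symp_E by (intro exists_bij_edges[OF V g(1) h(1)]) (auto simp: n_def)
  then show ?thesis unfolding n_def .
qed

lemma (in balanced_bipartite) graph_iso_M_graph:
  assumes V: "X \<union> Y = {0..<2 * card X}" and kt: "1 \<le> k" "k \<le> card X" "t < card X"
    and S: "S \<subseteq> X" "card S = t" and C: "C \<subseteq> Y" "card C = k"
    and conf: "\<And>s y. s \<in> S \<Longrightarrow> y \<in> Y \<Longrightarrow> E s y \<Longrightarrow> y \<in> C"
    and ge: "spectral_radius_graph (2 * card X) E \<ge>
      spectral_radius_graph (2 * card X) (M_graph (card X) (card X) (card X - k) t)"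
  shows "graph_iso (2 * card X) E (M_graph (card X) (card X) (card X - k) t)"
proof -
  define n where "n = card X"
  interpret M: balanced_bipartite "{0..<n}" "{n..<2 * n}" "M_graph n n (n - k) t"
    using balanced_bipartite_M_graph kt unfolding n_def by simp
  obtain f where f: "bij_betw f {0..<2 * n} {0..<2 * n}"
    "\<forall>i<2 * n. \<forall>j<2 * n. E i j \<longrightarrow> M_graph n n (n - k) t (f i) (f j)"
  proof -
    have "\<exists>f. bij_betw f {0..<2 * card X} {0..<2 * card X} \<and>
      (\<forall>i<2 * card X. \<forall>j<2 * card X. E i j \<longrightarrow> M_graph (card X) (card X) (card X - k) t (f i) (f j))"
      by (rule embeds_in_M_graph[OF V kt(2) less_imp_le[OF kt(3)] S C]) (rule conf)
    then show ?thesis using that unfolding n_def by blast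
  qed
  have un: "{0..<n} \<union> {n..<2 * n} = {..<2 * n}" by auto
  have "graph_iso (2 * n) E (M_graph n n (n - k) t)"
  proof (rule graph_iso_of_spectral_radius_ge[OF _ symp_E M.symp_E f(1)])
    fix z :: "nat \<Rightarrow> real" and i j c
    assume z: "\<And>i. z i \<ge> 0" "\<And>i. i < 2 * n \<Longrightarrow> (\<Sum>j<2 * n. of_bool (M_graph n n (n - k) t i j) * z j) = c * z i"
      "i < 2 * n" "z i = 0" "j < 2 * n"
    \<comment> \<open>\<open>n - 1\<close> is in \<open>X2\<close> because \<open>k \<ge> 1\<close>,
      and \<open>n\<close> is in \<open>Y1\<close> because \<open>t < n\<close>; each sees the
      entire other side.\<close>
    show "z j = 0"
    proof (rule M.dominated_eigenvector_zero[OF un, of "n - 1" n z c i j])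
      show "M_graph n n (n - k) t (n - 1) y" if "y \<in> {n..<2 * n}" for y
        using that kt M_graph_iff(1)[of "n - 1" n y k t] unfolding n_def by auto
      show "M_graph n n (n - k) t x n" if "x \<in> {0..<n}" for x
        using that kt M_graph_iff(1)[of x n n k t] unfolding n_def by auto
    qed (use z kt in \<open>auto simp: n_def\<close>)
  qed (use f(2) kt ge in \<open>auto simp: n_def\<close>)
  then show ?thesis unfolding n_def .
qed

lemma (in balanced_bipartite) graph_iso_N_graph:
  assumes V: "X \<union> Y = {0..<2 * card X}" and k: "2 \<le> k" "k \<le> card X"
    and xy: "x \<in> X" "y \<in> Y" "E x y" "deg_in E Y x = k" "deg_in E X y = k"
    and ge: "spectral_radius_graph (2 * card X) E \<ge> spectral_radius_graph (2 * card X) (N_graph (card X) (k - 2))"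
  shows "graph_iso (2 * card X) E (N_graph (card X) (k - 2))"
proof -
  define n where "n = card X"
  interpret M: balanced_bipartite "{0..<n}" "{n..<2 * n}" "N_graph n (k - 2)"
    using balanced_bipartite_N_graph k unfolding n_def by simp
  obtain f where f: "bij_betw f {0..<2 * n} {0..<2 * n}"
    "\<forall>i<2 * n. \<forall>j<2 * n. E i j \<longrightarrow> N_graph n (k - 2) (f i) (f j)"
    using embeds_in_N_graph[OF V k xy] unfolding n_def by blast
  have un: "{0..<n} \<union> {n..<2 * n} = {..<2 * n}" by auto
  have kn: "2 \<le> k" "k \<le> n" using k by (auto simp: n_def)
  have "graph_iso (2 * n) E (N_graph n (k - 2))"
  proof (rule graph_iso_of_spectral_radius_ge[OF _ symp_E M.symp_E f(1)])
    fix z :: "nat \<Rightarrow> real" and i j c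
    assume z: "\<And>i. z i \<ge> 0" "\<And>i. i < 2 * n \<Longrightarrow> (\<Sum>j<2 * n. of_bool (N_graph n (k - 2) i j) * z j) = c * z i"
      "i < 2 * n" "z i = 0" "j < 2 * n"
    \<comment> \<open>\<open>n - 2\<close> and \<open>2 * n - 2\<close> lie in \<open>X2\<close> and
      \<open>Y2\<close>, whose vertices see the entire other side.\<close>
    show "z j = 0"
    proof (rule M.dominated_eigenvector_zero[OF un, of "n - 2" "2 * n - 2" z c i j])
      show "N_graph n (k - 2) (n - 2) y" if "y \<in> {n..<2 * n}" for y
        using that kn N_graph_iff(1)[of "n - 2" n y k] by auto
      show "N_graph n (k - 2) x (2 * n - 2)" if "x \<in> {0..<n}" for x
        using that kn N_graph_iff(1)[of x n "2 * n - 2" k] by auto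
    qed (use z kn in auto)
  qed (use f(2) kn ge in \<open>auto simp: n_def\<close>)
  then show ?thesis unfolding n_def .
qed

text \<open>\<open>X\<close> and \<open>Y1\<close> span a complete bipartite graph with
  \<open>n * (n - t)\<close> edges; an edge into \<open>Y2\<close> makes the inequality
  strict.\<close>

lemma spectral_radius_M_graph_gt:
  assumes "1 \<le> k" "k \<le> n" "1 \<le> t" "t < n"
  shows "spectral_radius_graph (2 * n) (M_graph n n (n - k) t) > sqrt (real (n * (n - t)))"
proof -
  interpret M: balanced_bipartite "{0..<n}" "{n..<2 * n}" "M_graph n n (n - k) t"
    using balanced_bipartite_M_graph assms by simp
  have "sqrt (real (card {0..<n}) * real (card {n..<2 * n - t})) <
      spectral_radius_graph (2 * n) (M_graph n n (n - k) t)"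
  proof (rule M.spectral_radius_gt_complete)
    show "M_graph n n (n - k) t a b" if "a \<in> {0..<n}" "b \<in> {n..<2 * n - t}" for a b
      using that assms M_graph_iff(1)[of a n b k t] by auto
    show "M_graph n n (n - k) t (n - 1) (2 * n - 1)"
      using assms M_graph_iff(1)[of "n - 1" n "2 * n - 1" k t] by auto
  qed (use assms in auto)
  moreover have "card {0..<n} = n" "card {n..<2 * n - t} = n - t" using assms by auto
  ultimately show ?thesis by simp
qed

text \<open>Without the last vertex of each side \<open>N\<close> is complete bipartite; an edge to
  an omitted vertex makes the inequality strict.\<close>

lemma spectral_radius_N_graph_gt:
  assumes "2 \<le> k" "k \<le> n"
  shows "spectral_radius_graph (2 * n) (N_graph n (k - 2)) > real n - 1"
proof -
  interpret M: balanced_bipartite "{0..<n}" "{n..<2 * n}" "N_graph n (k - 2)"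
    using balanced_bipartite_N_graph assms by simp
  have "sqrt (real (card {0..<n - 1}) * real (card {n..<2 * n - 1})) <
      spectral_radius_graph (2 * n) (N_graph n (k - 2))"
  proof (rule M.spectral_radius_gt_complete)
    show "N_graph n (k - 2) a b" if "a \<in> {0..<n - 1}" "b \<in> {n..<2 * n - 1}" for a b
      using that assms N_graph_iff(1)[of a n b k] by auto
    show "N_graph n (k - 2) (n - 2) (2 * n - 1)"
      using assms N_graph_iff(1)[of "n - 2" n "2 * n - 1" k] by auto
  qed (use assms in auto)
  moreover have "card {0..<n - 1} = n - 1" "card {n..<2 * n - 1} = n - 1" using assms by auto
  ultimately show ?thesis using assms by (simp add: of_nat_diff real_sqrt_mult)
qed

section \<open>Deleting vertices, lifting the exceptional cases, and the conclusion\<close>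

lemma bipartite_graph_balanced:
  assumes "bipartite_graph (2 * n) X E" "card X = n"
  shows "balanced_bipartite X ({0..<2 * n} - X) E"
proof
  have X: "X \<subseteq> {0..<2 * n}" using assms by (simp add: bipartite_graph_def)
  then show "finite X" by (rule finite_subset) simp
  then show "card ({0..<2 * n} - X) = card X" using X assms(2) by (simp add: card_Diff_subset)
  show "symp E" using assms unfolding bipartite_graph_def simple_graph_def symp_def by blast
  show "\<not> E a b" if "a \<in> X" "b \<in> X" for a b using assms that unfolding bipartite_graph_def by blast
  show "\<not> E a b" if "a \<in> {0..<2 * n} - X" "b \<in> {0..<2 * n} - X" for a b
    using assms that unfolding bipartite_graph_def by blast
qed auto

text \<open>The deletion lowers each degree by at most \<open>p\<close> and the closure only adds
  edges, so minimum degree and density pass to \<open>H\<close>, while upper bounds on degrees in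
  \<open>H\<close> lift to \<open>E\<close> with \<open>p\<close> added.\<close>

lemma (in balanced_bipartite) not_biconnected_exceptional:
  assumes V: "X \<union> Y = {0..<2 * card X}"
    and min_deg: "\<And>x. x \<in> X \<Longrightarrow> p + t \<le> deg_in E Y x" "\<And>y. y \<in> Y \<Longrightarrow> p + t \<le> deg_in E X y"
    and t: "t \<ge> 1" and large: "card X \<ge> 2 * t + 4 + p"
    and dense: "missing X Y E < (t + 1) * (card X - p - (t + 2))"
    and not_bic: "\<not> hamilton_biconnected_2p (2 * card X) X E p"
  shows "(t \<noteq> 2 \<and> ((\<exists>S\<subseteq>X. \<exists>C\<subseteq>Y. card S = t \<and> card C = p + t \<and> (\<forall>s\<in>S. \<forall>y\<in>Y. E s y \<longrightarrow> y \<in> C)) \<or>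
      (\<exists>S\<subseteq>Y. \<exists>C\<subseteq>X. card S = t \<and> card C = p + t \<and> (\<forall>s\<in>S. \<forall>x\<in>X. E s x \<longrightarrow> x \<in> C)))) \<or>
    (t = 2 \<and> (two_of_degree X Y E (p + 2) \<or> two_of_degree Y X E (p + 2) \<or>
      (\<exists>x\<in>X. \<exists>y\<in>Y. E x y \<and> deg_in E Y x = p + 2 \<and> deg_in E X y = p + 2)))"
proof -
  obtain W where W: "W \<subseteq> {0..<2 * card X}" "card (W \<inter> X) = card (W - X)" "card W = 2 * p"
    "\<not> hamilton_biconnected X E ({0..<2 * card X} - W)"
    using not_bic unfolding hamilton_biconnected_2p_def by blast
  define X' Y' where "X' = X - W" and "Y' = Y - W"
  have WY: "W - X = W \<inter> Y" using W(1) V disjoint by blast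
  have finW: "finite W" using W(1) by (rule finite_subset) simp
  have "card W = card (W \<inter> X) + card (W - X)"
    using finW card_Int_Diff by blast
  then have cW: "card (W \<inter> X) = p" "card (W \<inter> Y) = p" using W(2,3) WY by auto
  have split: "X = X' \<union> (W \<inter> X)" "Y = Y' \<union> (W \<inter> Y)" by (auto simp: X'_def Y'_def)
  have cX': "card X' = card X - p" "card Y' = card X - p"
    unfolding X'_def Y'_def using finW cW card_eq
    by (simp_all add: card_Diff_subset_Int Int_commute)
  interpret B: balanced_bipartite X' Y' E
    using finite_X finite_Y disjoint cX' symp_E indep_X indep_Y
    by unfold_locales (auto simp: X'_def Y'_def)
  have rest: "{0..<2 * card X} - W = X' \<union> Y'" using V by (auto simp: X'_def Y'_def)
  have nb: "\<not> (\<forall>u\<in>X'. \<forall>v\<in>Y'. ham_path E (X' \<union> Y') u v)"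
  proof -
    have "(X' \<union> Y') \<inter> X = X'" "(X' \<union> Y') - X = Y'"
      using disjoint by (auto simp: X'_def Y'_def)
    then show ?thesis using W(4) unfolding hamilton_biconnected_def rest by simp
  qed
  obtain H where H: "balanced_bipartite X' Y' H" "degree_closed X' Y' H" "\<And>a b. E a b \<Longrightarrow> H a b"
    "\<forall>u\<in>X'. \<forall>v\<in>Y'. ham_path H (X' \<union> Y') u v \<longrightarrow> ham_path E (X' \<union> Y') u v"
    using B.closure_exists by blast
  interpret H: balanced_bipartite X' Y' H by (rule H(1))
  have deg_le: "deg_in E (S' \<union> T) z \<le> deg_in H S' z + card T" if "finite S'" "finite T" for S' T z
  proof -
    have "card {w \<in> S' \<union> T. E z w} \<le> card ({w \<in> S'. H z w} \<union> T)"
      using that H(3) by (intro card_mono) auto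
    also have "\<dots> \<le> card {w \<in> S'. H z w} + card T" by (rule card_Un_le)
    finally show ?thesis unfolding deg_in_def .
  qed
  have degX: "deg_in E Y z \<le> deg_in H Y' z + p" for z
    using deg_le[of Y' "W \<inter> Y" z] H.finite_Y finW cW split(2) by simp
  have degY: "deg_in E X z \<le> deg_in H X' z + p" for z
    using deg_le[of X' "W \<inter> X" z] H.finite_X finW cW split(1) by simp
  have "missing X' Y' H \<le> missing X Y E" unfolding missing_def
    using finite_X finite_Y H(3) by (intro card_mono) (auto simp: X'_def Y'_def)
  then have dense': "missing X' Y' H < (t + 1) * (card X' - (t + 2))" using dense cX' by simp
  have sub: "X' \<subseteq> X" "Y' \<subseteq> Y" by (auto simp: X'_def Y'_def)
  interpret D: dense_closed X' Y' H t
  proof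
    show "t \<le> deg_in H Y' x" if "x \<in> X'" for x
      using degX[of x] min_deg(1)[OF subsetD[OF sub(1) that]] by linarith
    show "t \<le> deg_in H X' y" if "y \<in> Y'" for y
      using degY[of y] min_deg(2)[OF subsetD[OF sub(2) that]] by linarith
    show "2 * t + 4 \<le> card X'" using large cX' by linarith
  qed (fact H(2) t dense')+
  have confined_lift: "\<exists>S\<subseteq>P. \<exists>C\<subseteq>Q. card S = t \<and> card C = p + t \<and> (\<forall>s\<in>S. \<forall>y\<in>Q. E s y \<longrightarrow> y \<in> C)"
    if conf: "confined P' Q' H t" and PQ: "P' \<subseteq> P" "Q = Q' \<union> T" "Q' \<inter> T = {}" "finite Q" "card T = p"
    for P P' Q Q' T
  proof -
    obtain S C where SC: "S \<subseteq> P'" "C \<subseteq> Q'" "card S = t" "card C = t" "\<forall>s\<in>S. \<forall>y\<in>Q'. H s y \<longrightarrow> y \<in> C"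
      using conf unfolding confined_def by blast
    have "finite C" "finite T" using SC(2) PQ by (auto intro: finite_subset)
    then have "card (C \<union> T) = p + t"
      using SC PQ by (subst card_Un_disjoint) auto
    moreover have "S \<subseteq> P" "C \<union> T \<subseteq> Q" using SC PQ by auto
    moreover have "y \<in> C \<union> T" if "s \<in> S" "y \<in> Q" "E s y" for s y
      using that SC(5) PQ(2) H(3) by blast
    ultimately show ?thesis using SC(3) by blast
  qed
  have two_lift: "two_of_degree P Q E (p + 2)"
    if two: "two_of_degree P' Q' H 2" and PQ: "P' \<subseteq> P" "\<And>z. deg_in E Q z \<le> deg_in H Q' z + p" for P P' Q Q'
  proof -
    obtain x x' where x: "x \<in> P'" "x' \<in> P'" "x \<noteq> x'" "deg_in H Q' x \<le> 2" "deg_in H Q' x' \<le> 2"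
      using two unfolding two_of_degree_def by blast
    then have "deg_in E Q x \<le> p + 2" "deg_in E Q x' \<le> p + 2"
      using PQ(2)[of x] PQ(2)[of x'] by linarith+
    then show ?thesis using x PQ(1) unfolding two_of_degree_def by blast
  qed
  have disj: "Y' \<inter> (W \<inter> Y) = {}" "X' \<inter> (W \<inter> X) = {}" by (auto simp: X'_def Y'_def)
  from D.ham_path_or_exceptional show ?thesis
  proof (elim disjE conjE bexE)
    assume "\<forall>u\<in>X'. \<forall>v\<in>Y'. ham_path H (X' \<union> Y') u v"
    then have "\<forall>u\<in>X'. \<forall>v\<in>Y'. ham_path E (X' \<union> Y') u v" using H(4) by simp
    with nb show ?thesis by contradiction
  next
    assume "t \<noteq> 2" "confined X' Y' H t"
    then show ?thesis
      using confined_lift[OF _ sub(1) split(2) disj(1) finite_Y cW(2)] by blast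
  next
    assume "t \<noteq> 2" "confined Y' X' H t"
    then show ?thesis
      using confined_lift[OF _ sub(2) split(1) disj(2) finite_X cW(1)] by blast
  next
    assume "t = 2" "two_of_degree X' Y' H 2"
    then show ?thesis using two_lift[OF _ sub(1) degX] by blast
  next
    assume "t = 2" "two_of_degree Y' X' H 2"
    then show ?thesis using two_lift[OF _ sub(2) degY] by blast
  next
    fix x y assume t2: "t = 2" and xy: "x \<in> X'" "y \<in> Y'" "H x y" "deg_in H Y' x \<le> 2" "deg_in H X' y \<le> 2"
    have mem: "x \<in> X" "y \<in> Y" using xy sub by auto
    have deg: "deg_in E Y x = p + 2" "deg_in E X y = p + 2"
      using degX[of x] degY[of y] xy min_deg mem t2 by (auto intro!: le_antisym)
    \<comment> \<open>If the closure had added this edge, \<open>x\<close> would keep at most one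
      neighbour outside the deleted set, hence at most \<open>p + 1\<close> in all, below its degree
      \<open>p + 2\<close>.\<close>
    have "E x y"
    proof (rule ccontr)
      assume "\<not> E x y"
      then have "{w \<in> Y. E x w} \<subseteq> ({w \<in> Y'. H x w} - {y}) \<union> (W \<inter> Y)"
        using H(3) split(2) by auto
      then have "card {w \<in> Y. E x w} \<le> card (({w \<in> Y'. H x w} - {y}) \<union> (W \<inter> Y))"
        using H.finite_Y finW by (intro card_mono) auto
      also have "\<dots> \<le> card ({w \<in> Y'. H x w} - {y}) + p"
        using card_Un_le[of "{w \<in> Y'. H x w} - {y}" "W \<inter> Y"] cW by simp
      also have "card ({w \<in> Y'. H x w} - {y}) < card {w \<in> Y'. H x w}"
        using xy H.finite_Y by (intro card_Diff1_less) auto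
      finally show False using deg(1) xy(4) unfolding deg_in_def by simp
    qed
    then show ?thesis using t2 mem deg by blast
  qed
qed

theorem theorem1p5:
  fixes n p k :: nat and X :: "nat set" and E :: "nat \<Rightarrow> nat \<Rightarrow> bool"
  assumes bip: "bipartite_graph (2 * n) X E"
    and bal: "card X = n"
    and kp: "k \<ge> p + 1"
    and mindeg: "min_degree_ge (2 * n) E k"
  shows "(k = p + 2 \<longrightarrow> n \<ge> 2 * k ^ 2 + 3 \<longrightarrow>
            spectral_radius_graph (2 * n) E \<ge> spectral_radius_graph (2 * n) (N_graph n (k - 2)) \<longrightarrow>
            hamilton_biconnected_2p (2 * n) X E p \<or> graph_iso (2 * n) E (N_graph n (k - 2)))
       \<and> (k \<noteq> p + 2 \<longrightarrow> n \<ge> (k + 2) * (k - p + 1) \<longrightarrow>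
            spectral_radius_graph (2 * n) E \<ge> spectral_radius_graph (2 * n) (M_graph n n (n - k) (k - p)) \<longrightarrow>
            hamilton_biconnected_2p (2 * n) X E p \<or> graph_iso (2 * n) E (M_graph n n (n - k) (k - p)))"
proof -
  define Y where "Y = {0..<2 * n} - X"
  interpret G: balanced_bipartite X Y E
    using bipartite_graph_balanced[OF bip bal] unfolding Y_def .
  interpret S: balanced_bipartite Y X E by (rule G.swap)
  have XV: "X \<subseteq> {0..<2 * n}" using bip by (simp add: bipartite_graph_def)
  have V: "X \<union> Y = {0..<2 * n}" "Y \<union> X = {0..<2 * n}" "X \<union> Y = {..<2 * n}" "Y \<union> X = {..<2 * n}"
    using XV by (auto simp: Y_def)
  have cY: "card Y = n" using G.card_eq bal by simp
  have deg: "Defs.degree (2 * n) E v = deg_in E Y v" if "v \<in> X" for v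
    unfolding Defs.degree_def deg_in_def V(1)[symmetric]
    using G.indep_X that by (intro arg_cong[of _ _ card]) auto
  have deg': "Defs.degree (2 * n) E v = deg_in E X v" if "v \<in> Y" for v
    unfolding Defs.degree_def deg_in_def V(1)[symmetric]
    using G.indep_Y that by (intro arg_cong[of _ _ card]) auto
  have min_deg: "k \<le> deg_in E Y x" if "x \<in> X" for x
  proof -
    have "x < 2 * n" using that XV by auto
    then have "k \<le> Defs.degree (2 * n) E x" using mindeg unfolding min_degree_ge_def by blast
    then show ?thesis unfolding deg[OF that] .
  qed
  have min_deg': "k \<le> deg_in E X y" if "y \<in> Y" for y
  proof -
    have "y < 2 * n" using that by (auto simp: Y_def)
    then have "k \<le> Defs.degree (2 * n) E y" using mindeg unfolding min_degree_ge_def by blast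
    then show ?thesis unfolding deg'[OF that] .
  qed
  show ?thesis
  proof (intro conjI impI)
    assume k: "k = p + 2" and n: "n \<ge> 2 * k ^ 2 + 3"
      and rho: "spectral_radius_graph (2 * n) E \<ge> spectral_radius_graph (2 * n) (N_graph n (k - 2))"
    have k2: "2 * k \<le> k ^ 2" using k by (simp add: power2_eq_square)
    have kn: "2 \<le> k" "k \<le> n" "0 < 2 * n" using k n k2 by linarith+
    \<comment> \<open>For \<open>t = 2\<close> the required density
      \<open>2 * n - 1 \<le> 3 * (n - p - 4)\<close> amounts to \<open>n \<ge> 3 * p + 11\<close>,
      and \<open>p = k - 2\<close>.\<close>
    have n5: "n \<ge> 3 * k + 5"
    proof -
      have "2 * p * p + 8 * p + 8 = 2 * k ^ 2" unfolding k by (simp add: power2_eq_square algebra_simps)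
      then show ?thesis using n k by linarith
    qed
    have gt: "spectral_radius_graph (2 * n) E > real n - 1"
      using rho spectral_radius_N_graph_gt[OF kn(1,2)] by linarith
    have "(real n - 1)\<^sup>2 < (spectral_radius_graph (2 * n) E)\<^sup>2"
      using gt kn by (intro power_strict_mono) auto
    then have "real (missing X Y E) < 2 * real n - 1"
      using G.spectral_radius_sq_le[OF V(3) kn(3)] bal by (simp add: power2_eq_square algebra_simps)
    then have miss: "missing X Y E < 2 * n - 1" using kn by linarith
    show "hamilton_biconnected_2p (2 * n) X E p \<or> graph_iso (2 * n) E (N_graph n (k - 2))"
    proof (cases "hamilton_biconnected_2p (2 * n) X E p")
      case not_bic: False
      have "two_of_degree X Y E k \<or> two_of_degree Y X E k \<or>
          (\<exists>x\<in>X. \<exists>y\<in>Y. E x y \<and> deg_in E Y x = k \<and> deg_in E X y = k)"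
        using G.not_biconnected_exceptional[of p 2] V(1) bal min_deg min_deg' not_bic k n5 miss
        by auto
      moreover have "\<not> two_of_degree X Y E k"
        using G.spectral_radius_le_two_defects[OF V(3), of k] gt n bal kn by auto
      moreover have "\<not> two_of_degree Y X E k"
        using S.spectral_radius_le_two_defects[OF V(4), of k] gt n cY kn by auto
      ultimately obtain x y where "x \<in> X" "y \<in> Y" "E x y" "deg_in E Y x = k" "deg_in E X y = k" by blast
      then show ?thesis
        using G.graph_iso_N_graph[of k x y] V(1) bal kn rho by simp
    qed simp
  next
    assume k: "k \<noteq> p + 2" and n: "n \<ge> (k + 2) * (k - p + 1)"
      and rho: "spectral_radius_graph (2 * n) E \<ge> spectral_radius_graph (2 * n) (M_graph n n (n - k) (k - p))"
    define t where "t = k - p"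
    have kt: "k = p + t" "t \<ge> 1" "t \<noteq> 2" using k kp by (auto simp: t_def)
    have n': "n \<ge> (k + 2) * (t + 1)" using n by (simp add: t_def)
    have "(k + 2) * (t + 1) \<ge> (k + 2) * 2" using kt by (intro mult_le_mono2) simp
    then have n2: "n \<ge> 2 * k + 4" using n' by simp
    then have kn: "1 \<le> k" "k \<le> n" "t < n" "0 < 2 * n" using kt by auto
    have gt: "sqrt (real (n * (n - t))) < spectral_radius_graph (2 * n) (M_graph n n (n - k) t)"
      using spectral_radius_M_graph_gt kn kt by simp
    have "real (n * (n - t)) = (sqrt (real (n * (n - t))))\<^sup>2" by simp
    also have "\<dots> < (spectral_radius_graph (2 * n) E)\<^sup>2"
      using gt rho unfolding t_def by (intro power_strict_mono) auto
    finally have "real (n * (n - t)) + real (missing X Y E) < (real n)\<^sup>2"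
      using G.spectral_radius_sq_le[OF V(3) kn(4)] bal by simp
    then have "n * (n - t) + missing X Y E < n * n"
      by (metis of_nat_add of_nat_less_iff of_nat_mult power2_eq_square)
    then have miss: "missing X Y E < n * t"
      using kn(3) by (simp add: diff_mult_distrib2 less_diff_conv2)
    also have "n * t \<le> (t + 1) * (n - p - (t + 2))"
    proof -
      obtain m where m: "n = (k + 2) * (t + 1) + m" using n' le_Suc_ex by blast
      have "n - p - (t + 2) = (k + 2) * t + m" unfolding m kt(1) by simp
      then show ?thesis unfolding m by (simp add: algebra_simps)
    qed
    finally have dense: "missing X Y E < (t + 1) * (n - p - (t + 2))" .
    show "hamilton_biconnected_2p (2 * n) X E p \<or> graph_iso (2 * n) E (M_graph n n (n - k) (k - p))"
    proof (cases "hamilton_biconnected_2p (2 * n) X E p")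
      case not_bic: False
      have "(\<exists>S\<subseteq>X. \<exists>C\<subseteq>Y. card S = t \<and> card C = k \<and> (\<forall>s\<in>S. \<forall>y\<in>Y. E s y \<longrightarrow> y \<in> C)) \<or>
          (\<exists>S\<subseteq>Y. \<exists>C\<subseteq>X. card S = t \<and> card C = k \<and> (\<forall>s\<in>S. \<forall>x\<in>X. E s x \<longrightarrow> x \<in> C))"
        using G.not_biconnected_exceptional[of p t] V(1) bal min_deg min_deg' not_bic kt n2 dense
        by auto
      then show ?thesis
      proof (elim disjE exE conjE)
        fix S C assume "S \<subseteq> X" "C \<subseteq> Y" "card S = t" "card C = k" "\<forall>s\<in>S. \<forall>y\<in>Y. E s y \<longrightarrow> y \<in> C"
        then show ?thesis
          using G.graph_iso_M_graph[of k t S C] V(1) bal kn rho unfolding t_def by simp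
      next
        fix S C assume "S \<subseteq> Y" "C \<subseteq> X" "card S = t" "card C = k" "\<forall>s\<in>S. \<forall>y\<in>X. E s y \<longrightarrow> y \<in> C"
        then show ?thesis
          using S.graph_iso_M_graph[of k t S C] V(2) cY kn rho unfolding t_def by simp
      qed
    qed simp
  qed
qed

end
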